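(* Let $n\geq 1$ be a natural number, let $p,q$ be real numbers with $1<p\leq 2$ and $1<q\leq p-1+\frac{p}{n}$, and let $\mathbb{S}=(0,+\infty)\times\mathbb{R}^n$. Let $u$ be an entire weak super-solution of the Cauchy problem in $\mathbb{S}$ for the equation $$w_t-\Delta_p(w)=|w|^{q-1}w$$ with initial data $u_0$ on $\{t=0\}$, and let $v$ be an entire weak sub-solution of the Cauchy problem in $\mathbb{S}$ for the same equation with initial data $v_0$ on $\{t=0\}$, where $u_0$ and $v_0$ are possibly different. If $u\geq v$ in $\mathbb{S}$, then $u\equiv v$ in $\mathbb{S}$.
   Context: Points of $\mathbb{S}=(0,+\infty)\times\mathbb{R}^n$ are written $(t,x)$ with $t>0$, $x=(x_1,\dots,x_n)\in\mathbb{R}^n$. The $p$-Laplacian is $\Delta_p(w):=\mathrm{div}_x\left(|\nabla_x w|^{p-2}\nabla_x w\right)$, where $\nabla_x w=(w_{x_1},\dots,w_{x_n})$ is the gradient in the $x$ variables; the vector $|\nabla_x w|^{p-2}\nabla_x w$ is taken to be $0$ where $\nabla_x w=0$. Derivatives of $u$ and $v$ are understood in the weak (distributional) sense. Functions are real-valued, and inequalities and identities between measurable functions are understood almost everywhere in $\mathbb{S}$. Entire weak super-solution of the equation: a measurable function $u=u(t,x)$ defined in $\mathbb{S}$ is called an entire weak super-solution of $w_t-\Delta_p(w)=|w|^{q-1}w$ in $\mathbb{S}$ if $u\in L_{q,loc}(\mathbb{S})$, $u_t\in L_{1,loc}(\mathbb{S})$, $|\nabla_x u|^{p}\in L_{1,loc}(\mathbb{S})$,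 and $$\int_{\mathbb{S}}\left[u_t\varphi+\sum_{i=1}^n|\nabla_x u|^{p-2}u_{x_i}\varphi_{x_i}-|u|^{q-1}u\,\varphi\right]dt\,dx\geq 0$$ for every non-negative function $\varphi\in C^\infty(\mathbb{S})$ with compact support in $\mathbb{S}$. Here "loc" refers to compact subsets of the open set $\mathbb{S}$. Entire weak sub-solution of the equation: a function $v=v(t,x)$ is an entire weak sub-solution of the equation if $-v$ is an entire weak super-solution of the equation. Cauchy problem: an entire weak super-solution (respectively sub-solution) of the Cauchy problem with initial data $u_0$ (respectively $v_0$) is an entire weak super-solution (respectively sub-solution) of the equation in $\mathbb{S}$, in the sense above, which in addition satisfies the initial condition $u(0,\cdot)=u_0$ (respectively $v(0,\cdot)=v_0$) on $\mathbb{R}^n$. The initial condition may be understood in any fixed sense, that is, as an arbitrary relation between a function on $\mathbb{S}$ and its initial data; the statement is asserted for every such choice. No growth conditions at infinity are imposed. *)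

theory Defs
  imports "HOL-Analysis.Analysis"
begin

text \<open>
  Functions on an open set \<open>S\<close> are represented by total functions whose values outside \<open>S\<close>
  are irrelevant, except for test functions, which are extended by zero.
\<close>

text \<open>The following two notions are meant for open \<open>S\<close> only.\<close>

fun C_k_on :: "nat \<Rightarrow> 'a::euclidean_space set \<Rightarrow> ('a \<Rightarrow> real) \<Rightarrow> bool" where
  "C_k_on 0 S f \<longleftrightarrow> continuous_on S f"
| "C_k_on (Suc k) S f \<longleftrightarrow>
     (\<forall>x\<in>S. f differentiable (at x)) \<and>
     (\<forall>b\<in>Basis. C_k_on k S (\<lambda>x. frechet_derivative f (at x) b))"

definition smooth_on :: "'a::euclidean_space set \<Rightarrow> ('a \<Rightarrow> real) \<Rightarrow> bool" where
  "smooth_on S f \<longleftrightarrow> (\<forall>k. C_k_on k S f)"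

definition test_function :: "'a::euclidean_space set \<Rightarrow> ('a \<Rightarrow> real) \<Rightarrow> bool" where
  "test_function S \<phi> \<longleftrightarrow>
     smooth_on S \<phi> \<and> compact (closure {z. \<phi> z \<noteq> 0}) \<and> closure {z. \<phi> z \<noteq> 0} \<subseteq> S"

definition L_loc :: "real \<Rightarrow> 'a::euclidean_space set \<Rightarrow> ('a \<Rightarrow> real) \<Rightarrow> bool" where
  "L_loc r S f \<longleftrightarrow>
     f \<in> borel_measurable (lebesgue_on S) \<and>
     (\<forall>K. compact K \<and> K \<subseteq> S \<longrightarrow> set_integrable lebesgue K (\<lambda>z. \<bar>f z\<bar> powr r))"

definition weak_derivative_on ::
    "'a::euclidean_space set \<Rightarrow> 'a \<Rightarrow> ('a \<Rightarrow> real) \<Rightarrow> ('a \<Rightarrow> real) \<Rightarrow> bool" where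
  "weak_derivative_on S b u g \<longleftrightarrow>
     L_loc 1 S u \<and> L_loc 1 S g \<and>
     (\<forall>\<phi>. test_function S \<phi> \<longrightarrow>
        (LINT z:S|lebesgue. u z * frechet_derivative \<phi> (at z) b) =
        - (LINT z:S|lebesgue. g z * \<phi> z))"

definition half_space :: "(real \<times> (real ^ 'n)) set" where
  "half_space = {0<..} \<times> UNIV"

abbreviation time_dir :: "real \<times> (real ^ 'n)" where
  "time_dir \<equiv> (1, 0)"

abbreviation space_dir :: "'n \<Rightarrow> real \<times> (real ^ 'n)" where
  "space_dir i \<equiv> (0, axis i 1)"

definition weak_gradient_x ::
    "(real \<times> (real ^ 'n) \<Rightarrow> real) \<Rightarrow> (real \<times> (real ^ 'n) \<Rightarrow> real ^ 'n) \<Rightarrow> bool" where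
  "weak_gradient_x u Du \<longleftrightarrow>
     (\<forall>i. weak_derivative_on half_space (space_dir i) u (\<lambda>z. Du z $ i))"

text \<open>
  Weak derivatives are unique up to null sets, so the existential quantifiers below merely name
  \<open>u\<^sub>t\<close> and \<open>\<nabla>\<^sub>x u\<close>. Since \<open>0 powr r = 0\<close>, the flux \<open>\<bar>\<nabla>\<^sub>x u\<bar>\<^sup>p\<^sup>-\<^sup>2 \<nabla>\<^sub>x u\<close> vanishes where
  \<open>\<nabla>\<^sub>x u = 0\<close>, also for \<open>p \<le> 2\<close>.
\<close>

definition entire_weak_supersolution ::
    "real \<Rightarrow> real \<Rightarrow> (real \<times> (real ^ 'n) \<Rightarrow> real) \<Rightarrow> bool" where
  "entire_weak_supersolution p q u \<longleftrightarrow>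
     L_loc q half_space u \<and>
     (\<exists>ut Du.
        weak_derivative_on half_space time_dir u ut \<and>
        weak_gradient_x u Du \<and>
        L_loc 1 half_space (\<lambda>z. norm (Du z) powr p) \<and>
        (\<forall>\<phi>. test_function half_space \<phi> \<and> (\<forall>z. 0 \<le> \<phi> z) \<longrightarrow>
           0 \<le> (LINT z:half_space|lebesgue.
                  ut z * \<phi> z
                  + (\<Sum>i\<in>UNIV. norm (Du z) powr (p - 2) * Du z $ i
                                * frechet_derivative \<phi> (at z) (space_dir i))
                  - \<bar>u z\<bar> powr (q - 1) * u z * \<phi> z)))"

definition entire_weak_subsolution ::
    "real \<Rightarrow> real \<Rightarrow> (real \<times> (real ^ 'n) \<Rightarrow> real) \<Rightarrow> bool" where
  "entire_weak_subsolution p q v \<longleftrightarrow> entire_weak_supersolution p q (\<lambda>z. - v z)"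

text \<open>
  The relation \<open>IC\<close> fixes the sense in which a function on the half-space attains its initial
  data: \<open>IC w w\<^sub>0\<close> reads \<open>w(0,\<cdot>) = w\<^sub>0\<close>.
\<close>

definition cauchy_supersolution ::
    "((real \<times> (real ^ 'n) \<Rightarrow> real) \<Rightarrow> (real ^ 'n \<Rightarrow> real) \<Rightarrow> bool) \<Rightarrow> real \<Rightarrow> real \<Rightarrow>
     (real ^ 'n \<Rightarrow> real) \<Rightarrow> (real \<times> (real ^ 'n) \<Rightarrow> real) \<Rightarrow> bool" where
  "cauchy_supersolution IC p q u0 u \<longleftrightarrow> entire_weak_supersolution p q u \<and> IC u u0"

definition cauchy_subsolution ::
    "((real \<times> (real ^ 'n) \<Rightarrow> real) \<Rightarrow> (real ^ 'n \<Rightarrow> real) \<Rightarrow> bool) \<Rightarrow> real \<Rightarrow> real \<Rightarrow>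
     (real ^ 'n \<Rightarrow> real) \<Rightarrow> (real \<times> (real ^ 'n) \<Rightarrow> real) \<Rightarrow> bool" where
  "cauchy_subsolution IC p q v0 v \<longleftrightarrow> entire_weak_subsolution p q v \<and> IC v v0"

end

theory Submission
  imports Defs "HOL-Real_Asymp.Real_Asymp"
begin

text \<open>
  Put \<open>w = u - v\<close>, \<open>F = A(\<nabla>u) - A(\<nabla>v)\<close> with \<open>A(\<xi>) = \<bar>\<xi>\<bar>\<^sup>p\<^sup>-\<^sup>2 \<xi>\<close>, and
  \<open>G = \<bar>u\<bar>\<^sup>q\<^sup>-\<^sup>1 u - \<bar>v\<bar>\<^sup>q\<^sup>-\<^sup>1 v\<close>. Then \<open>w \<ge> 0\<close> satisfies \<open>w\<^sub>t - div F \<ge> G\<close> weakly, and two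
  pointwise inequalities replace the structure that the difference of two solutions has lost:
  \<open>G \<ge> 2\<^sup>-\<^sup>q w\<^sup>q\<close>, and, because \<open>p \<le> 2\<close>, \<open>F \<bullet> \<nabla>w \<ge> c \<bar>F\<bar>\<^sup>p\<^sup>/\<^sup>(\<^sup>p\<^sup>-\<^sup>1\<^sup>)\<close>
  (\<open>reaction_lower_bound\<close>, \<open>plap_flux_monotone\<close>). Both come from one strong monotonicity
  inequality for \<open>\<bar>y\<bar>\<^sup>r\<^sup>-\<^sup>2 y\<close> with \<open>r \<ge> 2\<close>; for the flux it is applied to the inverse map of \<open>A\<close>,
  whose exponent \<open>p / (p - 1)\<close> is at least 2.

  Testing with \<open>(w + d)\<^sup>-\<^sup>e \<phi>\<close>, where \<open>d > 0\<close>, \<open>0 \<le> e < 1\<close> and \<open>\<phi>\<close> is a \<open>C\<^sup>1\<close> cutoff, gives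
  \<open>\<integral> G (w+d)\<^sup>-\<^sup>e \<phi> + e \<integral> (F \<bullet> \<nabla>w) (w+d)\<^sup>-\<^sup>e\<^sup>-\<^sup>1 \<phi> \<le> \<integral> (F \<bullet> \<nabla>\<phi>) (w+d)\<^sup>-\<^sup>e - 1/(1-e) \<integral> (w+d)\<^sup>1\<^sup>-\<^sup>e \<phi>\<^sub>t\<close>
  (\<open>energy_inequality\<close>, \<open>solution_pair_energy\<close>). To justify it without a chain rule for weak
  derivatives, the weak inequality is tested with the mollifier centred at a point, which makes
  it a pointwise inequality for smooth functions; this is multiplied by the test function,
  integrated by parts classically, and the mollification radius is sent to 0. The product
  \<open>F \<bullet> \<nabla>w\<close> passes to the limit because its mollified version is dominated by the mollifications
  of \<open>\<bar>F\<bar>\<^sup>p\<^sup>/\<^sup>(\<^sup>p\<^sup>-\<^sup>1\<^sup>)\<close> and \<open>\<bar>\<nabla>w\<bar>\<^sup>p\<close>, which converge in \<open>L\<^sup>1\<close>.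

  The conclusion is a test function argument of Fujita type (\<open>energy_estimate_imp_zero\<close>). The
  cutoff has length scale \<open>R\<close> in space and \<open>T\<close> in time, and the equation fixes a scale \<open>W\<close> for
  \<open>w\<close>: \<open>R\<^sup>p W\<^sup>q\<^sup>-\<^sup>p\<^sup>+\<^sup>1 = 1\<close> and \<open>T = W\<^sup>1\<^sup>-\<^sup>q\<close>. The assumption on \<open>q\<close> says exactly that
  \<open>W\<^sup>q T R\<^sup>n \<le> 1\<close> for \<open>R \<ge> 1\<close>. The cutoff also vanishes near \<open>t = 0\<close>, but there it increases in
  time, so this part has the good sign and no initial data enter. With a small \<open>e > 0\<close>, Young's
  inequality absorbs the right-hand side and bounds the weighted dissipation
  \<open>W\<^sup>e \<integral> (F \<bullet> \<nabla>w) (w+d)\<^sup>-\<^sup>e\<^sup>-\<^sup>1 \<phi>\<close> uniformly in \<open>R\<close>. With \<open>e = 0\<close>, the right-hand side is at most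
  \<open>\<mu>\<close> times this dissipation, plus \<open>M\<close> times the integral of \<open>(w+d)\<^sup>q \<phi>\<close> over the far region,
  where \<open>t > T\<close> or \<open>\<bar>x\<bar> > R\<close>, plus a constant that tends to 0 as \<open>M \<rightarrow> \<infinity>\<close> for fixed \<open>\<mu>\<close>. A
  suitable \<open>M\<close> shows that \<open>w\<^sup>q\<close> is integrable; then \<open>R \<rightarrow> \<infinity>\<close> removes the far integral, and
  \<open>M \<rightarrow> \<infinity>\<close>, \<open>\<mu> \<rightarrow> 0\<close> give \<open>\<integral> w\<^sup>q = 0\<close>. This second step is what covers the critical \<open>q\<close>.
\<close>

section \<open>Algebraic inequalities\<close>

text \<open>
  With \<open>a = \<bar>y\<bar>\<^sup>r\<^sup>-\<^sup>2\<close> and \<open>b = \<bar>z\<bar>\<^sup>r\<^sup>-\<^sup>2\<close>, the inner product equals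
  \<open>(a + b)/2 \<bar>y - z\<bar>\<^sup>2 + (a - b)/2 (\<bar>y\<bar>\<^sup>2 - \<bar>z\<bar>\<^sup>2)\<close>. The last term is nonnegative, and
  \<open>a + b \<ge> (\<bar>y - z\<bar>/2)\<^sup>r\<^sup>-\<^sup>2\<close> since one of the two vectors has at least half the length of \<open>y - z\<close>.
\<close>

lemma power_monotone_inner:
  fixes y z :: "'a::real_inner"
  assumes r: "2 \<le> r"
  shows "2 powr (1 - r) * norm (y - z) powr r
           \<le> (norm y powr (r - 2) *\<^sub>R y - norm z powr (r - 2) *\<^sub>R z) \<bullet> (y - z)"
proof -
  define a where "a = norm y powr (r - 2)"
  define b where "b = norm z powr (r - 2)"
  define m where "m = max (norm y) (norm z)"
  have m0: "0 \<le> m" by (simp add: m_def le_max_iff_disj)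
  have ab: "0 \<le> a" "0 \<le> b" by (auto simp: a_def b_def)
  have id: "(a *\<^sub>R y - b *\<^sub>R z) \<bullet> (y - z)
      = (a + b) / 2 * (norm (y - z))\<^sup>2 + (a - b) / 2 * ((norm y)\<^sup>2 - (norm z)\<^sup>2)"
    by (simp add: power2_norm_eq_inner inner_diff_left inner_diff_right inner_commute field_simps)
  have cross: "0 \<le> (a - b) / 2 * ((norm y)\<^sup>2 - (norm z)\<^sup>2)"
  proof (cases "norm z \<le> norm y")
    case True
    then have "b \<le> a" "(norm z)\<^sup>2 \<le> (norm y)\<^sup>2"
      using r by (auto simp: a_def b_def powr_mono2 power_mono)
    then show ?thesis by simp
  next
    case False
    then have "a \<le> b" "(norm y)\<^sup>2 \<le> (norm z)\<^sup>2"
      using r by (auto simp: a_def b_def powr_mono2 power_mono)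
    then show ?thesis by (simp add: mult_nonpos_nonpos)
  qed
  show ?thesis
  proof (cases "y = z")
    case False
    then have d0: "0 < norm (y - z)" by simp
    have dm: "norm (y - z) / 2 \<le> m"
      using norm_triangle_ineq4[of y z] by (auto simp: m_def)
    have "(norm (y - z) / 2) powr (r - 2) \<le> m powr (r - 2)"
      using dm r by (intro powr_mono2) auto
    also have "\<dots> \<le> a + b"
      using ab by (auto simp: m_def a_def b_def max_def)
    finally have le: "(norm (y - z) / 2) powr (r - 2) \<le> a + b" .
    have "2 powr (1 - r) * norm (y - z) powr r
        = (norm (y - z) / 2) powr (r - 2) / 2 * (norm (y - z))\<^sup>2"
      using d0 by (simp add: powr_divide powr_diff field_simps power2_eq_square)
    also have "\<dots> \<le> (a + b) / 2 * (norm (y - z))\<^sup>2"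
      using le by (intro mult_right_mono) auto
    also have "\<dots> \<le> (a *\<^sub>R y - b *\<^sub>R z) \<bullet> (y - z)"
      using id cross by simp
    finally show ?thesis by (simp add: a_def b_def)
  qed auto
qed

lemma reaction_lower_bound:
  fixes a b :: real
  assumes q: "1 < q" and ab: "b \<le> a"
  shows "2 powr (- q) * (a - b) powr q \<le> \<bar>a\<bar> powr (q - 1) * a - \<bar>b\<bar> powr (q - 1) * b"
proof (cases "a = b")
  case False
  with ab have d: "0 < a - b" by simp
  have "2 powr (1 - (q + 1)) * norm (a - b) powr (q + 1)
      \<le> (norm a powr (q + 1 - 2) *\<^sub>R a - norm b powr (q + 1 - 2) *\<^sub>R b) \<bullet> (a - b)"
    using q by (intro power_monotone_inner) auto
  then have "(2 powr (- q) * (a - b) powr q) * (a - b)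
      \<le> (\<bar>a\<bar> powr (q - 1) * a - \<bar>b\<bar> powr (q - 1) * b) * (a - b)"
    using d by (simp add: powr_add)
  then show ?thesis using d by simp
qed simp

text \<open>
  The map \<open>\<xi> \<mapsto> \<bar>\<xi>\<bar>\<^sup>p\<^sup>-\<^sup>2 \<xi>\<close>; the \<open>p\<close>-Laplacian of \<open>w\<close> is the divergence of its value at \<open>\<nabla>w\<close>. It vanishes at 0
  because of the scalar factor \<open>\<xi>\<close>, whatever the value of \<open>0 powr (p - 2)\<close>.
\<close>

definition plap_flux :: "real \<Rightarrow> 'a::real_inner \<Rightarrow> 'a" where
  "plap_flux p \<xi> = norm \<xi> powr (p - 2) *\<^sub>R \<xi>"

lemma norm_plap_flux:
  assumes "1 < p" shows "norm (plap_flux p \<xi>) = norm \<xi> powr (p - 1)"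
proof (cases "\<xi> = 0")
  case False
  then show ?thesis
    by (simp add: plap_flux_def powr_diff power2_eq_square)
qed (use assms in \<open>simp add: plap_flux_def\<close>)

lemma plap_flux_dual:
  assumes p: "1 < p"
  shows "norm (plap_flux p \<xi>) powr (p / (p - 1) - 2) *\<^sub>R plap_flux p \<xi> = \<xi>"
proof (cases "\<xi> = 0")
  case False
  have e: "(p - 1) * (p / (p - 1) - 2) + (p - 2) = 0" using p by (simp add: field_simps)
  have "norm (plap_flux p \<xi>) powr (p / (p - 1) - 2) * norm \<xi> powr (p - 2)
      = norm \<xi> powr ((p - 1) * (p / (p - 1) - 2) + (p - 2))"
    using p by (simp add: norm_plap_flux powr_powr powr_add)
  also have "\<dots> = 1" using e False by simp
  finally have "norm (plap_flux p \<xi>) powr (p / (p - 1) - 2) * norm \<xi> powr (p - 2) = 1" .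
  then show ?thesis by (simp add: plap_flux_def)
qed (simp add: plap_flux_def)

lemma plap_flux_monotone:
  fixes \<xi> \<eta> :: "'a::real_inner"
  assumes p: "1 < p" "p \<le> 2"
  shows "2 powr (1 - p / (p - 1)) * norm (plap_flux p \<xi> - plap_flux p \<eta>) powr (p / (p - 1))
      \<le> (plap_flux p \<xi> - plap_flux p \<eta>) \<bullet> (\<xi> - \<eta>)"
proof -
  have "2 \<le> p / (p - 1)" using p by (simp add: field_simps)
  from power_monotone_inner[OF this, of "plap_flux p \<xi>" "plap_flux p \<eta>"]
  show ?thesis using p by (simp add: plap_flux_dual inner_commute)
qed

text \<open>
  The three factors \<open>\<mu>X\<close>, \<open>MY\<close> and the constant carry exponents of sum 1, so their weighted
  geometric mean is at most their maximum. The constant is explicit because its decay in \<open>M\<close> matters.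
\<close>

lemma young_three:
  fixes X Y \<alpha> \<beta> \<mu> M :: real
  assumes "0 \<le> X" "0 \<le> Y" "0 \<le> \<alpha>" "0 \<le> \<beta>" "\<alpha> + \<beta> < 1" "0 < \<mu>" "0 < M"
  shows "X powr \<alpha> * Y powr \<beta>
    \<le> \<mu> * X + M * Y + (\<mu> powr (- \<alpha>) * M powr (- \<beta>)) powr (1 / (1 - \<alpha> - \<beta>))"
proof -
  define g where "g = 1 - \<alpha> - \<beta>"
  define D where "D = (\<mu> powr (- \<alpha>) * M powr (- \<beta>)) powr (1 / g)"
  define m where "m = max (\<mu> * X) (max (M * Y) D)"
  have g: "0 < g" using assms by (simp add: g_def)
  have D0: "0 < D" using assms by (simp add: D_def)
  have m0: "0 < m" using D0 by (simp add: m_def)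
  have "X powr \<alpha> * Y powr \<beta> = (\<mu> * X) powr \<alpha> * (M * Y) powr \<beta> * D powr g"
    using assms g by (simp add: D_def powr_powr powr_mult powr_minus field_simps)
  also have "\<dots> \<le> m powr \<alpha> * m powr \<beta> * m powr g"
    using assms g D0 by (intro mult_mono powr_mono2) (auto simp: m_def)
  also have "\<dots> = m powr (\<alpha> + \<beta> + g)" by (simp add: powr_add)
  also have "\<dots> = m" using m0 by (simp add: g_def)
  also have "\<dots> \<le> \<mu> * X + M * Y + D" using assms D0 by (auto simp: m_def)
  finally show ?thesis by (simp add: D_def g_def)
qed

section \<open>A smooth mollifier\<close>

text \<open>
  The functions \<open>exp(-1/x) / x\<^sup>k\<close>, extended by 0 to \<open>x \<le> 0\<close>. Up to linear combinations the family is
  closed under differentiation, which gives smoothness without computing higher derivatives.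
\<close>

definition flat_exp :: "nat \<Rightarrow> real \<Rightarrow> real" where
  "flat_exp k x = (if 0 < x then exp (- 1 / x) / x ^ k else 0)"

lemma flat_exp_tendsto_0: "(flat_exp k \<longlongrightarrow> 0) (at 0)"
proof -
  have "((\<lambda>x::real. exp (- 1 / x) / x ^ k) \<longlongrightarrow> 0) (at_right 0)"
    by real_asymp
  then have r: "(flat_exp k \<longlongrightarrow> 0) (at_right 0)"
    by (rule Lim_transform_eventually) (auto simp: flat_exp_def eventually_at_filter)
  have l: "(flat_exp k \<longlongrightarrow> 0) (at_left 0)"
    by (rule Lim_transform_eventually[OF tendsto_const]) (auto simp: flat_exp_def eventually_at_filter)
  show ?thesis using l r by (simp add: filterlim_split_at)
qed

lemma flat_exp_has_derivative:
  "(flat_exp k has_real_derivative (flat_exp (k + 2) x - real k * flat_exp (k + 1) x)) (at x)"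
proof -
  consider "0 < x" | "x < 0" | "x = 0" by linarith
  then show ?thesis
  proof cases
    case 1
    have "((\<lambda>x. exp (- 1 / x) / x ^ k) has_real_derivative
        (exp (- 1 / x) * (1 / x^2) * x ^ k - exp (- 1 / x) * (real k * x ^ (k - 1))) / (x ^ k * x ^ k)) (at x)"
      using 1 by (auto intro!: derivative_eq_intros simp: power2_eq_square)
    also have "(exp (- 1 / x) * (1 / x^2) * x ^ k - exp (- 1 / x) * (real k * x ^ (k - 1))) / (x ^ k * x ^ k)
        = flat_exp (k + 2) x - real k * flat_exp (k + 1) x"
      using 1 by (cases k) (simp_all add: flat_exp_def field_simps power2_eq_square)
    finally show ?thesis
      by (rule has_field_derivative_transform_within_open[where S = "{0<..}"])
         (use 1 in \<open>auto simp: flat_exp_def\<close>)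
  next
    case 2
    have "((\<lambda>x::real. 0) has_real_derivative 0) (at x)" by simp
    then have "(flat_exp k has_real_derivative 0) (at x)"
      by (rule has_field_derivative_transform_within_open[where S = "{..<0}"])
         (use 2 in \<open>auto simp: flat_exp_def\<close>)
    then show ?thesis using 2 by (simp add: flat_exp_def)
  next
    case 3
    have "((\<lambda>y. (flat_exp k y - flat_exp k 0) / (y - 0)) \<longlongrightarrow> 0) (at 0)"
      by (rule Lim_transform_eventually[OF flat_exp_tendsto_0[of "k + 1"]])
         (auto simp: flat_exp_def eventually_at_filter)
    then show ?thesis using 3 by (simp add: has_field_derivative_iff flat_exp_def)
  qed
qed

lemma flat_exp_nonneg: "0 \<le> flat_exp k x" by (simp add: flat_exp_def)

lemma continuous_flat_exp: "continuous_on A (flat_exp k)"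
  by (meson DERIV_isCont continuous_at_imp_continuous_on flat_exp_has_derivative)

text \<open>
  An algebra of functions that contains the bump functions and is closed under directional
  derivatives. A class with this property consists of smooth functions.
\<close>

inductive_set bump_algebra :: "('a::euclidean_space \<Rightarrow> real) set" where
  const: "(\<lambda>_. c) \<in> bump_algebra"
| coord: "(\<lambda>z. z \<bullet> b) \<in> bump_algebra"
| core: "(\<lambda>z. flat_exp k (c - (norm (z - a))\<^sup>2)) \<in> bump_algebra"
| sum: "f \<in> bump_algebra \<Longrightarrow> g \<in> bump_algebra \<Longrightarrow> (\<lambda>z. f z + g z) \<in> bump_algebra"
| mult: "f \<in> bump_algebra \<Longrightarrow> g \<in> bump_algebra \<Longrightarrow> (\<lambda>z. f z * g z) \<in> bump_algebra"

lemma bump_core_has_derivative: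
  "((\<lambda>z. flat_exp k (c - (norm (z - a))\<^sup>2)) has_derivative
     (\<lambda>h. (flat_exp (k + 2) (c - (norm (z - a))\<^sup>2) - real k * flat_exp (k + 1) (c - (norm (z - a))\<^sup>2))
            * (- 2 * ((z - a) \<bullet> h)))) (at (z :: 'a::real_inner))"
proof -
  have "((\<lambda>z. c - (norm (z - a))\<^sup>2) has_derivative (\<lambda>h. - 2 * ((z - a) \<bullet> h))) (at z)"
    unfolding power2_norm_eq_inner
    by (auto intro!: derivative_eq_intros simp: inner_commute)
  from has_derivative_compose[OF this
      flat_exp_has_derivative[of k "c - (norm (z - a))\<^sup>2", THEN has_field_derivative_imp_has_derivative]]
  show ?thesis by simp
qed

lemma bump_algebra_derivative:
  assumes "f \<in> bump_algebra"
  shows "\<exists>f'. (\<forall>z. (f has_derivative f' z) (at z)) \<and> (\<forall>b. (\<lambda>z. f' z b) \<in> bump_algebra)"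
  using assms
proof induction
  case (const c)
  show ?case
    by (rule exI[of _ "\<lambda>_ _. 0"]) (auto intro: bump_algebra.const)
next
  case (coord b)
  show ?case
    by (rule exI[of _ "\<lambda>_ h. h \<bullet> b"]) (auto intro!: bump_algebra.const derivative_eq_intros)
next
  case (core k c a)
  have lin: "(\<lambda>z. - 2 * ((z - a) \<bullet> b)) \<in> bump_algebra" for b :: 'a
  proof -
    have "(\<lambda>z. (- 2) * (z \<bullet> b + (- (a \<bullet> b)))) \<in> bump_algebra"
      by (intro bump_algebra.intros)
    then show ?thesis by (simp add: inner_diff_left)
  qed
  have fe: "(\<lambda>z. flat_exp (k + 2) (c - (norm (z - a))\<^sup>2)
      - real k * flat_exp (k + 1) (c - (norm (z - a))\<^sup>2)) \<in> bump_algebra"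
  proof -
    have "(\<lambda>z. flat_exp (k + 2) (c - (norm (z - a))\<^sup>2)
        + (- real k) * flat_exp (k + 1) (c - (norm (z - a))\<^sup>2)) \<in> bump_algebra"
      by (intro bump_algebra.intros)
    then show ?thesis by simp
  qed
  show ?case
    by (rule exI[where x = "\<lambda>z h. (flat_exp (k + 2) (c - (norm (z - a))\<^sup>2)
        - real k * flat_exp (k + 1) (c - (norm (z - a))\<^sup>2)) * (- 2 * ((z - a) \<bullet> h))"])
       (use bump_core_has_derivative[of k c a] bump_algebra.mult[OF fe lin] in blast)
next
  case (sum f g)
  then obtain f' g' where
    "\<And>z. (f has_derivative f' z) (at z)" "\<And>b. (\<lambda>z. f' z b) \<in> bump_algebra"
    "\<And>z. (g has_derivative g' z) (at z)" "\<And>b. (\<lambda>z. g' z b) \<in> bump_algebra" by blast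
  then show ?case
    by (intro exI[of _ "\<lambda>z h. f' z h + g' z h"])
       (auto intro!: bump_algebra.sum has_derivative_add)
next
  case (mult f g)
  then obtain f' g' where
    "\<And>z. (f has_derivative f' z) (at z)" "\<And>b. (\<lambda>z. f' z b) \<in> bump_algebra"
    "\<And>z. (g has_derivative g' z) (at z)" "\<And>b. (\<lambda>z. g' z b) \<in> bump_algebra" by blast
  with mult show ?case
    by (intro exI[of _ "\<lambda>z h. f z * g' z h + f' z h * g z"])
       (auto intro!: bump_algebra.sum bump_algebra.mult has_derivative_mult)
qed

lemma bump_algebra_C_k: "f \<in> bump_algebra \<Longrightarrow> C_k_on k S f"
proof (induction k arbitrary: f)
  case 0
  then obtain f' where "\<And>z. (f has_derivative f' z) (at z)"
    using bump_algebra_derivative by blast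
  then show ?case
    by (metis C_k_on.simps(1) continuous_at_imp_continuous_on has_derivative_continuous)
next
  case (Suc k)
  obtain f' where f': "\<And>z. (f has_derivative f' z) (at z)" "\<And>b. (\<lambda>z. f' z b) \<in> bump_algebra"
    using bump_algebra_derivative[OF Suc.prems] by blast
  have "frechet_derivative f (at z) = f' z" for z
    using frechet_derivative_at[OF f'(1)] by simp
  then show ?case
    using Suc.IH f' by (auto simp: differentiable_def)
qed

lemma bump_algebra_smooth: "f \<in> bump_algebra \<Longrightarrow> smooth_on S f"
  by (simp add: smooth_on_def bump_algebra_C_k)

text \<open>
  A smooth radial function, positive on the open ball of radius \<open>r\<close> around 0 and zero outside of it.
\<close>

definition bump :: "real \<Rightarrow> 'a::euclidean_space \<Rightarrow> real" where
  "bump r z = flat_exp 0 (r\<^sup>2 - (norm z)\<^sup>2)"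

text \<open>
  The mollifier of radius \<open>r\<close>, that is, the bump function normalized to integral 1.
\<close>

definition mker :: "real \<Rightarrow> 'a::euclidean_space \<Rightarrow> real" where
  "mker r z = bump r z / integral\<^sup>L lborel (bump r :: 'a \<Rightarrow> real)"

text \<open>
  The derivative of the mollifier at \<open>z\<close> in the direction \<open>b\<close>.
\<close>

definition mker_deriv :: "real \<Rightarrow> 'a::euclidean_space \<Rightarrow> 'a \<Rightarrow> real" where
  "mker_deriv r b z =
     - 2 * flat_exp 2 (r\<^sup>2 - (norm z)\<^sup>2) * (z \<bullet> b) / integral\<^sup>L lborel (bump r :: 'a \<Rightarrow> real)"

lemma continuous_bump: "continuous_on A (bump r)"
  unfolding bump_def
  by (rule continuous_on_compose2[OF continuous_flat_exp[of UNIV]]) (auto intro!: continuous_intros)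

lemma bump_eq_0: "0 < r \<Longrightarrow> r \<le> norm z \<Longrightarrow> bump r z = 0"
  by (smt (verit) bump_def flat_exp_def power_mono)

lemma bump_integrable:
  assumes "0 < r" shows "integrable lborel (bump r :: 'a::euclidean_space \<Rightarrow> real)"
proof -
  have "integrable lborel (\<lambda>z. indicator (cball 0 r) z *\<^sub>R bump r (z::'a))"
    by (rule borel_integrable_compact) (auto simp: continuous_bump)
  also have "(\<lambda>z. indicator (cball 0 r) z *\<^sub>R bump r (z::'a)) = bump r"
    using bump_eq_0[OF assms, where 'a = 'a] by (force simp: indicator_def fun_eq_iff not_le)
  finally show ?thesis .
qed

lemma bump_nonneg: "0 \<le> bump r z"
  by (simp add: bump_def flat_exp_nonneg)

lemma bump_integral_pos:
  assumes r: "0 < r" shows "0 < integral\<^sup>L lborel (bump r :: 'a::euclidean_space \<Rightarrow> real)"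
proof -
  define c where "c = exp (- 1 / (r\<^sup>2 - (r/2)\<^sup>2))"
  have pos: "0 < r\<^sup>2 - (r/2)\<^sup>2" using r by (simp add: power2_eq_square)
  have le: "c * indicator (ball 0 (r/2)) z \<le> bump r z" for z :: 'a
  proof (cases "z \<in> ball 0 (r/2)")
    case True
    then have "(norm z)\<^sup>2 \<le> (r/2)\<^sup>2" by (intro power_mono) auto
    then have "r\<^sup>2 - (r/2)\<^sup>2 \<le> r\<^sup>2 - (norm z)\<^sup>2" by simp
    then have "1 / (r\<^sup>2 - (norm z)\<^sup>2) \<le> 1 / (r\<^sup>2 - (r/2)\<^sup>2)" "0 < r\<^sup>2 - (norm z)\<^sup>2"
      using pos by (auto intro!: divide_left_mono mult_pos_pos)
    then show ?thesis using True by (simp add: bump_def flat_exp_def c_def)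
  qed (simp add: bump_nonneg)
  have fin: "emeasure lborel (ball (0::'a) (r/2)) < \<infinity>"
    using emeasure_bounded_finite[of "ball (0::'a) (r/2)"] by simp
  have "0 < c * measure lborel (ball (0::'a) (r/2))"
    using content_ball_pos[of "r/2" "0::'a"] r by (simp add: c_def)
  also have "\<dots> = (LINT z|lborel. c * indicator (ball (0::'a) (r/2)) z)"
    using fin by simp
  also have "\<dots> \<le> integral\<^sup>L lborel (bump r :: 'a \<Rightarrow> real)"
  proof (rule Bochner_Integration.integral_mono)
    show "integrable lborel (\<lambda>z. c * indicator (ball (0::'a) (r/2)) z)"
      using fin by (intro integrable_mult_right) auto
  qed (use le bump_integrable[OF r] in auto)
  finally show ?thesis .
qed

lemma mker_nonneg: "0 < r \<Longrightarrow> 0 \<le> mker r (z :: 'a::euclidean_space)"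
  using bump_integral_pos[of r, where 'a = 'a] by (simp add: mker_def bump_nonneg less_imp_le)

lemma mker_eq_0: "0 < r \<Longrightarrow> r \<le> norm z \<Longrightarrow> mker r z = 0"
  by (simp add: mker_def bump_eq_0)

lemma mker_sym: "mker r (- z) = mker r z" "mker r (x - y) = mker r (y - x)"
  by (simp_all add: mker_def bump_def norm_minus_commute)

lemma mker_integrable: "0 < r \<Longrightarrow> integrable lborel (mker r)"
  unfolding mker_def by (auto intro: bump_integrable)

lemma mker_integral:
  assumes "0 < r" shows "integral\<^sup>L lborel (mker r :: 'a::euclidean_space \<Rightarrow> real) = 1"
  using bump_integral_pos[OF assms, where 'a = 'a] by (simp add: mker_def[abs_def])

lemma continuous_mker:
  "0 < r \<Longrightarrow> continuous_on A (mker r :: 'a::euclidean_space \<Rightarrow> real)"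
  unfolding mker_def
  using bump_integral_pos[of r, where 'a = 'a]
  by (intro continuous_intros continuous_bump) (auto simp: less_imp_neq)

lemma continuous_mker_deriv:
  fixes b :: "'a::euclidean_space"
  assumes "0 < r" shows "continuous_on A (mker_deriv r b)"
proof -
  have "continuous_on A (\<lambda>z. flat_exp 2 (r\<^sup>2 - (norm z)\<^sup>2))"
    by (rule continuous_on_compose2[OF continuous_flat_exp[of UNIV]]) (auto intro!: continuous_intros)
  then show ?thesis
    unfolding mker_deriv_def
    using bump_integral_pos[OF assms, where 'a = 'a]
    by (intro continuous_intros) (auto simp: less_imp_neq)
qed

lemma mker_has_derivative:
  fixes z :: "'a::euclidean_space"
  shows "(mker r has_derivative (\<lambda>h. mker_deriv r h z)) (at z)"
proof -
  have "(bump r has_derivative (\<lambda>h. flat_exp 2 (r\<^sup>2 - (norm z)\<^sup>2) * (- 2 * (z \<bullet> h)))) (at z)"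
    using bump_core_has_derivative[of 0 "r\<^sup>2" 0 z]
    by (simp add: bump_def[abs_def] numeral_2_eq_2)
  then have "((\<lambda>z. bump r z / integral\<^sup>L lborel (bump r :: 'a \<Rightarrow> real)) has_derivative
      (\<lambda>h. (flat_exp 2 (r\<^sup>2 - (norm z)\<^sup>2) * (- 2 * (z \<bullet> h))) / integral\<^sup>L lborel (bump r :: 'a \<Rightarrow> real))) (at z)"
    by (rule bounded_linear.has_derivative[OF bounded_linear_divide])
  then show ?thesis by (simp add: mker_def[abs_def] mker_deriv_def mult_ac)
qed

lemma mker_deriv_eq_0: "0 < r \<Longrightarrow> r \<le> norm z \<Longrightarrow> mker_deriv r b z = 0"
  by (smt (verit) mker_deriv_def flat_exp_def power_mono mult_eq_0_iff divide_eq_0_iff)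

lemma bounded_of_compact_support:
  fixes f :: "'a::euclidean_space \<Rightarrow> real"
  assumes "continuous_on UNIV f" "\<And>z. r \<le> norm z \<Longrightarrow> f z = 0"
  shows "\<exists>B. \<forall>z. \<bar>f z\<bar> \<le> B"
proof -
  have "compact (f ` cball 0 r)"
    by (intro compact_continuous_image continuous_on_subset[OF assms(1)]) auto
  then obtain B where "\<And>z. z \<in> cball 0 r \<Longrightarrow> \<bar>f z\<bar> \<le> B" "0 < B"
    using compact_imp_bounded[THEN bounded_pos[THEN iffD1]] by fastforce
  then show ?thesis using assms(2)
    by (metis abs_zero less_eq_real_def linear mem_cball_0)
qed

lemma mker_bounded: "0 < r \<Longrightarrow> \<exists>B. \<forall>z. \<bar>mker r z\<bar> \<le> B"
  by (rule bounded_of_compact_support[where r = r]) (auto simp: continuous_mker mker_eq_0)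

lemma mker_deriv_bounded: "0 < r \<Longrightarrow> \<exists>B. \<forall>z. \<bar>mker_deriv r b z\<bar> \<le> B"
  by (rule bounded_of_compact_support[where r = r]) (auto simp: continuous_mker_deriv mker_deriv_eq_0)

lemma mker_translate_has_derivative:
  "((\<lambda>y. mker r (z - y)) has_derivative (\<lambda>h. - mker_deriv r h (z - y))) (at y)"
proof -
  have "((\<lambda>y. z - y) has_derivative (\<lambda>h. - h)) (at y)"
    by (auto intro!: derivative_eq_intros)
  from has_derivative_compose[OF this mker_has_derivative]
  show ?thesis by (simp add: mker_deriv_def)
qed

text \<open>
  Reflected translates of the mollifier are the only test functions used for the weak formulations.
\<close>

lemma mker_translate_test_function:
  fixes z :: "'a::euclidean_space"
  assumes r: "0 < r" and S: "cball z r \<subseteq> S"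
  shows "test_function S (\<lambda>y. mker r (z - y))"
proof -
  have "(\<lambda>y. inverse (integral\<^sup>L lborel (bump r :: 'a \<Rightarrow> real)) * flat_exp 0 (r\<^sup>2 - (norm (y - z))\<^sup>2))
      \<in> bump_algebra"
    by (intro bump_algebra.intros)
  then have sm: "smooth_on S (\<lambda>y. mker r (z - y))"
    by (simp add: mker_def bump_def field_simps norm_minus_commute bump_algebra_smooth)
  have sub: "{y. mker r (z - y) \<noteq> 0} \<subseteq> cball z r"
    using mker_eq_0[OF r] by (force simp: dist_norm)
  then have cl: "closure {y. mker r (z - y) \<noteq> 0} \<subseteq> cball z r"
    by (simp add: closure_minimal)
  show ?thesis
    unfolding test_function_def
    using sm cl S compact_closure bounded_subset[OF bounded_cball sub] by blast
qed

lemma frechet_derivative_mker_translate: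
  "frechet_derivative (\<lambda>y. mker r (z - y)) (at y) b = - mker_deriv r b (z - y)"
  using frechet_derivative_at[OF mker_translate_has_derivative[of r z y]] by metis

section \<open>Mollification\<close>

lemma lborel_translate:
  fixes f :: "'a::euclidean_space \<Rightarrow> real"
  assumes [measurable]: "f \<in> borel_measurable borel"
  shows "integral\<^sup>L lborel (\<lambda>z. f (z + a)) = integral\<^sup>L lborel f"
    and "integrable lborel (\<lambda>z. f (z + a)) \<longleftrightarrow> integrable lborel f"
proof -
  have "integral\<^sup>L lborel f = integral\<^sup>L (distr lborel borel ((+) a)) f"
    by (simp add: lborel_distr_plus)
  also have "\<dots> = integral\<^sup>L lborel (\<lambda>z. f (z + a))"
    by (subst integral_distr) (auto simp: add.commute)
  finally show "integral\<^sup>L lborel (\<lambda>z. f (z + a)) = integral\<^sup>L lborel f" by simp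
  have "integrable lborel f \<longleftrightarrow> integrable (distr lborel borel ((+) a)) f"
    by (simp add: lborel_distr_plus)
  also have "\<dots> \<longleftrightarrow> integrable lborel (\<lambda>z. f (z + a))"
    by (subst integrable_distr_eq) (auto simp: add.commute)
  finally show "integrable lborel (\<lambda>z. f (z + a)) \<longleftrightarrow> integrable lborel f" by simp
qed

text \<open>
  Mollification of \<open>f\<close> with radius \<open>r\<close>, and (\<open>mol_deriv\<close> below) the convolution of \<open>f\<close> with the
  derivative of the mollifier in the direction \<open>b\<close>. Both are meant for \<open>f\<close> integrable on the
  whole space; local functions are cut off by an indicator function first.
\<close>

definition mol :: "real \<Rightarrow> ('a::euclidean_space \<Rightarrow> real) \<Rightarrow> 'a \<Rightarrow> real" where
  "mol r f z = (LINT y|lebesgue. f y * mker r (z - y))"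

definition mol_deriv :: "real \<Rightarrow> 'a::euclidean_space \<Rightarrow> ('a \<Rightarrow> real) \<Rightarrow> 'a \<Rightarrow> real" where
  "mol_deriv r b f z = (LINT y|lebesgue. f y * mker_deriv r b (z - y))"

lemma continuous_lebesgue_measurable:
  fixes k :: "'a::euclidean_space \<Rightarrow> real"
  assumes "continuous_on UNIV k" shows "k \<in> borel_measurable lebesgue"
  using borel_measurable_continuous_onI[OF assms] by (simp add: measurable_completion)

lemma integrable_mult_bounded:
  fixes f k :: "'a::euclidean_space \<Rightarrow> real"
  assumes f: "integrable lebesgue f" and k: "k \<in> borel_measurable lebesgue"
    and B: "\<And>x. \<bar>k x\<bar> \<le> B"
  shows "integrable lebesgue (\<lambda>y. f y * k y)"
proof (rule Bochner_Integration.integrable_bound[OF integrable_mult_right[OF integrable_abs[OF f], of B]])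
  show "(\<lambda>y. f y * k y) \<in> borel_measurable lebesgue" using f k by measurable
  show "AE x in lebesgue. norm (f x * k x) \<le> norm (B * \<bar>f x\<bar>)"
  proof (rule AE_I2)
    fix x show "norm (f x * k x) \<le> norm (B * \<bar>f x\<bar>)"
      using mult_right_mono[OF order_trans[OF B[of x] abs_ge_self[of B]], of "\<bar>f x\<bar>"]
      by (simp add: abs_mult mult.commute)
  qed
qed

lemma continuous_reflect:
  fixes k :: "'a::euclidean_space \<Rightarrow> real"
  shows "continuous_on UNIV k \<Longrightarrow> continuous_on UNIV (\<lambda>y. k (z - y))"
  by (rule continuous_on_compose2[of UNIV k]) (auto intro!: continuous_intros)

lemma convolution_integrable:
  fixes f k :: "'a::euclidean_space \<Rightarrow> real"
  assumes f: "integrable lebesgue f" and k: "continuous_on UNIV k" and B: "\<And>x. \<bar>k x\<bar> \<le> B"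
  shows "integrable lebesgue (\<lambda>y. f y * k (z - y))"
  by (rule integrable_mult_bounded[OF f, where B = B])
     (auto intro!: continuous_lebesgue_measurable continuous_reflect k B)

lemma convolution_continuous:
  fixes f k :: "'a::euclidean_space \<Rightarrow> real"
  assumes f: "integrable lebesgue f" and k: "continuous_on UNIV k" and B: "\<And>x. \<bar>k x\<bar> \<le> B"
  shows "continuous_on UNIV (\<lambda>z. LINT y|lebesgue. f y * k (z - y))"
proof (rule continuous_at_imp_continuous_on, safe)
  fix z :: 'a
  show "isCont (\<lambda>z. LINT y|lebesgue. f y * k (z - y)) z"
    unfolding continuous_at_sequentially comp_def
  proof safe
    fix X :: "nat \<Rightarrow> 'a" assume X: "X \<longlonglongrightarrow> z"
    have "isCont k x" for x using k by (simp add: continuous_on_eq_continuous_at)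
    then have lim: "(\<lambda>i. f y * k (X i - y)) \<longlonglongrightarrow> f y * k (z - y)" for y
      by (intro tendsto_intros isCont_tendsto_compose[of _ k] X)
    show "(\<lambda>i. LINT y|lebesgue. f y * k (X i - y)) \<longlonglongrightarrow> (LINT y|lebesgue. f y * k (z - y))"
    proof (rule integral_dominated_convergence[where w = "\<lambda>y. B * \<bar>f y\<bar>"])
      show "(\<lambda>y. f y * k (z - y)) \<in> borel_measurable lebesgue"
        "(\<lambda>y. f y * k (X i - y)) \<in> borel_measurable lebesgue" for i
        by (rule borel_measurable_integrable, rule convolution_integrable[OF f k B])+
      show "AE y in lebesgue. norm (f y * k (X i - y)) \<le> B * \<bar>f y\<bar>" for i
        by (rule AE_I2)
           (use B in \<open>simp add: abs_mult mult.commute[of B] mult_left_mono\<close>)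
    qed (use f lim in auto)
  qed
qed

lemma mol_integrand_integrable:
  assumes "0 < r" "integrable lebesgue f"
  shows "integrable lebesgue (\<lambda>y. f y * mker r (z - y))"
proof -
  obtain B where "\<And>x::'a. \<bar>mker r x\<bar> \<le> B" using mker_bounded[OF assms(1)] by blast
  then show ?thesis by (rule convolution_integrable[OF assms(2) continuous_mker[OF assms(1)]])
qed

lemma mol_deriv_integrand_integrable:
  assumes "0 < r" "integrable lebesgue f"
  shows "integrable lebesgue (\<lambda>y. f y * mker_deriv r b (z - y))"
proof -
  obtain B where "\<And>x::'a. \<bar>mker_deriv r b x\<bar> \<le> B" using mker_deriv_bounded[OF assms(1)] by blast
  then show ?thesis by (rule convolution_integrable[OF assms(2) continuous_mker_deriv[OF assms(1)]])
qed

lemma continuous_mol: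
  assumes "0 < r" "integrable lebesgue f"
  shows "continuous_on UNIV (mol r f)"
proof -
  obtain B where "\<And>x::'a. \<bar>mker r x\<bar> \<le> B" using mker_bounded[OF assms(1)] by blast
  then show ?thesis unfolding mol_def
    by (rule convolution_continuous[OF assms(2) continuous_mker[OF assms(1)]])
qed

lemma continuous_mol_deriv:
  assumes "0 < r" "integrable lebesgue f"
  shows "continuous_on UNIV (mol_deriv r b f)"
proof -
  obtain B where "\<And>x::'a. \<bar>mker_deriv r b x\<bar> \<le> B" using mker_deriv_bounded[OF assms(1)] by blast
  then show ?thesis unfolding mol_deriv_def
    by (rule convolution_continuous[OF assms(2) continuous_mker_deriv[OF assms(1)]])
qed

lemma mker_line_derivative:
  "((\<lambda>s. mker r (x + s *\<^sub>R b)) has_real_derivative mker_deriv r b (x + s *\<^sub>R b)) (at s)"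
proof -
  have "((\<lambda>s. x + s *\<^sub>R b) has_derivative (\<lambda>h. h *\<^sub>R b)) (at s)"
    by (auto intro!: derivative_eq_intros)
  from has_derivative_compose[OF this mker_has_derivative]
  show ?thesis
    unfolding has_field_derivative_def
    by (rule has_derivative_eq_rhs) (auto simp: mker_deriv_def)
qed

lemma lipschitz_of_derivative:
  fixes g :: "real \<Rightarrow> real"
  assumes "\<And>s. (g has_real_derivative g' s) (at s)" "\<And>s. \<bar>g' s\<bar> \<le> B"
  shows "\<bar>g t - g s\<bar> \<le> B * \<bar>t - s\<bar>"
  using field_differentiable_bound[of UNIV g g' B t s] assms
  by (auto simp: has_field_derivative_at_within)

lemma mol_line_derivative:
  assumes r: "0 < r" and f: "integrable lebesgue f"
  shows "((\<lambda>s. mol r f (z + s *\<^sub>R b)) has_real_derivative mol_deriv r b f (z + s *\<^sub>R b)) (at s)"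
proof -
  obtain B where B: "\<And>x. \<bar>mker_deriv r b x\<bar> \<le> B" using mker_deriv_bounded[OF r] by blast
  show ?thesis
    unfolding has_field_derivative_iff tendsto_at_iff_sequentially comp_def
  proof safe
    fix X :: "nat \<Rightarrow> real" assume X: "\<forall>i. X i \<in> UNIV - {s}" "X \<longlonglongrightarrow> s"
    let ?q = "\<lambda>i y. f y * ((mker r ((z - y) + X i *\<^sub>R b) - mker r ((z - y) + s *\<^sub>R b)) / (X i - s))"
    have Xs: "X i \<noteq> s" for i using X by auto
    have eq: "(mol r f (z + X i *\<^sub>R b) - mol r f (z + s *\<^sub>R b)) / (X i - s) = integral\<^sup>L lebesgue (?q i)" for i
      unfolding mol_def
      by (subst Bochner_Integration.integral_diff[symmetric])
         (auto intro!: mol_integrand_integrable r f Bochner_Integration.integral_cong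
           simp flip: integral_divide_zero simp: algebra_simps diff_divide_distrib)
    have lim: "(\<lambda>i. ?q i y) \<longlonglongrightarrow> f y * mker_deriv r b (z + s *\<^sub>R b - y)" for y
    proof -
      have "(\<lambda>i. (mker r ((z - y) + X i *\<^sub>R b) - mker r ((z - y) + s *\<^sub>R b)) / (X i - s))
          \<longlonglongrightarrow> mker_deriv r b (z - y + s *\<^sub>R b)"
        using mker_line_derivative[of r "z - y" b s] X
        unfolding has_field_derivative_iff tendsto_at_iff_sequentially comp_def by blast
      then show ?thesis by (intro tendsto_intros) (simp add: algebra_simps)
    qed
    have meas: "?q i \<in> borel_measurable lebesgue" for i
    proof -
      have "integrable lebesgue (\<lambda>y. (f y * mker r (z + X i *\<^sub>R b - y) - f y * mker r (z + s *\<^sub>R b - y)) / (X i - s))"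
        by (intro integrable_divide Bochner_Integration.integrable_diff mol_integrand_integrable r f)
      then have "(\<lambda>y. (f y * mker r (z + X i *\<^sub>R b - y) - f y * mker r (z + s *\<^sub>R b - y)) / (X i - s)) \<in> borel_measurable lebesgue"
        by (rule borel_measurable_integrable)
      then show ?thesis by (simp add: algebra_simps)
    qed
    have "\<bar>mker r ((z - y) + X i *\<^sub>R b) - mker r ((z - y) + s *\<^sub>R b)\<bar> \<le> B * \<bar>X i - s\<bar>" for i y
      by (rule lipschitz_of_derivative[OF mker_line_derivative B])
    then have bd: "\<bar>(mker r ((z - y) + X i *\<^sub>R b) - mker r ((z - y) + s *\<^sub>R b)) / (X i - s)\<bar> \<le> B" for i y
      using Xs[of i] by (simp add: divide_simps)
    show "(\<lambda>i. (mol r f (z + X i *\<^sub>R b) - mol r f (z + s *\<^sub>R b)) / (X i - s)) \<longlonglongrightarrow> mol_deriv r b f (z + s *\<^sub>R b)"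
      unfolding eq mol_deriv_def
    proof (rule integral_dominated_convergence[where w = "\<lambda>y. B * \<bar>f y\<bar>"])
      show "(\<lambda>y. f y * mker_deriv r b (z + s *\<^sub>R b - y)) \<in> borel_measurable lebesgue"
        by (intro borel_measurable_integrable mol_deriv_integrand_integrable r f)
      show "AE y in lebesgue. norm (?q i y) \<le> B * \<bar>f y\<bar>" for i
        using bd[of _ i] by (auto simp only: real_norm_def abs_mult mult.commute[of B] intro!: AE_I2 mult_left_mono)
    qed (use f lim meas in auto)
  qed
qed

lemma mol_nonneg:
  assumes "0 < r" "AE y in lebesgue. 0 \<le> f y" shows "0 \<le> mol r f z"
  unfolding mol_def using assms by (intro integral_nonneg_AE) (auto simp: mker_nonneg)

lemma mol_diff:
  assumes "0 < r" "integrable lebesgue f" "integrable lebesgue g"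
  shows "mol r (\<lambda>y. f y - g y) z = mol r f z - mol r g z"
  unfolding mol_def
  by (subst Bochner_Integration.integral_diff[symmetric])
     (auto intro!: mol_integrand_integrable assms Bochner_Integration.integral_cong simp: algebra_simps)

lemma mol_abs_le:
  assumes "0 < r" "integrable lebesgue f"
  shows "\<bar>mol r f z\<bar> \<le> mol r (\<lambda>y. \<bar>f y\<bar>) z"
proof -
  have "\<bar>mol r f z\<bar> \<le> (LINT y|lebesgue. \<bar>f y * mker r (z - y)\<bar>)"
    unfolding mol_def by (rule integral_abs_bound)
  also have "\<dots> = mol r (\<lambda>y. \<bar>f y\<bar>) z"
    unfolding mol_def by (simp add: abs_mult mker_nonneg assms)
  finally show ?thesis .
qed

lemma mker_total_mass:
  assumes "0 < r"
  shows "integrable lebesgue (\<lambda>y::'a::euclidean_space. mker r (z - y))"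
    and "(LINT y|lebesgue. mker r (z - (y::'a))) = 1"
    and "integrable lborel (\<lambda>y::'a. mker r (y - z))"
    and "(LINT y|lborel. mker r (y - (z::'a))) = 1"
proof -
  have m: "(mker r :: 'a \<Rightarrow> real) \<in> borel_measurable borel"
    using continuous_mker[OF assms] by (rule borel_measurable_continuous_onI)
  have 1: "integrable lborel (\<lambda>y::'a. mker r (y + (- z)))"
    using lborel_translate(2)[OF m] mker_integrable[OF assms] by blast
  have 2: "(LINT y|lborel. mker r (y - (z::'a))) = 1" for z
    using lborel_translate(1)[OF m, of "- z"] mker_integral[OF assms, where 'a = 'a] by simp
  show b1: "integrable lborel (\<lambda>y::'a. mker r (y - z))" "(LINT y|lborel. mker r (y - (z::'a))) = 1"
    using 1 2[of z] by simp_all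
  have m2: "(\<lambda>y::'a. mker r (y - z)) \<in> borel_measurable lborel"
    using b1(1) by auto
  show "integrable lebesgue (\<lambda>y::'a. mker r (z - y))"
    "(LINT y|lebesgue. mker r (z - (y::'a))) = 1"
    unfolding mker_sym(2)[of r z]
    using b1 m2 by (simp_all add: integrable_completion integral_completion)
qed

lemma mol_const: "0 < r \<Longrightarrow> mol r (\<lambda>_. c) z = c"
  using mker_total_mass(2)[of r z] by (simp add: mol_def)

text \<open>
  Tonelli's theorem is applied to a Borel representative of \<open>f\<close>, since the product measure is that
  of two copies of \<^const>\<open>lborel\<close>.
\<close>

lemma mol_L1_contraction:
  fixes f :: "'a::euclidean_space \<Rightarrow> real"
  assumes r: "0 < r" and f: "integrable lebesgue f"
  shows "integrable lebesgue (mol r f)" "(LINT z|lebesgue. \<bar>mol r f z\<bar>) \<le> (LINT z|lebesgue. \<bar>f z\<bar>)"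
proof -
  obtain g where g[measurable]: "g \<in> borel_measurable lborel" and AE: "AE x in lborel. f x = g x"
    using completion_ex_borel_measurable_real[of f lborel] f by auto
  have AE': "AE x in lebesgue. f x = g x" using AE by (rule AE_completion)
  have gm: "g \<in> borel_measurable lebesgue" using g by (rule measurable_completion)
  have gi: "integrable lebesgue g"
    by (rule integrable_cong_AE_imp[OF f gm]) (use AE' in auto)
  then have gl: "integrable lborel g" using g by (simp add: integrable_completion)
  have km[measurable]: "(mker r :: 'a \<Rightarrow> real) \<in> borel_measurable borel"
    using continuous_mker[OF r] by (rule borel_measurable_continuous_onI)
  define h where "h = (\<lambda>y z. g y * mker r (z - y))"
  have hm[measurable]: "case_prod h \<in> borel_measurable (lborel \<Otimes>\<^sub>M lborel)"
    unfolding h_def by measurable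
  have mol_eq: "mol r f z = (LINT y|lborel. h y z)" for z
  proof -
    have "mol r f z = mol r g z"
      unfolding mol_def
      by (rule integral_cong_AE)
         (use AE' in \<open>auto intro!: borel_measurable_integrable mol_integrand_integrable r f gi\<close>)
    also have "\<dots> = (LINT y|lborel. h y z)"
      unfolding mol_def h_def by (rule integral_completion) measurable
    finally show ?thesis .
  qed
  have norm_h: "(LINT z|lborel. \<bar>h y z\<bar>) = \<bar>g y\<bar>" for y
    using mker_total_mass(4)[OF r, of y] by (simp add: h_def abs_mult mker_nonneg r)
  have hi: "integrable (lborel \<Otimes>\<^sub>M lborel) (case_prod h)"
  proof (rule lborel_pair.Fubini_integrable[OF hm])
    show "integrable lborel (\<lambda>x. LINT y|lborel. norm (case (x, y) of (x, xa) \<Rightarrow> h x xa))"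
      using gl by (simp add: norm_h)
    show "AE x in lborel. integrable lborel (\<lambda>y. case (x, y) of (x, xa) \<Rightarrow> h x xa)"
      using mker_total_mass(3)[OF r] by (auto simp: h_def)
  qed
  have i1: "integrable lborel (\<lambda>z. LINT y|lborel. h y z)"
    using lborel_pair.integrable_snd[OF hi] .
  have hi': "integrable (lborel \<Otimes>\<^sub>M lborel) (case_prod (\<lambda>y z. \<bar>h y z\<bar>))"
    using integrable_abs[OF hi] by (simp add: split_beta')
  have i2: "integrable lborel (\<lambda>z. LINT y|lborel. \<bar>h y z\<bar>)"
    using lborel_pair.integrable_snd[OF hi'] .
  have molb: "mol r f \<in> borel_measurable lborel"
    using borel_measurable_continuous_onI[OF continuous_mol[OF r f]] by simp
  have mi: "integrable lborel (mol r f)" using i1 by (simp add: mol_eq[abs_def])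
  then show "integrable lebesgue (mol r f)" using molb by (simp add: integrable_completion)
  have "(LINT z|lebesgue. \<bar>mol r f z\<bar>) = (LINT z|lborel. \<bar>mol r f z\<bar>)"
    using molb by (intro integral_completion borel_measurable_abs)
  also have "\<dots> \<le> (LINT z|lborel. LINT y|lborel. \<bar>h y z\<bar>)"
  proof (rule Bochner_Integration.integral_mono)
    show "\<bar>mol r f z\<bar> \<le> (LINT y|lborel. \<bar>h y z\<bar>)" for z
      unfolding mol_eq by (rule integral_abs_bound)
  qed (use mi i2 in auto)
  also have "\<dots> = (LINT y|lborel. LINT z|lborel. \<bar>h y z\<bar>)"
    by (rule lborel_pair.Fubini_integral[OF hi'])
  also have "\<dots> = (LINT y|lborel. \<bar>g y\<bar>)" by (simp add: norm_h)
  also have "\<dots> = (LINT y|lebesgue. \<bar>g y\<bar>)"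
    by (rule integral_completion[symmetric]) measurable
  also have "\<dots> = (LINT y|lebesgue. \<bar>f y\<bar>)"
    by (rule integral_cong_AE) (use AE' gm f in auto)
  finally show "(LINT z|lebesgue. \<bar>mol r f z\<bar>) \<le> (LINT z|lebesgue. \<bar>f z\<bar>)" .
qed

section \<open>Convergence of mollifications and integration by parts\<close>

text \<open>
  Lipschitz continuous with bounded support.
\<close>

definition lipschitz_bump :: "('a::euclidean_space \<Rightarrow> real) \<Rightarrow> bool" where
  "lipschitz_bump g \<longleftrightarrow> (\<exists>L B. 0 \<le> L \<and> (\<forall>x y. \<bar>g x - g y\<bar> \<le> L * norm (x - y)) \<and> (\<forall>x. B < norm x \<longrightarrow> g x = 0))"

lemma lipschitz_bump_continuous:
  fixes g :: "'a::euclidean_space \<Rightarrow> real"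
  assumes "lipschitz_bump g" shows "continuous_on UNIV g"
proof -
  obtain L where "0 \<le> L" "\<And>x y. \<bar>g x - g y\<bar> \<le> L * norm (x - y)"
    using assms by (auto simp: lipschitz_bump_def)
  then have "L-lipschitz_on UNIV g" by (auto simp: lipschitz_on_def dist_norm)
  then show ?thesis by (rule lipschitz_on_continuous_on)
qed

lemma integrable_compact_support:
  fixes g :: "'a::euclidean_space \<Rightarrow> real"
  assumes c: "continuous_on UNIV g" and K: "compact K" and z: "\<And>x. x \<notin> K \<Longrightarrow> g x = 0"
  shows "integrable lborel g" "integrable lebesgue g"
proof -
  have "integrable lborel (\<lambda>z. indicator K z *\<^sub>R g z)"
    by (rule borel_integrable_compact) (auto intro: K continuous_on_subset[OF c])
  also have "(\<lambda>z. indicator K z *\<^sub>R g z) = g"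
    using z by (auto simp: indicator_def fun_eq_iff)
  finally show *: "integrable lborel g" .
  then have "g \<in> borel_measurable lborel" by auto
  then show "integrable lebesgue g" using * by (simp add: integrable_completion)
qed

lemma lipschitz_bump_integrable:
  fixes g :: "'a::euclidean_space \<Rightarrow> real"
  assumes "lipschitz_bump g" shows "integrable lborel g" "integrable lebesgue g"
proof -
  obtain B where B: "\<And>x. B < norm x \<Longrightarrow> g x = 0" using assms by (auto simp: lipschitz_bump_def)
  have "\<And>x. x \<notin> cball 0 B \<Longrightarrow> g x = 0" using B by auto
  then show "integrable lborel g" "integrable lebesgue g"
    using integrable_compact_support[OF lipschitz_bump_continuous[OF assms] compact_cball] by blast+
qed

lemma lipschitz_bump_scale:
  assumes "lipschitz_bump g" shows "lipschitz_bump (\<lambda>x. c * g x)"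
proof -
  obtain L B where L: "0 \<le> L" "\<And>x y. \<bar>g x - g y\<bar> \<le> L * norm (x - y)" and B: "\<And>x. B < norm x \<Longrightarrow> g x = 0"
    using assms by (auto simp: lipschitz_bump_def)
  have "\<bar>c * g x - c * g y\<bar> \<le> (\<bar>c\<bar> * L) * norm (x - y)" for x y
    using mult_left_mono[OF L(2)[of x y], of "\<bar>c\<bar>"] by (simp add: abs_mult flip: right_diff_distrib)
  then show ?thesis unfolding lipschitz_bump_def using L B
    by (intro exI[of _ "\<bar>c\<bar> * L"] exI[of _ B]) auto
qed

lemma lipschitz_bump_add:
  assumes "lipschitz_bump f" "lipschitz_bump g" shows "lipschitz_bump (\<lambda>x. f x + g x)"
proof -
  obtain L B where L: "0 \<le> L" "\<And>x y. \<bar>g x - g y\<bar> \<le> L * norm (x - y)" and B: "\<And>x. B < norm x \<Longrightarrow> g x = 0"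
    using assms by (auto simp: lipschitz_bump_def)
  obtain L' B' where L': "0 \<le> L'" "\<And>x y. \<bar>f x - f y\<bar> \<le> L' * norm (x - y)" and B': "\<And>x. B' < norm x \<Longrightarrow> f x = 0"
    using assms by (auto simp: lipschitz_bump_def)
  have "\<bar>(f x + g x) - (f y + g y)\<bar> \<le> (L + L') * norm (x - y)" for x y
    using L(2)[of x y] L'(2)[of x y] by (simp add: algebra_simps)
  then show ?thesis unfolding lipschitz_bump_def using L L' B B'
    by (intro exI[of _ "L + L'"] exI[of _ "max B B'"]) auto
qed

text \<open>
  Membership in the \<open>L\<^sup>1\<close>-closure of the Lipschitz functions with bounded support. Integrability of
  \<open>f\<close> itself is not part of the notion.
\<close>

definition L1_approximable :: "('a::euclidean_space \<Rightarrow> real) \<Rightarrow> bool" where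
  "L1_approximable f \<longleftrightarrow> (\<forall>e>0. \<exists>g. lipschitz_bump g \<and> (LINT z|lborel. \<bar>f z - g z\<bar>) < e)"

lemma L1_triangle:
  fixes f g h :: "'a \<Rightarrow> real"
  assumes "integrable M f" "integrable M g" "integrable M h"
  shows "(LINT z|M. \<bar>f z - h z\<bar>) \<le> (LINT z|M. \<bar>f z - g z\<bar>) + (LINT z|M. \<bar>g z - h z\<bar>)"
proof -
  have "(LINT z|M. \<bar>f z - h z\<bar>) \<le> (LINT z|M. \<bar>f z - g z\<bar> + \<bar>g z - h z\<bar>)"
    using assms by (intro Bochner_Integration.integral_mono) auto
  also have "\<dots> = (LINT z|M. \<bar>f z - g z\<bar>) + (LINT z|M. \<bar>g z - h z\<bar>)"
    using assms by (intro Bochner_Integration.integral_add) auto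
  finally show ?thesis .
qed

lemma L1_approximable_close:
  fixes f :: "'a::euclidean_space \<Rightarrow> real"
  assumes f: "integrable lborel f"
    and h: "\<And>e. 0 < e \<Longrightarrow> \<exists>h. integrable lborel h \<and> L1_approximable h \<and> (LINT z|lborel. \<bar>f z - h z\<bar>) < e"
  shows "L1_approximable f"
  unfolding L1_approximable_def
proof safe
  fix e :: real assume e: "0 < e"
  then obtain h where i: "integrable lborel h" "L1_approximable h" "(LINT z|lborel. \<bar>f z - h z\<bar>) < e / 2"
    using h[of "e / 2"] by auto
  obtain g where g: "lipschitz_bump g" "(LINT z|lborel. \<bar>h z - g z\<bar>) < e / 2"
    using i(2) e unfolding L1_approximable_def by (meson half_gt_zero)
  have "(LINT z|lborel. \<bar>f z - g z\<bar>) < e"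
    using L1_triangle[OF f i(1) lipschitz_bump_integrable(1)[OF g(1)]] i(3) g(2) by simp
  then show "\<exists>g. lipschitz_bump g \<and> (LINT z|lborel. \<bar>f z - g z\<bar>) < e" using g by blast
qed

lemma L1_approximable_limit:
  fixes f :: "'a::euclidean_space \<Rightarrow> real"
  assumes f: "integrable lborel f" and s: "\<And>i. integrable lborel (s i)" "\<And>i. L1_approximable (s i)"
    and lim: "\<And>x. (\<lambda>i. s i x) \<longlonglongrightarrow> f x" and w: "integrable lborel w" "\<And>i x. \<bar>s i x\<bar> \<le> w x"
  shows "L1_approximable f"
proof (rule L1_approximable_close[OF f])
  fix e :: real assume e: "0 < e"
  have bd: "\<bar>f x\<bar> \<le> w x" for x
    by (rule Lim_bounded[OF tendsto_rabs[OF lim]]) (use w in auto)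
  have "(\<lambda>i. LINT z|lborel. \<bar>f z - s i z\<bar>) \<longlonglongrightarrow> (LINT z|(lborel :: 'a measure). (0::real))"
  proof (rule integral_dominated_convergence[where w = "\<lambda>x. 2 * w x"])
    show "AE x in lborel. (\<lambda>i. \<bar>f x - s i x\<bar>) \<longlonglongrightarrow> 0"
    proof (rule AE_I2)
      fix x
      have "(\<lambda>i. \<bar>f x - s i x\<bar>) \<longlonglongrightarrow> \<bar>f x - f x\<bar>"
        by (intro tendsto_intros lim)
      then show "(\<lambda>i. \<bar>f x - s i x\<bar>) \<longlonglongrightarrow> 0" by simp
    qed
    show "AE x in lborel. norm \<bar>f x - s i x\<bar> \<le> 2 * w x" for i
    proof (rule AE_I2)
      fix x show "norm \<bar>f x - s i x\<bar> \<le> 2 * w x" using bd[of x] w(2)[of i x] by simp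
    qed
  qed (use f s w in auto)
  then have "\<forall>\<^sub>F i in sequentially. (LINT z|lborel. \<bar>f z - s i z\<bar>) < e"
    using e by (intro order_tendstoD(2)[of _ 0]) auto
  then obtain i where "(LINT z|lborel. \<bar>f z - s i z\<bar>) < e"
    by (auto simp: eventually_sequentially)
  then show "\<exists>h. integrable lborel h \<and> L1_approximable h \<and> (LINT z|lborel. \<bar>f z - h z\<bar>) < e"
    using s by blast
qed

lemma lipschitz_bump_distance:
  fixes K :: "'a::euclidean_space set"
  assumes K: "compact K" "K \<noteq> {}" and c: "1 \<le> c"
  shows "lipschitz_bump (\<lambda>x. max 0 (1 - c * infdist x K))"
proof -
  obtain B where B: "\<And>x. x \<in> K \<Longrightarrow> norm x \<le> B" using compact_imp_bounded[OF K(1)] by (auto simp: bounded_iff)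
  have lip: "\<bar>infdist x K - infdist y K\<bar> \<le> norm (x - y)" for x y
    using infdist_triangle_abs[of x K y] by (simp add: dist_norm)
  have "\<bar>max 0 (1 - c * infdist x K) - max 0 (1 - c * infdist y K)\<bar> \<le> c * norm (x - y)" for x y
  proof -
    have "\<bar>max 0 (1 - c * infdist x K) - max 0 (1 - c * infdist y K)\<bar>
        \<le> \<bar>c * infdist x K - c * infdist y K\<bar>" by (auto simp: max_def abs_if)
    also have "\<dots> = c * \<bar>infdist x K - infdist y K\<bar>"
      using c by (simp add: abs_mult flip: right_diff_distrib)
    also have "\<dots> \<le> c * norm (x - y)" using c by (intro mult_left_mono lip) auto
    finally show ?thesis .
  qed
  moreover have "max 0 (1 - c * infdist x K) = 0" if "B + 1 < norm x" for x
  proof -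
    have "1 \<le> infdist x K"
      unfolding infdist_notempty[OF K(2)]
    proof (rule cINF_greatest[OF K(2)])
      fix y assume "y \<in> K"
      then have "norm y \<le> B" by (rule B)
      then show "1 \<le> dist x y" using that(1) norm_triangle_ineq2[of x y] by (simp add: dist_norm)
    qed
    then have "1 * 1 \<le> c * infdist x K" using c by (intro mult_mono) auto
    then show ?thesis by simp
  qed
  ultimately show ?thesis
    unfolding lipschitz_bump_def using c
    by (intro exI[of _ c] exI[of _ "B + 1"]) auto
qed

lemma lipschitz_bump_approximable: "lipschitz_bump g \<Longrightarrow> L1_approximable g"
  unfolding L1_approximable_def by (auto intro!: exI[of _ g])

lemma L1_approximable_indicator_compact:
  fixes K :: "'a::euclidean_space set"
  assumes K: "compact K" shows "L1_approximable (indicator K)"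
proof (cases "K = {}")
  case True
  have "lipschitz_bump (\<lambda>_::'a. 0)" by (auto simp: lipschitz_bump_def intro: exI[of _ 0])
  then show ?thesis using True by (simp add: lipschitz_bump_approximable indicator_def[abs_def])
next
  case False
  define s where "s = (\<lambda>i x. max 0 (1 - real (Suc i) * infdist x K))"
  have lb: "lipschitz_bump (s i)" for i
    unfolding s_def by (rule lipschitz_bump_distance) (use K False in auto)
  show ?thesis
  proof (rule L1_approximable_limit[where s = s and w = "s 0"])
    show "integrable lborel (indicator K :: 'a \<Rightarrow> real)"
      using emeasure_compact_finite[OF K] K by (simp add: compact_imp_closed)
    show "(\<lambda>i. s i x) \<longlonglongrightarrow> indicator K x" for x
    proof (cases "x \<in> K")
      case True
      then show ?thesis by (simp add: s_def)
    next
      case nK: False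
      then have d: "0 < infdist x K"
        using infdist_pos_not_in_closed[OF compact_imp_closed[OF K] False] by blast
      obtain N where N: "1 / infdist x K < real N" using reals_Archimedean2 by blast
      have "s i x = 0" if "N \<le> i" for i
      proof -
        have "1 / infdist x K \<le> real (Suc i)" using N that by linarith
        then have "1 \<le> real (Suc i) * infdist x K" using d by (simp add: field_simps)
        then show ?thesis by (simp add: s_def)
      qed
      then have "\<forall>\<^sub>F i in sequentially. s i x = 0" by (auto simp: eventually_sequentially)
      then show ?thesis using nK by (simp add: tendsto_eventually)
    qed
    show "\<bar>s i x\<bar> \<le> s 0 x" for i x
    proof -
      have "infdist x K * 1 \<le> infdist x K * real (Suc i)"
        by (intro mult_left_mono infdist_nonneg) simp
      then have "1 - real (Suc i) * infdist x K \<le> 1 - real (Suc 0) * infdist x K"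
        by (simp add: mult.commute)
      then show ?thesis unfolding s_def by linarith
    qed
  qed (use lb lipschitz_bump_integrable(1) lipschitz_bump_approximable in auto)
qed

lemma L1_approximable_indicator:
  fixes A :: "'a::euclidean_space set"
  assumes A: "A \<in> sets lborel" and fin: "emeasure lborel A < \<infinity>"
  shows "L1_approximable (indicator A)"
proof (rule L1_approximable_close)
  show "integrable lborel (indicator A :: 'a \<Rightarrow> real)" using A fin by simp
  fix e :: real assume e: "0 < e"
  obtain T where T: "closed T" "T \<subseteq> A" "A - T \<in> lmeasurable" "emeasure lebesgue (A - T) < ennreal e"
    using sets_lebesgue_inner_closed[of A e] A e by auto
  have Tfin: "emeasure lborel T < \<infinity>"
    using emeasure_mono[OF T(2) A] fin by simp
  have Ti: "integrable lborel (indicator T :: 'a \<Rightarrow> real)"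
    using Tfin T(1) by simp
  have ap: "L1_approximable (indicator T)"
  proof (rule L1_approximable_limit[where s = "\<lambda>i. indicator (T \<inter> cball 0 (real i))" and w = "indicator T"])
    show "integrable lborel (indicator (T \<inter> cball 0 (real i)) :: 'a \<Rightarrow> real)" for i
      using emeasure_mono[of "T \<inter> cball 0 (real i)" T lborel] Tfin T(1) by (simp add: le_less_trans)
    show "L1_approximable (indicator (T \<inter> cball 0 (real i)))" for i
      by (intro L1_approximable_indicator_compact closed_Int_compact T compact_cball)
    show "(\<lambda>i. indicator (T \<inter> cball 0 (real i)) x :: real) \<longlonglongrightarrow> indicator T x" for x
    proof -
      obtain N where N: "norm x < real N" using reals_Archimedean2 by blast
      have "\<forall>\<^sub>F i in sequentially. indicator (T \<inter> cball 0 (real i)) x = (indicator T x :: real)"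
        unfolding eventually_sequentially using N by (intro exI[of _ N]) (auto simp: indicator_def)
      then show ?thesis by (rule tendsto_eventually)
    qed
  qed (use Ti in \<open>auto simp: indicator_def\<close>)
  have "(LINT z|lborel. \<bar>indicator A z - indicator T z :: real\<bar>) = (LINT z|lborel. indicator (A - T) z)"
    using T(2) by (intro Bochner_Integration.integral_cong) (auto simp: indicator_def)
  also have "\<dots> = measure lborel (A - T)" by simp
  also have "\<dots> < e"
  proof -
    have lt: "emeasure lborel (A - T) < ennreal e" using T(4) A T(1) by (simp add: emeasure_completion)
    then have "emeasure lborel (A - T) \<noteq> top" by auto
    then have "emeasure lborel (A - T) = ennreal (measure lborel (A - T))"
      by (rule emeasure_eq_ennreal_measure)
    then show ?thesis using lt by (simp add: ennreal_less_iff)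
  qed
  finally show "\<exists>h. integrable lborel h \<and> L1_approximable h \<and> (LINT z|lborel. \<bar>indicator A z - h z\<bar>) < e"
    using Ti ap by blast
qed

lemma L1_approximable_scale:
  fixes f :: "'a::euclidean_space \<Rightarrow> real"
  assumes "L1_approximable f" shows "L1_approximable (\<lambda>x. c * f x)"
  unfolding L1_approximable_def
proof safe
  fix e :: real assume e: "0 < e"
  have "0 < e / (\<bar>c\<bar> + 1)" using e by simp
  then obtain g where g: "lipschitz_bump g" "(LINT z|lborel. \<bar>f z - g z\<bar>) < e / (\<bar>c\<bar> + 1)"
    using assms unfolding L1_approximable_def by blast
  have "(LINT z|lborel. \<bar>c * f z - c * g z\<bar>) = \<bar>c\<bar> * (LINT z|lborel. \<bar>f z - g z\<bar>)"
    by (simp add: abs_mult flip: right_diff_distrib)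
  also have "\<dots> \<le> (\<bar>c\<bar> + 1) * (LINT z|lborel. \<bar>f z - g z\<bar>)"
    by (intro mult_right_mono) auto
  also have "\<dots> < e" using g(2) by (simp add: field_simps pos_less_divide_eq)
  finally show "\<exists>g. lipschitz_bump g \<and> (LINT z|lborel. \<bar>c * f z - g z\<bar>) < e"
    using lipschitz_bump_scale[OF g(1)] by blast
qed

lemma L1_approximable_add:
  fixes f g :: "'a::euclidean_space \<Rightarrow> real"
  assumes f: "integrable lborel f" "L1_approximable f" and g: "integrable lborel g" "L1_approximable g"
  shows "L1_approximable (\<lambda>x. f x + g x)"
  unfolding L1_approximable_def
proof safe
  fix e :: real assume e: "0 < e"
  then have e2: "0 < e / 2" by simp
  obtain f' where f': "lipschitz_bump f'" "(LINT z|lborel. \<bar>f z - f' z\<bar>) < e / 2"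
    using f(2) e2 unfolding L1_approximable_def by blast
  obtain g' where g': "lipschitz_bump g'" "(LINT z|lborel. \<bar>g z - g' z\<bar>) < e / 2"
    using g(2) e2 unfolding L1_approximable_def by blast
  have "(LINT z|lborel. \<bar>f z + g z - (f' z + g' z)\<bar>) \<le> (LINT z|lborel. \<bar>f z - f' z\<bar> + \<bar>g z - g' z\<bar>)"
    using f(1) g(1) lipschitz_bump_integrable(1)[OF f'(1)] lipschitz_bump_integrable(1)[OF g'(1)]
    by (intro Bochner_Integration.integral_mono) auto
  also have "\<dots> = (LINT z|lborel. \<bar>f z - f' z\<bar>) + (LINT z|lborel. \<bar>g z - g' z\<bar>)"
    using f(1) g(1) lipschitz_bump_integrable(1)[OF f'(1)] lipschitz_bump_integrable(1)[OF g'(1)]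
    by (intro Bochner_Integration.integral_add) auto
  finally show "\<exists>h. lipschitz_bump h \<and> (LINT z|lborel. \<bar>f z + g z - h z\<bar>) < e"
    using f' g' lipschitz_bump_add[OF f'(1) g'(1)] by (intro exI[of _ "\<lambda>x. f' x + g' x"]) auto
qed

lemma integrable_imp_L1_approximable:
  fixes f :: "'a::euclidean_space \<Rightarrow> real"
  assumes "integrable lborel f" shows "L1_approximable f"
  using assms
proof (induction rule: integrable_induct)
  case (base A c)
  then show ?case
    using L1_approximable_scale[OF L1_approximable_indicator[of A], of c] by (simp add: mult.commute)
next
  case (add f g)
  then show ?case by (intro L1_approximable_add)
next
  case (lim f s)
  show ?case
    by (rule L1_approximable_limit[where s = s and w = "\<lambda>x. 2 * norm (f x)"]) (use lim in auto)
qed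

lemma mol_lipschitz_bump:
  fixes g :: "'a::euclidean_space \<Rightarrow> real"
  assumes g: "lipschitz_bump g"
  shows "\<exists>C. \<forall>r. 0 < r \<and> r \<le> 1 \<longrightarrow> (LINT z|lebesgue. \<bar>mol r g z - g z\<bar>) \<le> C * r"
proof -
  obtain L B where L: "0 \<le> L" "\<And>x y. \<bar>g x - g y\<bar> \<le> L * norm (x - y)" and B: "\<And>x. B < norm x \<Longrightarrow> g x = 0"
    using g by (auto simp: lipschitz_bump_def)
  have gi: "integrable lebesgue g" by (rule lipschitz_bump_integrable(2)[OF g])
  have "(LINT z|lebesgue. \<bar>mol r g z - g z\<bar>) \<le> (L * measure lebesgue (cball (0::'a) (B + 1))) * r"
    if r: "0 < r" "r \<le> 1" for r
  proof -
    have eq: "mol r g z - g z = (LINT y|lebesgue. (g y - g z) * mker r (z - y))" for z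
    proof -
      have "g z = (LINT y|lebesgue. g z * mker r (z - y))" using mol_const[OF r(1)] by (simp add: mol_def)
      moreover have "integrable lebesgue (\<lambda>y. g z * mker r (z - y))"
        by (intro integrable_mult_right mker_total_mass(1) r)
      ultimately show ?thesis
        unfolding mol_def left_diff_distrib
        by (subst Bochner_Integration.integral_diff) (auto intro!: mol_integrand_integrable r gi)
    qed
    have pw: "\<bar>mol r g z - g z\<bar> \<le> (L * r) * indicator (cball 0 (B + 1)) z" for z
    proof (cases "z \<in> cball 0 (B + 1)")
      case True
      have pt: "\<bar>(g y - g z) * mker r (z - y)\<bar> \<le> (L * r) * mker r (z - y)" for y
      proof (cases "norm (z - y) < r")
        case True
        have "\<bar>g y - g z\<bar> \<le> L * r"
          using L(2)[of y z] mult_left_mono[OF less_imp_le[OF True] L(1)] by (simp add: norm_minus_commute)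
        then show ?thesis by (simp add: abs_mult mker_nonneg r mult_right_mono)
      qed (simp add: mker_eq_0 r)
      have "\<bar>mol r g z - g z\<bar> \<le> (LINT y|lebesgue. \<bar>(g y - g z) * mker r (z - y)\<bar>)"
        unfolding eq by (rule integral_abs_bound)
      also have "\<dots> \<le> (LINT y|lebesgue. (L * r) * mker r (z - y))"
        by (rule integral_mono'[OF integrable_mult_right[OF mker_total_mass(1)[OF r(1)]] pt])
           (use L r in \<open>simp add: mker_nonneg\<close>)
      also have "\<dots> = L * r" using mker_total_mass(2)[OF r(1), of z] by simp
      finally show ?thesis using True by simp
    next
      case False
      have "(g y - g z) * mker r (z - y) = 0" for y
      proof (cases "norm (z - y) < r")
        case True
        have "norm z \<le> norm y + norm (z - y)" using norm_triangle_ineq[of y "z - y"] by simp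
        then have "g y = 0" "g z = 0" using False True r by (auto intro!: B)
        then show ?thesis by simp
      qed (simp add: mker_eq_0 r)
      then have "(\<lambda>y. (g y - g z) * mker r (z - y)) = (\<lambda>_. 0)" by blast
      then show ?thesis using False by (simp add: eq)
    qed
    have "(LINT z|lebesgue. \<bar>mol r g z - g z\<bar>) \<le> (LINT z|lebesgue. (L * r) * indicator (cball (0::'a) (B + 1)) z)"
    proof (rule integral_mono'[OF _ pw])
      show "integrable lebesgue (\<lambda>z. L * r * indicator (cball (0::'a) (B + 1)) z)"
        by (intro integrable_mult_right integrable_real_indicator)
           (use emeasure_compact_finite[of "cball (0::'a) (B + 1)"] in \<open>auto simp: top.not_eq_extremum\<close>)
    qed (use L r in auto)
    also have "\<dots> = (L * measure lebesgue (cball (0::'a) (B + 1))) * r" by simp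
    finally show ?thesis .
  qed
  then show ?thesis by blast
qed

lemma mol_tendsto_L1:
  fixes f :: "'a::euclidean_space \<Rightarrow> real"
  assumes f: "integrable lebesgue f" and r: "\<And>i. 0 < r i" "r \<longlonglongrightarrow> 0"
  shows "(\<lambda>i. LINT z|lebesgue. \<bar>mol (r i) f z - f z\<bar>) \<longlonglongrightarrow> 0"
proof (rule LIMSEQ_I)
  fix e :: real assume e: "0 < e"
  obtain f0 where f0: "f0 \<in> borel_measurable lborel" and AE: "AE x in lborel. f x = f0 x"
    using completion_ex_borel_measurable_real[of f lborel] f by auto
  have AE': "AE x in lebesgue. f x = f0 x" using AE by (rule AE_completion)
  have gm: "f0 \<in> borel_measurable lebesgue" using f0 by (rule measurable_completion)
  have "integrable lebesgue f0"
    by (rule integrable_cong_AE_imp[OF f gm]) (use AE' in auto)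
  then have f0i: "integrable lborel f0" using f0 by (simp add: integrable_completion)
  obtain g where g: "lipschitz_bump g" "(LINT z|lborel. \<bar>f0 z - g z\<bar>) < e / 4"
    using integrable_imp_L1_approximable[OF f0i] e unfolding L1_approximable_def
    by (meson divide_pos_pos zero_less_numeral)
  have gi: "integrable lebesgue g" by (rule lipschitz_bump_integrable(2)[OF g(1)])
  have "(LINT z|lebesgue. \<bar>f z - g z\<bar>) = (LINT z|lebesgue. \<bar>f0 z - g z\<bar>)"
    by (rule integral_cong_AE) (use AE' f gm gi in auto)
  also have "\<dots> = (LINT z|lborel. \<bar>f0 z - g z\<bar>)"
    using f0 lipschitz_bump_integrable(1)[OF g(1)]
    by (intro integral_completion borel_measurable_abs borel_measurable_diff) auto
  finally have fg: "(LINT z|lebesgue. \<bar>f z - g z\<bar>) < e / 4" using g by simp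
  obtain C where C: "\<And>r. 0 < r \<Longrightarrow> r \<le> 1 \<Longrightarrow> (LINT z|lebesgue. \<bar>mol r g z - g z\<bar>) \<le> C * r"
    using mol_lipschitz_bump[OF g(1)] by blast
  have "(\<lambda>i. C * r i) \<longlonglongrightarrow> 0" using tendsto_mult_right_zero[OF r(2)] .
  then have "\<forall>\<^sub>F i in sequentially. C * r i < e / 4" using e by (intro order_tendstoD(2)[of _ 0]) auto
  moreover have "\<forall>\<^sub>F i in sequentially. r i < 1" by (intro order_tendstoD(2)[OF r(2)]) auto
  ultimately have "\<forall>\<^sub>F i in sequentially. norm ((LINT z|lebesgue. \<bar>mol (r i) f z - f z\<bar>) - 0) < e"
  proof eventually_elim
    case (elim i)
    have int: "integrable lebesgue (mol (r i) f)" "integrable lebesgue (mol (r i) g)"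
      by (auto intro: mol_L1_contraction(1) r f gi)
    have "(LINT z|lebesgue. \<bar>mol (r i) f z - mol (r i) g z\<bar>) = (LINT z|lebesgue. \<bar>mol (r i) (\<lambda>y. f y - g y) z\<bar>)"
      by (simp add: mol_diff r f gi)
    also have "\<dots> \<le> (LINT z|lebesgue. \<bar>f z - g z\<bar>)"
      by (intro mol_L1_contraction(2) r Bochner_Integration.integrable_diff f gi)
    finally have 1: "(LINT z|lebesgue. \<bar>mol (r i) f z - mol (r i) g z\<bar>) < e / 4" using fg by simp
    have 2: "(LINT z|lebesgue. \<bar>mol (r i) g z - g z\<bar>) < e / 4" using C[of "r i"] r(1)[of i] elim by linarith
    have 3: "(LINT z|lebesgue. \<bar>g z - f z\<bar>) < e / 4" using fg by (simp add: abs_minus_commute)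
    have "(LINT z|lebesgue. \<bar>mol (r i) f z - f z\<bar>) < e"
      using L1_triangle[OF int(1) int(2) f] L1_triangle[OF int(2) gi f] 1 2 3 e by linarith
    then show ?case by simp
  qed
  then show "\<exists>N. \<forall>i\<ge>N. norm ((LINT z|lebesgue. \<bar>mol (r i) f z - f z\<bar>) - 0) < e"
    by (simp add: eventually_sequentially)
qed

text \<open>
  Integration by parts: the integral of a directional derivative of a compactly supported function
  vanishes, being the limit of integrals of difference quotients, which are zero by translation
  invariance. Only the derivative along lines parallel to \<open>b\<close> is required.
\<close>

lemma integral_line_derivative_eq_0:
  fixes g g' :: "'a::euclidean_space \<Rightarrow> real"
  assumes g: "continuous_on UNIV g" and g': "continuous_on UNIV g'"
    and d: "\<And>z s. ((\<lambda>s. g (z + s *\<^sub>R b)) has_real_derivative g' (z + s *\<^sub>R b)) (at s)"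
    and K: "compact K" and z: "\<And>x. x \<notin> K \<Longrightarrow> g x = 0" "\<And>x. x \<notin> K \<Longrightarrow> g' x = 0"
  shows "(LINT z|lebesgue. g' z) = 0"
proof -
  obtain B0 where B0: "\<And>x. x \<in> K \<Longrightarrow> norm x \<le> B0" using compact_imp_bounded[OF K] by (auto simp: bounded_iff)
  obtain B where B: "\<And>x. \<bar>g' x\<bar> \<le> B"
    using bounded_of_compact_support[OF g', of "B0 + 1"] z(2) B0 by force
  define s where "s = (\<lambda>i::nat. 1 / real (Suc i))"
  have s: "0 < s i" "s i \<le> 1" for i by (auto simp: s_def)
  have s0: "s \<longlonglongrightarrow> 0" unfolding s_def by (rule LIMSEQ_Suc[OF lim_1_over_n])
  let ?q = "\<lambda>i z. (g (z + s i *\<^sub>R b) - g z) / s i"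
  have gl: "integrable lborel g" by (rule integrable_compact_support(1)[OF g K z(1)])
  then have gb: "g \<in> borel_measurable borel" by auto
  have q0: "(LINT z|lborel. ?q i z) = 0" for i
    using lborel_translate[OF gb, of "s i *\<^sub>R b"] gl
    by (simp add: Bochner_Integration.integral_diff)
  have lim: "(\<lambda>i. ?q i z) \<longlonglongrightarrow> g' z" for z
  proof -
    have "\<forall>i. s i \<in> UNIV - {0}" using s(1) by (simp add: less_imp_neq[symmetric])
    then show ?thesis
      using d[of z 0] s0
      unfolding has_field_derivative_iff tendsto_at_iff_sequentially comp_def by simp
  qed
  have "(\<lambda>i. LINT z|lborel. ?q i z) \<longlonglongrightarrow> (LINT z|lborel. g' z)"
  proof (rule integral_dominated_convergence[where w = "\<lambda>z. B * indicator (cball 0 (B0 + norm b)) z"])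
    show "AE z in lborel. norm (?q i z) \<le> B * indicator (cball 0 (B0 + norm b)) z" for i
    proof (rule AE_I2)
      fix z :: 'a
      have "\<bar>g (z + s i *\<^sub>R b) - g (z + 0 *\<^sub>R b)\<bar> \<le> B * \<bar>s i - 0\<bar>"
        by (rule lipschitz_of_derivative[OF d B])
      then have 1: "\<bar>?q i z\<bar> \<le> B" using s(1)[of i] by (simp add: divide_simps)
      have 2: "?q i z = 0" if "z \<notin> cball 0 (B0 + norm b)"
      proof -
        have "norm (s i *\<^sub>R b) \<le> 1 * norm b" using s[of i] mult_right_mono[of "s i" 1 "norm b"] by simp
        moreover have "norm z \<le> norm (z + s i *\<^sub>R b) + norm (s i *\<^sub>R b)"
          using norm_triangle_ineq4[of "z + s i *\<^sub>R b" "s i *\<^sub>R b"] by simp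
        ultimately have "z \<notin> K" "z + s i *\<^sub>R b \<notin> K"
          using that B0[of z] B0[of "z + s i *\<^sub>R b"] norm_ge_zero[of b] by (auto simp del: norm_ge_zero)
        then show ?thesis using z by simp
      qed
      show "norm (?q i z) \<le> B * indicator (cball 0 (B0 + norm b)) z"
        using 1 2 by (cases "z \<in> cball 0 (B0 + norm b)") auto
    qed
    show "g' \<in> borel_measurable lborel" using borel_measurable_continuous_onI[OF g'] by simp
    show "?q i \<in> borel_measurable lborel" for i using gb by measurable
    show "integrable lborel (\<lambda>z. B * indicator (cball (0::'a) (B0 + norm b)) z)"
      using emeasure_compact_finite[of "cball (0::'a) (B0 + norm b)"] by (intro integrable_mult_right integrable_real_indicator) auto
  qed (use lim in auto)
  then have "(LINT z|lborel. g' z) = 0" by (simp only: q0 LIMSEQ_const_iff)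
  then show ?thesis
    using borel_measurable_continuous_onI[OF g'] by (simp add: integral_completion)
qed

section \<open>The energy inequality\<close>

lemma mol_add:
  assumes "0 < r" "integrable lebesgue f" "integrable lebesgue g"
  shows "mol r (\<lambda>y. f y + g y) z = mol r f z + mol r g z"
  unfolding mol_def
  by (subst Bochner_Integration.integral_add[symmetric])
     (auto intro!: mol_integrand_integrable assms Bochner_Integration.integral_cong simp: algebra_simps)

lemma mol_deriv_add:
  assumes "0 < r" "integrable lebesgue f" "integrable lebesgue g"
  shows "mol_deriv r b (\<lambda>y. f y + g y) z = mol_deriv r b f z + mol_deriv r b g z"
  unfolding mol_deriv_def
  by (subst Bochner_Integration.integral_add[symmetric])
     (auto intro!: mol_deriv_integrand_integrable assms Bochner_Integration.integral_cong simp: algebra_simps)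

text \<open>
  Young's inequality for the conjugate exponents \<open>p / (p - 1)\<close> and \<open>p\<close>, without the sharp constants.
\<close>

lemma young_product:
  fixes x y :: real
  assumes "0 \<le> x" "0 \<le> y" "1 < p"
  shows "x * y \<le> x powr (p / (p - 1)) + y powr p"
proof (cases "x \<le> y powr (p - 1)")
  case True
  then have "x * y \<le> y powr (p - 1) * y" using assms by (intro mult_right_mono)
  also have "\<dots> = y powr p" using assms by (cases "y = 0") (auto simp: powr_diff)
  finally show ?thesis by (simp add: add_increasing)
next
  case False
  then have x0: "0 < x" by (smt (verit) powr_ge_zero)
  have "y = (y powr (p - 1)) powr (1 / (p - 1))" using assms by (simp add: powr_powr)
  also have "\<dots> \<le> x powr (1 / (p - 1))" using False assms by (intro powr_mono2) auto
  finally have "x * y \<le> x * x powr (1 / (p - 1))" using assms by (intro mult_left_mono)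
  also have "\<dots> = x powr (1 + 1 / (p - 1))" using x0 by (simp add: powr_add)
  also have "1 + 1 / (p - 1) = p / (p - 1)" using assms by (simp add: field_simps)
  finally show ?thesis by (simp add: add_increasing2)
qed

text \<open>
  Mollify \<open>\<bar>f(y)\<bar> \<bar>g(x)\<bar> \<le> \<bar>f(y)\<bar>\<^sup>p\<^sup>/\<^sup>(\<^sup>p\<^sup>-\<^sup>1\<^sup>) + \<bar>g(x)\<bar>\<^sup>p\<close> first in \<open>y\<close>, then in \<open>x\<close>. This
  takes the place of convergence of mollifications in \<open>L\<^sup>p\<close>.
\<close>

lemma mol_product_le:
  fixes f g :: "'a::euclidean_space \<Rightarrow> real"
  assumes r: "0 < r" and p: "1 < p"
    and f: "integrable lebesgue f" "integrable lebesgue (\<lambda>y. \<bar>f y\<bar> powr (p / (p - 1)))"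
    and g: "integrable lebesgue g" "integrable lebesgue (\<lambda>y. \<bar>g y\<bar> powr p)"
  shows "\<bar>mol r f z * mol r g z\<bar> \<le> mol r (\<lambda>y. \<bar>f y\<bar> powr (p / (p - 1))) z + mol r (\<lambda>y. \<bar>g y\<bar> powr p) z"
proof -
  let ?A = "mol r (\<lambda>y. \<bar>f y\<bar> powr (p / (p - 1))) z" and ?B = "mol r (\<lambda>y. \<bar>g y\<bar> powr p) z"
  have k: "(LINT y|lebesgue. mker r (z - y)) = 1" by (rule mker_total_mass(2)[OF r])
  have step: "(LINT y|lebesgue. c * mker r (z - y)) = c" "integrable lebesgue (\<lambda>y. c * mker r (z - y))" for c
    using k by (auto intro: integrable_mult_right mker_total_mass(1)[OF r])
  have af: "integrable lebesgue (\<lambda>y. \<bar>f y\<bar>)" and ag: "integrable lebesgue (\<lambda>y. \<bar>g y\<bar>)" using f g by auto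
  note int = mol_integrand_integrable[OF r]
  have 1: "mol r (\<lambda>y. \<bar>f y\<bar>) z * \<bar>g x\<bar> \<le> ?A + \<bar>g x\<bar> powr p" for x
  proof -
    have "mol r (\<lambda>y. \<bar>f y\<bar>) z * \<bar>g x\<bar> = (LINT y|lebesgue. \<bar>g x\<bar> * (\<bar>f y\<bar> * mker r (z - y)))"
      by (simp add: mol_def)
    also have "\<dots> \<le> (LINT y|lebesgue. \<bar>f y\<bar> powr (p / (p - 1)) * mker r (z - y) + \<bar>g x\<bar> powr p * mker r (z - y))"
    proof (rule Bochner_Integration.integral_mono)
      show "\<bar>g x\<bar> * (\<bar>f y\<bar> * mker r (z - y))
          \<le> \<bar>f y\<bar> powr (p / (p - 1)) * mker r (z - y) + \<bar>g x\<bar> powr p * mker r (z - y)" for y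
        using mult_right_mono[OF young_product[of "\<bar>f y\<bar>" "\<bar>g x\<bar>" p] mker_nonneg[OF r, of "z - y"]] p
        by (simp add: algebra_simps)
    qed (intro integrable_mult_right Bochner_Integration.integrable_add int f af step)+
    also have "\<dots> = (LINT y|lebesgue. \<bar>f y\<bar> powr (p / (p - 1)) * mker r (z - y))
        + (LINT y|lebesgue. \<bar>g x\<bar> powr p * mker r (z - y))"
      by (intro Bochner_Integration.integral_add int f step)
    also have "\<dots> = ?A + \<bar>g x\<bar> powr p" by (simp only: mol_def step)
    finally show ?thesis .
  qed
  have "mol r (\<lambda>y. \<bar>f y\<bar>) z * mol r (\<lambda>y. \<bar>g y\<bar>) z
      = (LINT x|lebesgue. mol r (\<lambda>y. \<bar>f y\<bar>) z * (\<bar>g x\<bar> * mker r (z - x)))"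
    by (simp add: mol_def[of _ "\<lambda>y. \<bar>g y\<bar>"])
  also have "\<dots> \<le> (LINT x|lebesgue. ?A * mker r (z - x) + \<bar>g x\<bar> powr p * mker r (z - x))"
  proof (rule Bochner_Integration.integral_mono)
    show "mol r (\<lambda>y. \<bar>f y\<bar>) z * (\<bar>g x\<bar> * mker r (z - x))
        \<le> ?A * mker r (z - x) + \<bar>g x\<bar> powr p * mker r (z - x)" for x
      using mult_right_mono[OF 1[of x] mker_nonneg[OF r, of "z - x"]] by (simp add: algebra_simps)
  qed (intro integrable_mult_right Bochner_Integration.integrable_add int g ag step)+
  also have "\<dots> = (LINT x|lebesgue. ?A * mker r (z - x)) + (LINT x|lebesgue. \<bar>g x\<bar> powr p * mker r (z - x))"
    by (intro Bochner_Integration.integral_add int g step)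
  also have "\<dots> = ?A + ?B" by (simp only: step mol_def[of _ "\<lambda>y. \<bar>g y\<bar> powr p"])
  finally have 2: "mol r (\<lambda>y. \<bar>f y\<bar>) z * mol r (\<lambda>y. \<bar>g y\<bar>) z \<le> ?A + ?B" .
  have "\<bar>mol r f z * mol r g z\<bar> \<le> mol r (\<lambda>y. \<bar>f y\<bar>) z * mol r (\<lambda>y. \<bar>g y\<bar>) z"
    unfolding abs_mult using mol_abs_le[OF r f(1), of z] mol_abs_le[OF r g(1), of z] by (intro mult_mono) auto
  then show ?thesis using 2 by linarith
qed

text \<open>
  Dominated convergence with dominating functions that vary but converge in \<open>L\<^sup>1\<close>: truncate the
  sequence at height \<open>g\<close>; the error is at most \<open>\<bar>gs i - g\<bar>\<close>.
\<close>

lemma integral_tendsto_of_L1_dominated: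
  fixes f :: "'a \<Rightarrow> real"
  assumes fi: "\<And>i. integrable M (fs i)" and f: "f \<in> borel_measurable M"
    and lim: "AE x in M. (\<lambda>i. fs i x) \<longlonglongrightarrow> f x"
    and g: "integrable M g" "\<And>i. integrable M (gs i)"
    and le: "\<And>i. AE x in M. \<bar>fs i x\<bar> \<le> gs i x" "AE x in M. \<bar>f x\<bar> \<le> g x"
    and L1: "(\<lambda>i. LINT x|M. \<bar>gs i x - g x\<bar>) \<longlonglongrightarrow> 0"
  shows "(\<lambda>i. integral\<^sup>L M (fs i)) \<longlonglongrightarrow> integral\<^sup>L M f"
proof -
  define c where "c = (\<lambda>i x. max (- g x) (min (g x) (fs i x)))"
  have cm: "c i \<in> borel_measurable M" for i
    using borel_measurable_integrable[OF g(1)] borel_measurable_integrable[OF fi[of i]] unfolding c_def by measurable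
  have g0: "AE x in M. 0 \<le> g x" using le(2) by eventually_elim auto
  have ci: "integrable M (c i)" for i
    by (rule Bochner_Integration.integrable_bound[OF g(1) cm]) (use g0 in \<open>eventually_elim, auto simp: c_def\<close>)
  have clim: "(\<lambda>i. integral\<^sup>L M (c i)) \<longlonglongrightarrow> integral\<^sup>L M f"
  proof (rule integral_dominated_convergence[where w = g])
    show "AE x in M. (\<lambda>i. c i x) \<longlonglongrightarrow> f x"
      using lim le(2)
    proof eventually_elim
      case (elim x)
      have "(\<lambda>i. c i x) \<longlonglongrightarrow> max (- g x) (min (g x) (f x))"
        unfolding c_def by (intro tendsto_intros elim)
      then show ?case using elim by (simp add: max_def min_def abs_le_iff split: if_splits)
    qed
    show "AE x in M. norm (c i x) \<le> g x" for i
      using g0 by eventually_elim (auto simp: c_def)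
  qed (use f cm g in auto)
  have d: "\<bar>integral\<^sup>L M (fs i) - integral\<^sup>L M (c i)\<bar> \<le> (LINT x|M. \<bar>gs i x - g x\<bar>)" for i
  proof -
    have "\<bar>integral\<^sup>L M (fs i) - integral\<^sup>L M (c i)\<bar> = \<bar>LINT x|M. fs i x - c i x\<bar>"
      by (simp add: Bochner_Integration.integral_diff fi ci)
    also have "\<dots> \<le> (LINT x|M. \<bar>fs i x - c i x\<bar>)" by (rule integral_abs_bound)
    also have "\<dots> \<le> (LINT x|M. \<bar>gs i x - g x\<bar>)"
    proof (rule integral_mono_AE)
      show "AE x in M. \<bar>fs i x - c i x\<bar> \<le> \<bar>gs i x - g x\<bar>"
        using le(1)[of i] g0 by eventually_elim (auto simp: c_def max_def min_def)
    qed (use fi ci g in auto)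
    finally show ?thesis .
  qed
  have "(\<lambda>i. integral\<^sup>L M (fs i) - integral\<^sup>L M (c i)) \<longlonglongrightarrow> 0"
    by (rule Lim_null_comparison[OF _ L1]) (use d in auto)
  from tendsto_add[OF this clim] show ?thesis by simp
qed

lemma mol_AE_subsequence:
  fixes \<F> :: "('a::euclidean_space \<Rightarrow> real) set"
  assumes fin: "finite \<F>" and int: "\<And>f. f \<in> \<F> \<Longrightarrow> integrable lebesgue f"
    and r: "\<And>i. 0 < r i" "r \<longlonglongrightarrow> 0"
  shows "\<exists>s::nat \<Rightarrow> nat. strict_mono s \<and> (\<forall>f\<in>\<F>. AE z in lebesgue. (\<lambda>i. mol (r (s i)) f z) \<longlonglongrightarrow> f z)"
proof -
  define E where "E = (\<lambda>i z. \<Sum>f\<in>\<F>. \<bar>mol (r i) f z - f z\<bar>)"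
  have mi: "integrable lebesgue (\<lambda>z. \<bar>mol (r i) f z - f z\<bar>)" if "f \<in> \<F>" for i f
    by (intro integrable_abs Bochner_Integration.integrable_diff mol_L1_contraction(1) r int that)
  have Ei: "integrable lebesgue (E i)" for i
    unfolding E_def by (intro Bochner_Integration.integrable_sum mi)
  have "(\<lambda>i. \<Sum>f\<in>\<F>. LINT z|lebesgue. \<bar>mol (r i) f z - f z\<bar>) \<longlonglongrightarrow> (\<Sum>f\<in>\<F>. 0)"
    by (intro tendsto_sum mol_tendsto_L1 int r)
  moreover have "(LINT z|lebesgue. norm (E i z)) = (\<Sum>f\<in>\<F>. LINT z|lebesgue. \<bar>mol (r i) f z - f z\<bar>)" for i
    unfolding E_def by (simp add: sum_nonneg Bochner_Integration.integral_sum mi)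
  ultimately have "(\<lambda>i. LINT z|lebesgue. norm (E i z)) \<longlonglongrightarrow> 0" by simp
  from tendsto_L1_AE_subseq[OF Ei this] obtain s where s: "strict_mono s"
    and AE: "AE z in lebesgue. (\<lambda>i. E (s i) z) \<longlonglongrightarrow> 0" by blast
  have "AE z in lebesgue. (\<lambda>i. mol (r (s i)) f z) \<longlonglongrightarrow> f z" if f: "f \<in> \<F>" for f
    using AE
  proof eventually_elim
    case (elim z)
    have "(\<lambda>i. mol (r (s i)) f z - f z) \<longlonglongrightarrow> 0"
      by (rule Lim_null_comparison[OF _ elim])
         (auto simp: E_def fin f intro!: always_eventually member_le_sum[of f \<F> "\<lambda>f. \<bar>mol _ f z - f z\<bar>"])
    then show ?case by (simp add: LIM_zero_iff)
  qed
  then show ?thesis using s by blast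
qed

text \<open>
  \<open>\<phi>\<close> is a nonnegative \<open>C\<^sup>1\<close> function that vanishes, together with its derivatives, outside the
  compact set \<open>K\<close>; \<open>\<phi>' b\<close> is its derivative in the direction \<open>b\<close>. Differentiability is required
  along lines only.
\<close>

definition C1_cutoff :: "'a::euclidean_space set \<Rightarrow> ('a \<Rightarrow> real) \<Rightarrow> ('a \<Rightarrow> 'a \<Rightarrow> real) \<Rightarrow> bool" where
  "C1_cutoff K \<phi> \<phi>' \<longleftrightarrow> compact K \<and> continuous_on UNIV \<phi> \<and> (\<forall>b. continuous_on UNIV (\<phi>' b)) \<and>
     (\<forall>b z s. ((\<lambda>s. \<phi> (z + s *\<^sub>R b)) has_real_derivative \<phi>' b (z + s *\<^sub>R b)) (at s)) \<and>
     (\<forall>z. z \<notin> K \<longrightarrow> \<phi> z = 0 \<and> (\<forall>b. \<phi>' b z = 0)) \<and> (\<forall>z. 0 \<le> \<phi> z)"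

text \<open>
  The pointwise inequality \<open>ineq\<close> for the mollified functions is multiplied by \<open>(m + d)\<^sup>-\<^sup>e \<phi>\<close>, where
  \<open>m\<close> is the mollification of \<open>w\<close>, and integrated by parts. The identity \<open>grad\<close> is used to write
  the gradient of \<open>m\<close> as a mollified gradient.
\<close>

lemma mollified_energy_inequality:
  fixes w G :: "'a::euclidean_space \<Rightarrow> real" and F H :: "'i::finite \<Rightarrow> 'a \<Rightarrow> real" and dir :: "'i \<Rightarrow> 'a"
  assumes r: "0 < r" and w: "integrable lebesgue w" "AE z in lebesgue. 0 \<le> w z"
    and G: "integrable lebesgue G" and F: "\<And>i. integrable lebesgue (F i)" and H: "\<And>i. integrable lebesgue (H i)"
    and \<phi>: "C1_cutoff K \<phi> \<phi>'" and d: "0 < d" and e: "0 \<le> e" "e < 1"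
    and grad: "\<And>i z. z \<in> K \<Longrightarrow> mol_deriv r (dir i) w z = mol r (H i) z"
    and ineq: "\<And>z. z \<in> K \<Longrightarrow> 0 \<le> mol_deriv r \<tau> w z - (\<Sum>i\<in>UNIV. mol_deriv r (dir i) (F i) z) - mol r G z"
  shows "(LINT z|lebesgue. mol r G z * (mol r w z + d) powr (- e) * \<phi> z)
      + e * (\<Sum>i\<in>UNIV. LINT z|lebesgue. mol r (F i) z * mol r (H i) z * (mol r w z + d) powr (- e - 1) * \<phi> z)
    \<le> (\<Sum>i\<in>UNIV. LINT z|lebesgue. mol r (F i) z * (mol r w z + d) powr (- e) * \<phi>' (dir i) z)
      - 1 / (1 - e) * (LINT z|lebesgue. (mol r w z + d) powr (1 - e) * \<phi>' \<tau> z)"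
proof -
  define m where "m = mol r w"
  have K: "compact K" and \<phi>c: "continuous_on UNIV \<phi>" and \<phi>'c: "\<And>b. continuous_on UNIV (\<phi>' b)"
    and \<phi>d: "\<And>b z s. ((\<lambda>s. \<phi> (z + s *\<^sub>R b)) has_real_derivative \<phi>' b (z + s *\<^sub>R b)) (at s)"
    and \<phi>0: "\<And>z. z \<notin> K \<Longrightarrow> \<phi> z = 0" "\<And>z b. z \<notin> K \<Longrightarrow> \<phi>' b z = 0" "\<And>z. 0 \<le> \<phi> z"
    using \<phi> by (auto simp: C1_cutoff_def)
  have m0: "0 \<le> m z" for z unfolding m_def by (rule mol_nonneg[OF r w(2)])
  have md: "0 < m z + d" for z using m0[of z] d by linarith
  have mc: "continuous_on UNIV m" unfolding m_def by (rule continuous_mol[OF r w(1)])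
  have mpc: "continuous_on UNIV (\<lambda>z. (m z + d) powr a)" for a
    by (intro continuous_intros mc) (metis md less_irrefl)
  have Dc: "continuous_on UNIV (mol_deriv r b f)" if "integrable lebesgue f" for b f
    by (rule continuous_mol_deriv[OF r that])
  have Mc: "continuous_on UNIV (mol r f)" if "integrable lebesgue f" for f
    by (rule continuous_mol[OF r that])
  note cs = mpc Dc Mc \<phi>c \<phi>'c w G F H continuous_on_mult continuous_on_add continuous_on_diff continuous_on_const continuous_on_sum
  have mpd: "((\<lambda>s. (m (z + s *\<^sub>R b) + d) powr a) has_real_derivative
      a * (m (z + s *\<^sub>R b) + d) powr (a - 1) * mol_deriv r b w (z + s *\<^sub>R b)) (at s)" for a b z s
    unfolding m_def
  proof -
    have "((\<lambda>x. x powr a) has_real_derivative a * (mol r w (z + s *\<^sub>R b) + d) powr (a - 1))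
        (at (mol r w (z + s *\<^sub>R b) + d))"
      using md[of "z + s *\<^sub>R b"] by (intro has_real_derivative_powr) (simp add: m_def)
    moreover have "((\<lambda>s. mol r w (z + s *\<^sub>R b) + d) has_real_derivative mol_deriv r b w (z + s *\<^sub>R b)) (at s)"
      by (auto intro!: derivative_eq_intros mol_line_derivative[OF r w(1)])
    ultimately show "((\<lambda>s. (mol r w (z + s *\<^sub>R b) + d) powr a) has_real_derivative
        a * (mol r w (z + s *\<^sub>R b) + d) powr (a - 1) * mol_deriv r b w (z + s *\<^sub>R b)) (at s)"
      using DERIV_chain2 by fast
  qed
  have ci: "integrable lebesgue f" if "continuous_on UNIV f" "\<And>z. z \<notin> K \<Longrightarrow> f z = 0" for f :: "'a \<Rightarrow> real"
    by (rule integrable_compact_support(2)[OF that(1) K that(2)])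
  have time: "(LINT z|lebesgue. mol_deriv r \<tau> w z * (m z + d) powr (- e) * \<phi> z)
      = - (1 / (1 - e)) * (LINT z|lebesgue. (m z + d) powr (1 - e) * \<phi>' \<tau> z)"
  proof -
    have "(LINT z|lebesgue. mol_deriv r \<tau> w z * (m z + d) powr (- e) * \<phi> z
        + 1 / (1 - e) * ((m z + d) powr (1 - e) * \<phi>' \<tau> z)) = 0"
    proof (rule integral_line_derivative_eq_0[where b = \<tau> and K = K and g = "\<lambda>z. 1 / (1 - e) * ((m z + d) powr (1 - e) * \<phi> z)"])
      show "((\<lambda>s. 1 / (1 - e) * ((m (z + s *\<^sub>R \<tau>) + d) powr (1 - e) * \<phi> (z + s *\<^sub>R \<tau>))) has_real_derivative
          mol_deriv r \<tau> w (z + s *\<^sub>R \<tau>) * (m (z + s *\<^sub>R \<tau>) + d) powr (- e) * \<phi> (z + s *\<^sub>R \<tau>)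
          + 1 / (1 - e) * ((m (z + s *\<^sub>R \<tau>) + d) powr (1 - e) * \<phi>' \<tau> (z + s *\<^sub>R \<tau>))) (at s)" for z s
        by (rule derivative_eq_intros mpd \<phi>d refl)+ (use e in \<open>simp add: field_simps\<close>)
    qed (use K \<phi>0 e in \<open>auto intro!: cs continuous_on_divide\<close>)
    moreover have "integrable lebesgue (\<lambda>z. mol_deriv r \<tau> w z * (m z + d) powr (- e) * \<phi> z)"
      "integrable lebesgue (\<lambda>z. (m z + d) powr (1 - e) * \<phi>' \<tau> z)"
      by (rule ci; use \<phi>0 in \<open>auto intro!: cs\<close>)+
    ultimately show ?thesis by (simp add: Bochner_Integration.integral_add)
  qed
  have space: "(LINT z|lebesgue. mol_deriv r (dir i) (F i) z * (m z + d) powr (- e) * \<phi> z)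
      = e * (LINT z|lebesgue. mol r (F i) z * mol r (H i) z * (m z + d) powr (- e - 1) * \<phi> z)
        - (LINT z|lebesgue. mol r (F i) z * (m z + d) powr (- e) * \<phi>' (dir i) z)" for i
  proof -
    have eq: "mol r (F i) z * (m z + d) powr (- e - 1) * mol_deriv r (dir i) w z * \<phi> z
        = mol r (F i) z * mol r (H i) z * (m z + d) powr (- e - 1) * \<phi> z" for z
      using grad[of z i] \<phi>0(1)[of z] by (cases "z \<in> K") auto
    have "(LINT z|lebesgue. mol_deriv r (dir i) (F i) z * (m z + d) powr (- e) * \<phi> z
        + (- e) * (mol r (F i) z * (m z + d) powr (- e - 1) * mol_deriv r (dir i) w z * \<phi> z)
        + mol r (F i) z * (m z + d) powr (- e) * \<phi>' (dir i) z) = 0"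
    proof (rule integral_line_derivative_eq_0[where b = "dir i" and K = K and g = "\<lambda>z. mol r (F i) z * (m z + d) powr (- e) * \<phi> z"])
      show "((\<lambda>s. mol r (F i) (z + s *\<^sub>R dir i) * (m (z + s *\<^sub>R dir i) + d) powr (- e) * \<phi> (z + s *\<^sub>R dir i)) has_real_derivative
          mol_deriv r (dir i) (F i) (z + s *\<^sub>R dir i) * (m (z + s *\<^sub>R dir i) + d) powr (- e) * \<phi> (z + s *\<^sub>R dir i)
          + (- e) * (mol r (F i) (z + s *\<^sub>R dir i) * (m (z + s *\<^sub>R dir i) + d) powr (- e - 1)
              * mol_deriv r (dir i) w (z + s *\<^sub>R dir i) * \<phi> (z + s *\<^sub>R dir i))
          + mol r (F i) (z + s *\<^sub>R dir i) * (m (z + s *\<^sub>R dir i) + d) powr (- e) * \<phi>' (dir i) (z + s *\<^sub>R dir i)) (at s)" for z s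
        by (rule derivative_eq_intros mpd \<phi>d mol_line_derivative[OF r F] refl)+ (simp add: field_simps)
    qed (use K \<phi>0 in \<open>auto intro!: cs\<close>)
    moreover have "integrable lebesgue (\<lambda>z. mol_deriv r (dir i) (F i) z * (m z + d) powr (- e) * \<phi> z)"
      "integrable lebesgue (\<lambda>z. mol r (F i) z * (m z + d) powr (- e) * \<phi>' (dir i) z)"
      "integrable lebesgue (\<lambda>z. mol r (F i) z * mol r (H i) z * (m z + d) powr (- e - 1) * \<phi> z)"
      by (rule ci; use \<phi>0 in \<open>auto intro!: cs\<close>)+
    ultimately show ?thesis unfolding eq by (simp add: Bochner_Integration.integral_add)
  qed
  have int1: "integrable lebesgue (\<lambda>z. mol_deriv r \<tau> w z * (m z + d) powr (- e) * \<phi> z)"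
    "integrable lebesgue (\<lambda>z. mol r G z * (m z + d) powr (- e) * \<phi> z)"
    "\<And>i. integrable lebesgue (\<lambda>z. mol_deriv r (dir i) (F i) z * (m z + d) powr (- e) * \<phi> z)"
    by (rule ci; use \<phi>0 in \<open>auto intro!: cs\<close>)+
  have "0 \<le> (LINT z|lebesgue. mol_deriv r \<tau> w z * (m z + d) powr (- e) * \<phi> z
      - (\<Sum>i\<in>UNIV. mol_deriv r (dir i) (F i) z * (m z + d) powr (- e) * \<phi> z)
      - mol r G z * (m z + d) powr (- e) * \<phi> z)"
  proof (rule Bochner_Integration.integral_nonneg)
    fix z
    show "0 \<le> mol_deriv r \<tau> w z * (m z + d) powr (- e) * \<phi> z
      - (\<Sum>i\<in>UNIV. mol_deriv r (dir i) (F i) z * (m z + d) powr (- e) * \<phi> z)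
      - mol r G z * (m z + d) powr (- e) * \<phi> z"
    proof (cases "z \<in> K")
      case True
      have "0 \<le> (mol_deriv r \<tau> w z - (\<Sum>i\<in>UNIV. mol_deriv r (dir i) (F i) z) - mol r G z) * ((m z + d) powr (- e) * \<phi> z)"
        using ineq[OF True] \<phi>0(3)[of z] by (intro mult_nonneg_nonneg) auto
      then show ?thesis by (simp add: algebra_simps sum_distrib_left)
    qed (simp add: \<phi>0)
  qed
  also have "\<dots> = (LINT z|lebesgue. mol_deriv r \<tau> w z * (m z + d) powr (- e) * \<phi> z)
      - (\<Sum>i\<in>UNIV. LINT z|lebesgue. mol_deriv r (dir i) (F i) z * (m z + d) powr (- e) * \<phi> z)
      - (LINT z|lebesgue. mol r G z * (m z + d) powr (- e) * \<phi> z)"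
    using int1 by (simp add: Bochner_Integration.integral_diff Bochner_Integration.integral_sum)
  finally show ?thesis
    unfolding time space
    by (simp add: m_def sum_subtractf sum_distrib_left)
qed

lemma L1_null_bound:
  fixes h :: "nat \<Rightarrow> 'a \<Rightarrow> real"
  assumes "\<And>i. integrable M (h i)" "\<And>i. integrable M (k i)" "\<And>i x. \<bar>h i x\<bar> \<le> k i x"
    and "(\<lambda>i. integral\<^sup>L M (k i)) \<longlonglongrightarrow> 0"
  shows "(\<lambda>i. LINT x|M. \<bar>h i x\<bar>) \<longlonglongrightarrow> 0"
proof (rule Lim_null_comparison[OF _ assms(4)], intro always_eventually allI)
  fix i
  have "(LINT x|M. \<bar>h i x\<bar>) \<le> integral\<^sup>L M (k i)"
    using assms by (intro Bochner_Integration.integral_mono) auto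
  then show "norm (LINT x|M. \<bar>h i x\<bar>) \<le> integral\<^sup>L M (k i)"
    by (simp add: Bochner_Integration.integral_nonneg)
qed

lemma mol_times_bounded_tendsto:
  fixes f b :: "'a::euclidean_space \<Rightarrow> real"
  assumes r: "\<And>j. 0 < r j" "r \<longlonglongrightarrow> 0" and f: "integrable lebesgue f"
    and lim: "AE z in lebesgue. (\<lambda>j. mol (r j) f z) \<longlonglongrightarrow> f z"
    and b: "b \<in> borel_measurable lebesgue" "\<And>j. bs j \<in> borel_measurable lebesgue"
    and blim: "AE z in lebesgue. (\<lambda>j. bs j z) \<longlonglongrightarrow> b z"
    and bd: "AE z in lebesgue. \<bar>b z\<bar> \<le> C" "\<And>j z. \<bar>bs j z\<bar> \<le> C"
  shows "integrable lebesgue (\<lambda>z. f z * b z)"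
    and "(\<lambda>j. LINT z|lebesgue. mol (r j) f z * bs j z) \<longlonglongrightarrow> (LINT z|lebesgue. f z * b z)"
proof -
  have C: "0 \<le> C" using bd(2)[of 0 undefined] by linarith
  have mi: "integrable lebesgue (mol (r j) f)" for j by (rule mol_L1_contraction(1)[OF r(1) f])
  show fb: "integrable lebesgue (\<lambda>z. f z * b z)"
  proof (rule Bochner_Integration.integrable_bound[OF integrable_mult_right[OF integrable_abs[OF f], of C]])
    show "(\<lambda>z. f z * b z) \<in> borel_measurable lebesgue" using f b by measurable
    show "AE z in lebesgue. norm (f z * b z) \<le> norm (C * \<bar>f z\<bar>)"
      using bd(1) by eventually_elim (use C in \<open>simp add: abs_mult mult.commute[of C] mult_left_mono\<close>)
  qed
  show "(\<lambda>j. LINT z|lebesgue. mol (r j) f z * bs j z) \<longlonglongrightarrow> (LINT z|lebesgue. f z * b z)"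
  proof (rule integral_tendsto_of_L1_dominated[where g = "\<lambda>z. C * \<bar>f z\<bar>" and gs = "\<lambda>j z. C * \<bar>mol (r j) f z\<bar>"])
    show "integrable lebesgue (\<lambda>z. mol (r j) f z * bs j z)" for j
      by (rule integrable_mult_bounded[OF mi b(2) bd(2)])
    show "AE z in lebesgue. (\<lambda>j. mol (r j) f z * bs j z) \<longlonglongrightarrow> f z * b z"
      using lim blim by eventually_elim (rule tendsto_mult)
    show "AE z in lebesgue. \<bar>mol (r j) f z * bs j z\<bar> \<le> C * \<bar>mol (r j) f z\<bar>" for j
      by (rule AE_I2) (simp add: abs_mult mult.commute[of C] mult_left_mono bd)
    show "AE z in lebesgue. \<bar>f z * b z\<bar> \<le> C * \<bar>f z\<bar>"
      using bd(1) by eventually_elim (simp add: abs_mult mult.commute[of C] mult_left_mono)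
    show "(\<lambda>j. LINT z|lebesgue. \<bar>C * \<bar>mol (r j) f z\<bar> - C * \<bar>f z\<bar>\<bar>) \<longlonglongrightarrow> 0"
    proof (rule L1_null_bound[where k = "\<lambda>j z. C * \<bar>mol (r j) f z - f z\<bar>"])
      show "\<bar>C * \<bar>mol (r j) f z\<bar> - C * \<bar>f z\<bar>\<bar> \<le> C * \<bar>mol (r j) f z - f z\<bar>" for j z
        using C by (simp add: abs_mult mult_left_mono flip: right_diff_distrib)
      show "(\<lambda>j. LINT z|lebesgue. C * \<bar>mol (r j) f z - f z\<bar>) \<longlonglongrightarrow> 0"
        using tendsto_mult_right_zero[OF mol_tendsto_L1[OF f r], of C] by simp
    qed (use mi f in auto)
  qed (use f mi fb in auto)
qed

lemma mol_product_tendsto: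
  fixes f g b :: "'a::euclidean_space \<Rightarrow> real"
  assumes r: "\<And>j. 0 < r j" "r \<longlonglongrightarrow> 0" and p: "1 < p"
    and f: "integrable lebesgue f" "integrable lebesgue (\<lambda>y. \<bar>f y\<bar> powr (p / (p - 1)))"
    and g: "integrable lebesgue g" "integrable lebesgue (\<lambda>y. \<bar>g y\<bar> powr p)"
    and lim: "AE z in lebesgue. (\<lambda>j. mol (r j) f z) \<longlonglongrightarrow> f z" "AE z in lebesgue. (\<lambda>j. mol (r j) g z) \<longlonglongrightarrow> g z"
    and b: "b \<in> borel_measurable lebesgue" "\<And>j. bs j \<in> borel_measurable lebesgue"
    and blim: "AE z in lebesgue. (\<lambda>j. bs j z) \<longlonglongrightarrow> b z"
    and bd: "AE z in lebesgue. \<bar>b z\<bar> \<le> C" "\<And>j z. \<bar>bs j z\<bar> \<le> C"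
  shows "integrable lebesgue (\<lambda>z. f z * g z * b z)"
    and "(\<lambda>j. LINT z|lebesgue. mol (r j) f z * mol (r j) g z * bs j z) \<longlonglongrightarrow> (LINT z|lebesgue. f z * g z * b z)"
proof -
  have C: "0 \<le> C" using bd(2)[of 0 undefined] by linarith
  define f' where "f' = (\<lambda>y. \<bar>f y\<bar> powr (p / (p - 1)))"
  define g' where "g' = (\<lambda>y. \<bar>g y\<bar> powr p)"
  have f': "integrable lebesgue f'" and g': "integrable lebesgue g'" using f g by (auto simp: f'_def g'_def)
  note mi = mol_L1_contraction(1)[OF r(1)]
  have fm: "f \<in> borel_measurable lebesgue" and gm: "g \<in> borel_measurable lebesgue" using f g by auto
  have mm: "mol (r j) f \<in> borel_measurable lebesgue" "mol (r j) g \<in> borel_measurable lebesgue" for j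
    by (intro borel_measurable_integrable mi f g)+
  let ?G = "\<lambda>z. C * (f' z + g' z)" and ?Gs = "\<lambda>j z. C * (mol (r j) f' z + mol (r j) g' z)"
  have le: "\<bar>f z * g z * b z\<bar> \<le> ?G z" if "\<bar>b z\<bar> \<le> C" for z
  proof -
    have "\<bar>f z\<bar> * \<bar>g z\<bar> * \<bar>b z\<bar> \<le> (f' z + g' z) * C"
      using that p by (intro mult_mono) (auto simp: f'_def g'_def intro!: young_product)
    then show ?thesis by (simp add: abs_mult mult_ac)
  qed
  have les: "\<bar>mol (r j) f z * mol (r j) g z * bs j z\<bar> \<le> ?Gs j z" for j z
  proof -
    have "\<bar>mol (r j) f z * mol (r j) g z\<bar> * \<bar>bs j z\<bar> \<le> (mol (r j) f' z + mol (r j) g' z) * C"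
      unfolding f'_def g'_def
    proof (intro mult_mono mol_product_le r p f g bd)
      show "0 \<le> mol (r j) (\<lambda>y. \<bar>f y\<bar> powr (p / (p - 1))) z + mol (r j) (\<lambda>y. \<bar>g y\<bar> powr p) z"
        by (intro add_nonneg_nonneg mol_nonneg r) auto
    qed auto
    then show ?thesis by (simp add: abs_mult mult_ac)
  qed
  have Gi: "integrable lebesgue ?G" "integrable lebesgue (?Gs j)" for j
    by (intro integrable_mult_right Bochner_Integration.integrable_add f' g' mi)+
  have G0: "0 \<le> f' z + g' z" for z by (simp add: f'_def g'_def)
  have AEle: "AE z in lebesgue. \<bar>f z * g z * b z\<bar> \<le> ?G z"
    using bd(1) by eventually_elim (rule le)
  show fb: "integrable lebesgue (\<lambda>z. f z * g z * b z)"
  proof (rule Bochner_Integration.integrable_bound[OF Gi(1)])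
    show "(\<lambda>z. f z * g z * b z) \<in> borel_measurable lebesgue" using fm gm b by measurable
    show "AE z in lebesgue. norm (f z * g z * b z) \<le> norm (?G z)"
      using AEle by eventually_elim auto
  qed
  show "(\<lambda>j. LINT z|lebesgue. mol (r j) f z * mol (r j) g z * bs j z) \<longlonglongrightarrow> (LINT z|lebesgue. f z * g z * b z)"
  proof (rule integral_tendsto_of_L1_dominated[where g = ?G and gs = ?Gs])
    show "integrable lebesgue (\<lambda>z. mol (r j) f z * mol (r j) g z * bs j z)" for j
    proof (rule Bochner_Integration.integrable_bound[OF Gi(2)])
      show "(\<lambda>z. mol (r j) f z * mol (r j) g z * bs j z) \<in> borel_measurable lebesgue" using mm b by measurable
      show "AE z in lebesgue. norm (mol (r j) f z * mol (r j) g z * bs j z) \<le> norm (?Gs j z)"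
        unfolding real_norm_def by (intro AE_I2 order_trans[OF les abs_ge_self])
    qed
    show "AE z in lebesgue. (\<lambda>j. mol (r j) f z * mol (r j) g z * bs j z) \<longlonglongrightarrow> f z * g z * b z"
      using lim blim by eventually_elim (intro tendsto_mult)
    show "(\<lambda>j. LINT z|lebesgue. \<bar>?Gs j z - ?G z\<bar>) \<longlonglongrightarrow> 0"
    proof (rule L1_null_bound[where k = "\<lambda>j z. C * (\<bar>mol (r j) f' z - f' z\<bar> + \<bar>mol (r j) g' z - g' z\<bar>)"])
      show "\<bar>?Gs j z - ?G z\<bar> \<le> C * (\<bar>mol (r j) f' z - f' z\<bar> + \<bar>mol (r j) g' z - g' z\<bar>)" for j z
      proof -
        have "\<bar>?Gs j z - ?G z\<bar> = C * \<bar>(mol (r j) f' z + mol (r j) g' z) - (f' z + g' z)\<bar>"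
          using C by (simp add: abs_mult flip: right_diff_distrib)
        also have "\<dots> \<le> C * (\<bar>mol (r j) f' z - f' z\<bar> + \<bar>mol (r j) g' z - g' z\<bar>)"
          using C by (intro mult_left_mono) auto
        finally show ?thesis .
      qed
      have "(\<lambda>j. C * ((LINT z|lebesgue. \<bar>mol (r j) f' z - f' z\<bar>) + (LINT z|lebesgue. \<bar>mol (r j) g' z - g' z\<bar>))) \<longlonglongrightarrow> C * (0 + 0)"
        by (intro tendsto_intros mol_tendsto_L1 f' g' r)
      moreover have "(LINT z|lebesgue. C * (\<bar>mol (r j) f' z - f' z\<bar> + \<bar>mol (r j) g' z - g' z\<bar>))
          = C * ((LINT z|lebesgue. \<bar>mol (r j) f' z - f' z\<bar>) + (LINT z|lebesgue. \<bar>mol (r j) g' z - g' z\<bar>))" for j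
        using f' g' mi[OF f', of j] mi[OF g', of j] by (simp add: Bochner_Integration.integral_add)
      ultimately show "(\<lambda>j. LINT z|lebesgue. C * (\<bar>mol (r j) f' z - f' z\<bar> + \<bar>mol (r j) g' z - g' z\<bar>)) \<longlonglongrightarrow> 0"
        by (simp only: add_0_left mult_zero_right)
      show "integrable lebesgue (\<lambda>z. C * (\<bar>mol (r j) f' z - f' z\<bar> + \<bar>mol (r j) g' z - g' z\<bar>))" for j
        by (intro integrable_mult_right Bochner_Integration.integrable_add integrable_abs
            Bochner_Integration.integrable_diff f' g' mi)
      show "integrable lebesgue (\<lambda>z. ?Gs j z - ?G z)" for j
        by (intro Bochner_Integration.integrable_diff Gi)
    qed
  qed (use Gi les AEle borel_measurable_integrable[OF fb] in auto)
qed

text \<open>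
  The limit of \<open>mollified_energy_inequality\<close> along radii \<open>h j\<close> tending to 0. The functions \<open>w\<close>, \<open>G\<close>,
  \<open>F\<close>, \<open>H\<close> are global; \<open>H\<close> plays the role of the gradient of \<open>w\<close>, through the assumption \<open>grad\<close>.
\<close>

lemma energy_inequality:
  fixes w G :: "'a::euclidean_space \<Rightarrow> real" and F H :: "'i::finite \<Rightarrow> 'a \<Rightarrow> real" and dir :: "'i \<Rightarrow> 'a"
  assumes h: "\<And>j. 0 < h j" "h \<longlonglongrightarrow> 0" and p: "1 < p"
    and w: "integrable lebesgue w" "AE z in lebesgue. 0 \<le> w z"
    and G: "integrable lebesgue G" and F: "\<And>i. integrable lebesgue (F i)" and H: "\<And>i. integrable lebesgue (H i)"
    and Fp: "\<And>i. integrable lebesgue (\<lambda>z. \<bar>F i z\<bar> powr (p / (p - 1)))"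
    and Hp: "\<And>i. integrable lebesgue (\<lambda>z. \<bar>H i z\<bar> powr p)"
    and \<phi>: "C1_cutoff K \<phi> \<phi>'" and d: "0 < d" and e: "0 \<le> e" "e < 1"
    and grad: "\<And>j i z. z \<in> K \<Longrightarrow> mol_deriv (h j) (dir i) w z = mol (h j) (H i) z"
    and ineq: "\<And>j z. z \<in> K \<Longrightarrow> 0 \<le> mol_deriv (h j) \<tau> w z - (\<Sum>i\<in>UNIV. mol_deriv (h j) (dir i) (F i) z) - mol (h j) G z"
  shows "integrable lebesgue (\<lambda>z. G z * ((w z + d) powr (- e) * \<phi> z))" (is ?i1)
    and "\<And>i. integrable lebesgue (\<lambda>z. F i z * H i z * ((w z + d) powr (- e - 1) * \<phi> z))" (is "PROP ?i2")
    and "\<And>i. integrable lebesgue (\<lambda>z. F i z * ((w z + d) powr (- e) * \<phi>' (dir i) z))" (is "PROP ?i3")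
    and "integrable lebesgue (\<lambda>z. (w z + d) powr (1 - e) * \<phi>' \<tau> z)" (is ?i4)
    and "(LINT z|lebesgue. G z * ((w z + d) powr (- e) * \<phi> z))
      + e * (\<Sum>i\<in>UNIV. LINT z|lebesgue. F i z * H i z * ((w z + d) powr (- e - 1) * \<phi> z))
    \<le> (\<Sum>i\<in>UNIV. LINT z|lebesgue. F i z * ((w z + d) powr (- e) * \<phi>' (dir i) z))
      - 1 / (1 - e) * (LINT z|lebesgue. (w z + d) powr (1 - e) * \<phi>' \<tau> z)" (is ?le)
proof -
  have K: "compact K" and \<phi>c: "continuous_on UNIV \<phi>" and \<phi>'c: "\<And>b. continuous_on UNIV (\<phi>' b)"
    and \<phi>0: "\<And>z. z \<notin> K \<Longrightarrow> \<phi> z = 0" "\<And>z b. z \<notin> K \<Longrightarrow> \<phi>' b z = 0" "\<And>z. 0 \<le> \<phi> z"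
    using \<phi> by (auto simp: C1_cutoff_def)
  obtain R where R: "\<And>x. x \<in> K \<Longrightarrow> norm x \<le> R" using compact_imp_bounded[OF K] by (auto simp: bounded_iff)
  have bdd: "\<exists>B. \<forall>z. \<bar>f z\<bar> \<le> B" if "continuous_on UNIV f" "\<And>z. z \<notin> K \<Longrightarrow> f z = 0" for f :: "'a \<Rightarrow> real"
    by (rule bounded_of_compact_support[of f "R + 1", OF that(1)]) (use that(2) R in force)
  have "finite (insert w (insert G (range F \<union> range H)))" by simp
  then obtain s where s: "strict_mono s"
    and lim0: "\<And>f. f \<in> insert w (insert G (range F \<union> range H)) \<Longrightarrow> AE z in lebesgue. (\<lambda>i. mol (h (s i)) f z) \<longlonglongrightarrow> f z"
    using mol_AE_subsequence[of "insert w (insert G (range F \<union> range H))" h] h w G F H by blast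
  define r where "r = h \<circ> s"
  have r: "0 < r j" "r \<longlonglongrightarrow> 0" for j
    unfolding r_def using h s by (auto intro: LIMSEQ_subseq_LIMSEQ)
  have lim: "AE z in lebesgue. (\<lambda>i. mol (r i) w z) \<longlonglongrightarrow> w z" "AE z in lebesgue. (\<lambda>i. mol (r i) G z) \<longlonglongrightarrow> G z"
    "AE z in lebesgue. (\<lambda>j. mol (r j) (F i) z) \<longlonglongrightarrow> F i z" "AE z in lebesgue. (\<lambda>j. mol (r j) (H i) z) \<longlonglongrightarrow> H i z" for i
    using lim0 by (auto simp: r_def)
  have wm: "w \<in> borel_measurable lebesgue" using w by auto
  have m0: "0 \<le> mol (r j) w z" for j z by (rule mol_nonneg[OF r(1) w(2)])
  have md: "d \<le> mol (r j) w z + d" for j z using m0[of j z] by linarith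
  have mm: "mol (r j) w \<in> borel_measurable lebesgue" for j
    by (intro borel_measurable_integrable mol_L1_contraction(1) r w)
  \<comment> \<open>The shift \<open>d\<close> makes the weights \<open>(w + d)\<^sup>-\<^sup>a\<close> bounded by \<open>d\<^sup>-\<^sup>a\<close>.\<close>
  have weight: "(\<lambda>z. (w z + d) powr (- a) * f z) \<in> borel_measurable lebesgue"
      "(\<lambda>z. (mol (r j) w z + d) powr (- a) * f z) \<in> borel_measurable lebesgue"
      "AE z in lebesgue. (\<lambda>j. (mol (r j) w z + d) powr (- a) * f z) \<longlonglongrightarrow> (w z + d) powr (- a) * f z"
      "AE z in lebesgue. \<bar>(w z + d) powr (- a) * f z\<bar> \<le> d powr (- a) * B"
      "\<bar>(mol (r j) w z + d) powr (- a) * f z\<bar> \<le> d powr (- a) * B"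
    if f: "continuous_on UNIV f" "\<And>z. \<bar>f z\<bar> \<le> B" and a: "0 \<le> a" for f :: "'a \<Rightarrow> real" and B a j z
  proof -
    have fm: "f \<in> borel_measurable lebesgue" by (rule continuous_lebesgue_measurable[OF f(1)])
    show "(\<lambda>z. (w z + d) powr (- a) * f z) \<in> borel_measurable lebesgue"
      using wm fm by measurable
    show "(\<lambda>z. (mol (r j) w z + d) powr (- a) * f z) \<in> borel_measurable lebesgue"
      using mm[of j] fm by measurable
    show "AE z in lebesgue. (\<lambda>j. (mol (r j) w z + d) powr (- a) * f z) \<longlonglongrightarrow> (w z + d) powr (- a) * f z"
      using lim(1) w(2)
    proof eventually_elim
      case (elim z)
      then show ?case using d by (intro tendsto_intros) auto
    qed
    have bd: "\<bar>x powr (- a) * f z\<bar> \<le> d powr (- a) * B" if "d \<le> x" for x z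
    proof -
      have "x powr (- a) \<le> d powr (- a)" using that d a by (intro powr_mono2') auto
      then show ?thesis unfolding abs_mult using f(2)[of z] by (intro mult_mono) auto
    qed
    show "AE z in lebesgue. \<bar>(w z + d) powr (- a) * f z\<bar> \<le> d powr (- a) * B"
      using w(2) by eventually_elim (intro bd, simp)
    show "\<bar>(mol (r j) w z + d) powr (- a) * f z\<bar> \<le> d powr (- a) * B" by (intro bd md)
  qed
  obtain B where B: "\<And>z. \<bar>\<phi> z\<bar> \<le> B" using bdd[OF \<phi>c \<phi>0(1)] by blast
  have "\<exists>B. \<forall>z. \<bar>\<phi>' b z\<bar> \<le> B" for b by (rule bdd[OF \<phi>'c \<phi>0(2)])
  then obtain B' where B': "\<And>b z. \<bar>\<phi>' b z\<bar> \<le> B' b" by metis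
  have e1: "- e - 1 = - (e + 1)" "0 \<le> e + 1" using e by auto
  note w\<phi> = weight[OF \<phi>c B e(1)] and w\<phi>1 = weight[OF \<phi>c B e1(2)] and w\<phi>' = weight[OF \<phi>'c B' e(1)]
  have t1: "integrable lebesgue (\<lambda>z. G z * ((w z + d) powr (- e) * \<phi> z))"
    "(\<lambda>j. LINT z|lebesgue. mol (r j) G z * ((mol (r j) w z + d) powr (- e) * \<phi> z))
      \<longlonglongrightarrow> (LINT z|lebesgue. G z * ((w z + d) powr (- e) * \<phi> z))"
    by (rule mol_times_bounded_tendsto[OF r G lim(2) w\<phi>])+
  have t2: "integrable lebesgue (\<lambda>z. F i z * H i z * ((w z + d) powr (- e - 1) * \<phi> z))"
    "(\<lambda>j. LINT z|lebesgue. mol (r j) (F i) z * mol (r j) (H i) z * ((mol (r j) w z + d) powr (- e - 1) * \<phi> z))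
      \<longlonglongrightarrow> (LINT z|lebesgue. F i z * H i z * ((w z + d) powr (- e - 1) * \<phi> z))" for i
    unfolding e1(1)
    by (rule mol_product_tendsto[OF r p F Fp H Hp lim(3) lim(4) w\<phi>1])+
  have t3: "integrable lebesgue (\<lambda>z. F i z * ((w z + d) powr (- e) * \<phi>' (dir i) z))"
    "(\<lambda>j. LINT z|lebesgue. mol (r j) (F i) z * ((mol (r j) w z + d) powr (- e) * \<phi>' (dir i) z))
      \<longlonglongrightarrow> (LINT z|lebesgue. F i z * ((w z + d) powr (- e) * \<phi>' (dir i) z))" for i
    by (rule mol_times_bounded_tendsto[OF r F lim(3) w\<phi>'])+
  let ?T = "B' \<tau>"
  have T0: "0 \<le> ?T" using B'[of \<tau> undefined] by linarith
  have Kfin: "integrable lebesgue (indicator K :: 'a \<Rightarrow> real)"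
    using emeasure_compact_finite[OF K] K by (intro integrable_real_indicator) (auto simp: compact_imp_closed less_top[symmetric])
  define g where "g = (\<lambda>z. ?T * ((1 + d) * indicator K z + \<bar>w z\<bar>))"
  define gs where "gs = (\<lambda>j z. ?T * ((1 + d) * indicator K z + \<bar>mol (r j) w z\<bar>))"
  have gi: "integrable lebesgue g" "integrable lebesgue (gs j)" for j
    unfolding g_def gs_def
    by (intro integrable_mult_right Bochner_Integration.integrable_add Kfin integrable_abs w mol_L1_contraction(1) r)+
  have tb: "\<bar>(x + d) powr (1 - e) * \<phi>' \<tau> z\<bar> \<le> ?T * ((1 + d) * indicator K z + \<bar>x\<bar>)" if "0 \<le> x" for x z
  proof (cases "z \<in> K")
    case True
    have "(x + d) powr (1 - e) \<le> 1 + (x + d)"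
    proof (cases "x + d \<le> 1")
      case True
      then have "(x + d) powr (1 - e) \<le> 1 powr (1 - e)" using that d e by (intro powr_mono2) auto
      then show ?thesis using that d by simp
    next
      case False
      then have "(x + d) powr (1 - e) \<le> (x + d) powr 1" using e by (intro powr_mono) auto
      then show ?thesis using that d by simp
    qed
    then have "(x + d) powr (1 - e) * \<bar>\<phi>' \<tau> z\<bar> \<le> (1 + (x + d)) * ?T"
      using B' that d by (intro mult_mono) auto
    then show ?thesis using True that by (simp add: abs_mult algebra_simps)
  qed (use \<phi>0 T0 in simp)
  have cm: "\<phi>' \<tau> \<in> borel_measurable lebesgue" by (rule continuous_lebesgue_measurable[OF \<phi>'c])
  have fm: "(\<lambda>z. (w z + d) powr (1 - e) * \<phi>' \<tau> z) \<in> borel_measurable lebesgue" using wm cm by measurable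
  have AEt: "AE z in lebesgue. \<bar>(w z + d) powr (1 - e) * \<phi>' \<tau> z\<bar> \<le> g z"
    unfolding g_def using w(2) by eventually_elim (rule tb)
  have t4i: "integrable lebesgue (\<lambda>z. (w z + d) powr (1 - e) * \<phi>' \<tau> z)"
    by (rule Bochner_Integration.integrable_bound[OF gi(1) fm]) (use AEt in \<open>eventually_elim, auto\<close>)
  have t4: "(\<lambda>j. LINT z|lebesgue. (mol (r j) w z + d) powr (1 - e) * \<phi>' \<tau> z)
      \<longlonglongrightarrow> (LINT z|lebesgue. (w z + d) powr (1 - e) * \<phi>' \<tau> z)"
  proof (rule integral_tendsto_of_L1_dominated[where g = g and gs = gs])
    show le: "AE z in lebesgue. \<bar>(mol (r j) w z + d) powr (1 - e) * \<phi>' \<tau> z\<bar> \<le> gs j z" for j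
      unfolding gs_def using tb[OF m0] by auto
    show "integrable lebesgue (\<lambda>z. (mol (r j) w z + d) powr (1 - e) * \<phi>' \<tau> z)" for j
    proof (rule Bochner_Integration.integrable_bound[OF gi(2)[of j]])
      show "(\<lambda>z. (mol (r j) w z + d) powr (1 - e) * \<phi>' \<tau> z) \<in> borel_measurable lebesgue"
        using mm[of j] cm by measurable
      show "AE z in lebesgue. norm ((mol (r j) w z + d) powr (1 - e) * \<phi>' \<tau> z) \<le> norm (gs j z)"
        using le[of j] by eventually_elim auto
    qed
    show "AE z in lebesgue. (\<lambda>j. (mol (r j) w z + d) powr (1 - e) * \<phi>' \<tau> z) \<longlonglongrightarrow> (w z + d) powr (1 - e) * \<phi>' \<tau> z"
      using lim(1) w(2)
    proof eventually_elim
      case (elim z)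
      then show ?case using d by (intro tendsto_intros) auto
    qed
    show "(\<lambda>j. LINT z|lebesgue. \<bar>gs j z - g z\<bar>) \<longlonglongrightarrow> 0"
    proof (rule L1_null_bound[where k = "\<lambda>j z. ?T * \<bar>mol (r j) w z - w z\<bar>"])
      show "\<bar>gs j z - g z\<bar> \<le> ?T * \<bar>mol (r j) w z - w z\<bar>" for j z
      proof -
        have "\<bar>gs j z - g z\<bar> = ?T * \<bar>\<bar>mol (r j) w z\<bar> - \<bar>w z\<bar>\<bar>"
          using T0 by (simp add: gs_def g_def abs_mult flip: right_diff_distrib)
        also have "\<dots> \<le> ?T * \<bar>mol (r j) w z - w z\<bar>" using T0 by (intro mult_left_mono) auto
        finally show ?thesis .
      qed
      show "(\<lambda>j. LINT z|lebesgue. ?T * \<bar>mol (r j) w z - w z\<bar>) \<longlonglongrightarrow> 0"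
        using tendsto_mult_right_zero[OF mol_tendsto_L1[OF w(1) r], of ?T] by simp
      show "integrable lebesgue (\<lambda>z. ?T * \<bar>mol (r j) w z - w z\<bar>)" for j
        by (intro integrable_mult_right integrable_abs Bochner_Integration.integrable_diff mol_L1_contraction(1) r w)
    qed (intro Bochner_Integration.integrable_diff gi)
  qed (use gi AEt fm in auto)
  show ?i1 "PROP ?i2" "PROP ?i3" ?i4 using t1 t2 t3 t4i by auto
  show ?le
  proof (rule LIMSEQ_le[OF tendsto_add[OF t1(2) tendsto_mult_left[OF tendsto_sum[OF t2(2)]]]
        tendsto_diff[OF tendsto_sum[OF t3(2)] tendsto_mult_left[OF t4]]], intro exI allI impI)
    fix j :: nat
    have "0 < h (s j)" by (rule h)
    from mollified_energy_inequality[OF this w G F H \<phi> d e grad[where j = "s j"] ineq[where j = "s j"]]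
    show "(LINT z|lebesgue. mol (r j) G z * ((mol (r j) w z + d) powr (- e) * \<phi> z))
      + e * (\<Sum>i\<in>UNIV. LINT z|lebesgue. mol (r j) (F i) z * mol (r j) (H i) z * ((mol (r j) w z + d) powr (- e - 1) * \<phi> z))
    \<le> (\<Sum>i\<in>UNIV. LINT z|lebesgue. mol (r j) (F i) z * ((mol (r j) w z + d) powr (- e) * \<phi>' (dir i) z))
      - 1 / (1 - e) * (LINT z|lebesgue. (mol (r j) w z + d) powr (1 - e) * \<phi>' \<tau> z)"
      by (simp add: r_def mult.assoc)
  qed
qed

section \<open>The energy estimate for pairs of solutions\<close>

lemma open_half_space: "open (half_space :: (real \<times> (real ^ 'n)) set)"
  by (simp add: half_space_def open_Times)

lemma integrable_localized_bound:
  fixes f :: "'a::euclidean_space \<Rightarrow> real"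
  assumes S: "open S" and K: "compact K" "K \<subseteq> S" and f: "f \<in> borel_measurable (lebesgue_on S)"
    and g: "integrable lebesgue (\<lambda>z. indicator K z * g z)" and le: "\<And>z. \<bar>f z\<bar> \<le> g z"
  shows "integrable lebesgue (\<lambda>z. indicator K z * f z)"
proof (rule Bochner_Integration.integrable_bound[OF g])
  have SL: "S \<inter> space lebesgue \<in> sets lebesgue" using S by auto
  have fS: "(\<lambda>z. indicator S z *\<^sub>R f z) \<in> borel_measurable lebesgue"
    using f borel_measurable_restrict_space_iff[OF SL, of f] by simp
  have Kb: "K \<in> sets lebesgue" using K(1) by (simp add: compact_imp_closed lborelD)
  have "(\<lambda>z. indicator K z * (indicator S z *\<^sub>R f z)) \<in> borel_measurable lebesgue"
    using fS Kb by measurable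
  also have "(\<lambda>z. indicator K z * (indicator S z *\<^sub>R f z)) = (\<lambda>z. indicator K z * f z)"
    using K(2) by (auto simp: indicator_def fun_eq_iff)
  finally show "(\<lambda>z. indicator K z * f z) \<in> borel_measurable lebesgue" .
  show "AE z in lebesgue. norm (indicator K z * f z) \<le> norm (indicator K z * g z)"
    using order_trans[OF le abs_ge_self] by (intro AE_I2) (auto simp: indicator_def)
qed

lemma L_loc_measurable: "L_loc r S f \<Longrightarrow> f \<in> borel_measurable (lebesgue_on S)"
  by (simp add: L_loc_def)

lemma L_loc_powr_integrable:
  assumes "L_loc r S f" "compact K" "K \<subseteq> S"
  shows "integrable lebesgue (\<lambda>z. indicator K z * \<bar>f z\<bar> powr r)"
  using assms unfolding L_loc_def set_integrable_def by simp

lemma L_loc_1_integrable: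
  assumes "L_loc 1 S f" "open S" "compact K" "K \<subseteq> S"
  shows "integrable lebesgue (\<lambda>z. indicator K z * f z)"
proof (rule integrable_localized_bound[OF assms(2-4) L_loc_measurable[OF assms(1)]])
  show "integrable lebesgue (\<lambda>z. indicator K z * \<bar>f z\<bar>)"
    using L_loc_powr_integrable[OF assms(1,3,4)] by simp
qed simp

text \<open>
  Near points at which the mollifier fits into \<open>K\<close>, mollification commutes with weak derivatives,
  although both functions are cut off to \<open>K\<close>.
\<close>

lemma weak_derivative_mol:
  fixes u g :: "'a::euclidean_space \<Rightarrow> real"
  assumes D: "weak_derivative_on S b u g" and r: "0 < r" and z: "cball z r \<subseteq> K" and K: "K \<subseteq> S"
  shows "mol_deriv r b (\<lambda>y. indicator K y * u y) z = mol r (\<lambda>y. indicator K y * g y) z"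
proof -
  have tf: "test_function S (\<lambda>y. mker r (z - y))"
    using z K by (intro mker_translate_test_function r) auto
  have "(LINT y:S|lebesgue. u y * frechet_derivative (\<lambda>y. mker r (z - y)) (at y) b)
      = - (LINT y:S|lebesgue. g y * mker r (z - y))"
    using D tf unfolding weak_derivative_on_def by blast
  moreover have "(LINT y:S|lebesgue. u y * frechet_derivative (\<lambda>y. mker r (z - y)) (at y) b)
      = - mol_deriv r b (\<lambda>y. indicator K y * u y) z"
    unfolding set_lebesgue_integral_def mol_deriv_def frechet_derivative_mker_translate
      Bochner_Integration.integral_minus[symmetric]
  proof (rule Bochner_Integration.integral_cong[OF refl])
    fix y
    show "indicator S y *\<^sub>R (u y * - mker_deriv r b (z - y)) = - (indicator K y * u y * mker_deriv r b (z - y))"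
      using z K mker_deriv_eq_0[OF r, of "z - y" b]
      by (cases "y \<in> cball z r") (auto simp: indicator_def dist_norm)
  qed
  moreover have "(LINT y:S|lebesgue. g y * mker r (z - y)) = mol r (\<lambda>y. indicator K y * g y) z"
    unfolding set_lebesgue_integral_def mol_def
  proof (rule Bochner_Integration.integral_cong[OF refl])
    fix y
    show "indicator S y *\<^sub>R (g y * mker r (z - y)) = indicator K y * g y * mker r (z - y)"
      using z K mker_eq_0[OF r, of "z - y"]
      by (cases "y \<in> cball z r") (auto simp: indicator_def dist_norm)
  qed
  ultimately show ?thesis by simp
qed

text \<open>
  The weak inequality, tested with the mollifier centred at \<open>z\<close>, as a pointwise inequality at \<open>z\<close>.
  The derivatives in the flux term change sign because the mollifier is reflected.
\<close>

lemma weak_inequality_mol: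
  fixes a c :: "real \<times> (real ^ 'n) \<Rightarrow> real" and A :: "'n \<Rightarrow> real \<times> (real ^ 'n) \<Rightarrow> real"
  assumes W: "\<And>\<phi>. test_function half_space \<phi> \<Longrightarrow> (\<And>z. 0 \<le> \<phi> z) \<Longrightarrow>
       0 \<le> (LINT z:half_space|lebesgue. a z * \<phi> z
            + (\<Sum>i\<in>UNIV. A i z * frechet_derivative \<phi> (at z) (space_dir i)) - c z * \<phi> z)"
    and r: "0 < r" and z: "cball z r \<subseteq> K" and K: "K \<subseteq> half_space"
    and int: "integrable lebesgue (\<lambda>y. indicator K y * a y)" "\<And>i. integrable lebesgue (\<lambda>y. indicator K y * A i y)"
      "integrable lebesgue (\<lambda>y. indicator K y * c y)"
  shows "0 \<le> mol r (\<lambda>y. indicator K y * a y) z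
      - (\<Sum>i\<in>UNIV. mol_deriv r (space_dir i) (\<lambda>y. indicator K y * A i y) z) - mol r (\<lambda>y. indicator K y * c y) z"
proof -
  have tf: "test_function half_space (\<lambda>y. mker r (z - y))"
    using z K by (intro mker_translate_test_function r) auto
  have "0 \<le> (LINT y:half_space|lebesgue. a y * mker r (z - y)
            + (\<Sum>i\<in>UNIV. A i y * frechet_derivative (\<lambda>y. mker r (z - y)) (at y) (space_dir i)) - c y * mker r (z - y))"
    by (rule W[OF tf]) (rule mker_nonneg[OF r])
  also have "\<dots> = (LINT y|lebesgue. indicator K y * a y * mker r (z - y)
      - (\<Sum>i\<in>UNIV. indicator K y * A i y * mker_deriv r (space_dir i) (z - y)) - indicator K y * c y * mker r (z - y))"
    unfolding set_lebesgue_integral_def frechet_derivative_mker_translate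
  proof (rule Bochner_Integration.integral_cong[OF refl])
    fix y
    show "indicator half_space y *\<^sub>R (a y * mker r (z - y) + (\<Sum>i\<in>UNIV. A i y * - mker_deriv r (space_dir i) (z - y)) - c y * mker r (z - y))
       = indicator K y * a y * mker r (z - y)
      - (\<Sum>i\<in>UNIV. indicator K y * A i y * mker_deriv r (space_dir i) (z - y)) - indicator K y * c y * mker r (z - y)"
      using z K mker_eq_0[OF r, of "z - y"] mker_deriv_eq_0[OF r, of "z - y"]
      by (cases "y \<in> cball z r") (auto simp: indicator_def dist_norm sum_negf)
  qed
  also have "\<dots> = mol r (\<lambda>y. indicator K y * a y) z
      - (\<Sum>i\<in>UNIV. mol_deriv r (space_dir i) (\<lambda>y. indicator K y * A i y) z) - mol r (\<lambda>y. indicator K y * c y) z"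
    unfolding mol_def mol_deriv_def
    using mol_integrand_integrable[OF r int(1)] mol_integrand_integrable[OF r int(3)] mol_deriv_integrand_integrable[OF r int(2)]
    by (simp add: Bochner_Integration.integral_diff Bochner_Integration.integral_sum)
  finally show ?thesis .
qed

lemma powr_sum_le:
  fixes x y :: real
  assumes "0 \<le> x" "0 \<le> y" "0 \<le> s"
  shows "(x + y) powr s \<le> 2 powr s * (x powr s + y powr s)"
proof -
  have "(x + y) powr s \<le> (2 * max x y) powr s" using assms by (intro powr_mono2) auto
  also have "\<dots> = 2 powr s * max x y powr s" using assms by (simp add: powr_mult)
  also have "\<dots> \<le> 2 powr s * (x powr s + y powr s)"
    by (intro mult_left_mono) (auto simp: max_def)
  finally show ?thesis .
qed

lemma compact_thickening:
  fixes K :: "'a::euclidean_space set"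
  assumes K: "compact K" "K \<subseteq> S" and S: "open S"
  obtains \<rho> K' where "0 < \<rho>" "compact K'" "K' \<subseteq> S" "K \<subseteq> K'" "\<And>z r. z \<in> K \<Longrightarrow> r \<le> \<rho> \<Longrightarrow> cball z r \<subseteq> K'"
proof -
  obtain \<rho> where \<rho>: "0 < \<rho>" "(\<Union>x\<in>K. cball x \<rho>) \<subseteq> S"
    using compact_subset_open_imp_cball_epsilon_subset[OF K(1) S K(2)] by blast
  have eq: "(\<Union>x\<in>K. cball x \<rho>) = {x + y |x y. x \<in> K \<and> y \<in> cball 0 \<rho>}"
  proof safe
    fix x z assume "x \<in> K" "z \<in> cball x \<rho>"
    then show "\<exists>x' y. z = x' + y \<and> x' \<in> K \<and> y \<in> cball 0 \<rho>"
      by (intro exI[of _ x] exI[of _ "z - x"]) (auto simp: dist_norm norm_minus_commute)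
  next
    fix x y :: 'a assume "x \<in> K" "y \<in> cball 0 \<rho>"
    then show "x + y \<in> (\<Union>x\<in>K. cball x \<rho>)" by (intro UN_I[of x]) (auto simp: dist_norm)
  qed
  have "compact (\<Union>x\<in>K. cball x \<rho>)" unfolding eq by (intro compact_sums K compact_cball)
  then show thesis
    by (rule that[OF \<rho>(1)]) (use \<rho> in \<open>auto intro: subset_cball\<close>)
qed

lemma borel_measurable_vec_components:
  fixes f :: "'a \<Rightarrow> real ^ 'n"
  assumes "\<And>i. (\<lambda>z. f z $ i) \<in> borel_measurable M"
  shows "f \<in> borel_measurable M"
proof (subst borel_measurable_euclidean_space, safe)
  fix b :: "real ^ 'n" assume "b \<in> Basis"
  then obtain i where "b = axis i 1" by (auto simp: Basis_vec_def)
  then show "(\<lambda>z. f z \<bullet> b) \<in> borel_measurable M" using assms[of i] by (simp add: inner_axis)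
qed

lemma powr_le_1_plus_powr:
  fixes x :: real
  assumes "0 \<le> x" "0 \<le> a" "a \<le> b" shows "x powr a \<le> 1 + x powr b"
proof (cases "x \<le> 1")
  case True
  then have "x powr a \<le> 1 powr a" using assms by (intro powr_mono2) auto
  then show ?thesis by (simp add: add_increasing2)
next
  case False
  then have "x powr a \<le> x powr b" using assms by (intro powr_mono) auto
  then show ?thesis by simp
qed

text \<open>
  The energy inequality for \<open>w\<close> and all admissible cutoffs, together with the integrability of the
  integrands. Here \<open>G\<close> stands for the reaction term, \<open>F\<close> for the flux and \<open>X\<close> for the product of the
  flux with the spatial gradient of \<open>w\<close>, so that the gradient itself need not be mentioned.
\<close>

definition energy_estimate ::
    "(real \<times> (real ^ 'n) \<Rightarrow> real) \<Rightarrow> (real \<times> (real ^ 'n) \<Rightarrow> real) \<Rightarrow> (real \<times> (real ^ 'n) \<Rightarrow> real) \<Rightarrow>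
     (real \<times> (real ^ 'n) \<Rightarrow> real ^ 'n) \<Rightarrow> bool" where
  "energy_estimate w G X F \<longleftrightarrow> (\<forall>K \<phi> \<phi>' d e.
      K \<subseteq> half_space \<longrightarrow> C1_cutoff K \<phi> \<phi>' \<longrightarrow> 0 < d \<longrightarrow> 0 \<le> e \<longrightarrow> e < 1 \<longrightarrow>
      integrable lebesgue (\<lambda>z. G z * ((w z + d) powr (- e) * \<phi> z)) \<and>
      integrable lebesgue (\<lambda>z. X z * ((w z + d) powr (- e - 1) * \<phi> z)) \<and>
      integrable lebesgue (\<lambda>z. (\<Sum>i\<in>UNIV. F z $ i * \<phi>' (space_dir i) z) * (w z + d) powr (- e)) \<and>
      integrable lebesgue (\<lambda>z. (w z + d) powr (1 - e) * \<phi>' time_dir z) \<and>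
      (LINT z|lebesgue. G z * ((w z + d) powr (- e) * \<phi> z))
        + e * (LINT z|lebesgue. X z * ((w z + d) powr (- e - 1) * \<phi> z))
      \<le> (LINT z|lebesgue. (\<Sum>i\<in>UNIV. F z $ i * \<phi>' (space_dir i) z) * (w z + d) powr (- e))
        - 1 / (1 - e) * (LINT z|lebesgue. (w z + d) powr (1 - e) * \<phi>' time_dir z))"

text \<open>
  Since \<open>-v\<close> is a supersolution as well, the two weak inequalities are added; the flux and the
  gradient of the difference are thus sums of those of \<open>u\<close> and \<open>-v\<close>.
\<close>

lemma solution_pair_energy:
  fixes u v :: "real \<times> (real ^ 'n) \<Rightarrow> real"
  assumes p: "1 < p" "p \<le> 2" and q: "1 < q"
    and u: "entire_weak_supersolution p q u" and v: "entire_weak_subsolution p q v"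
    and uv: "AE z in lebesgue_on half_space. v z \<le> u z"
  obtains G X :: "real \<times> (real ^ 'n) \<Rightarrow> real" and F :: "real \<times> (real ^ 'n) \<Rightarrow> real ^ 'n"
  where "AE z in lebesgue. z \<in> half_space \<longrightarrow> 0 \<le> u z - v z \<and> 2 powr (- q) * (u z - v z) powr q \<le> G z
      \<and> 2 powr (1 - p / (p - 1)) * norm (F z) powr (p / (p - 1)) \<le> X z"
    and "\<And>K. compact K \<Longrightarrow> K \<subseteq> half_space \<Longrightarrow> integrable lebesgue (\<lambda>z. indicator K z * \<bar>u z - v z\<bar> powr q)"
    and "energy_estimate (\<lambda>z. u z - v z) G X F"
proof -
  let ?S = "half_space :: (real \<times> (real ^ 'n)) set"
  let ?v = "\<lambda>z. - v z"
  obtain ut Du where u1: "L_loc q ?S u" "weak_derivative_on ?S time_dir u ut" "weak_gradient_x u Du"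
      "L_loc 1 ?S (\<lambda>z. norm (Du z) powr p)"
    and u2: "\<And>\<phi>. test_function ?S \<phi> \<Longrightarrow> (\<And>z. 0 \<le> \<phi> z) \<Longrightarrow>
       0 \<le> (LINT z:?S|lebesgue. ut z * \<phi> z
          + (\<Sum>i\<in>UNIV. norm (Du z) powr (p - 2) * Du z $ i * frechet_derivative \<phi> (at z) (space_dir i))
          - \<bar>u z\<bar> powr (q - 1) * u z * \<phi> z)"
    using u unfolding entire_weak_supersolution_def by blast
  obtain vt Dv where v1: "L_loc q ?S ?v" "weak_derivative_on ?S time_dir ?v vt" "weak_gradient_x ?v Dv"
      "L_loc 1 ?S (\<lambda>z. norm (Dv z) powr p)"
    and v2: "\<And>\<phi>. test_function ?S \<phi> \<Longrightarrow> (\<And>z. 0 \<le> \<phi> z) \<Longrightarrow>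
       0 \<le> (LINT z:?S|lebesgue. vt z * \<phi> z
          + (\<Sum>i\<in>UNIV. norm (Dv z) powr (p - 2) * Dv z $ i * frechet_derivative \<phi> (at z) (space_dir i))
          - \<bar>- v z\<bar> powr (q - 1) * - v z * \<phi> z)"
    using v unfolding entire_weak_subsolution_def entire_weak_supersolution_def by blast
  define w where "w = (\<lambda>z. u z - v z)"
  define gu where "gu = (\<lambda>z. \<bar>u z\<bar> powr (q - 1) * u z)"
  define gv where "gv = (\<lambda>z. \<bar>- v z\<bar> powr (q - 1) * - v z)"
  define G where "G = (\<lambda>z. gu z + gv z)"
  define Fu where "Fu = (\<lambda>z. plap_flux p (Du z))"
  define Fv where "Fv = (\<lambda>z. plap_flux p (Dv z))"
  define F where "F = (\<lambda>z. Fu z + Fv z)"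
  define H where "H = (\<lambda>z. Du z + Dv z)"
  define X where "X = (\<lambda>z. F z \<bullet> H z)"
  have Fu_i: "Fu z $ i = norm (Du z) powr (p - 2) * Du z $ i" and Fv_i: "Fv z $ i = norm (Dv z) powr (p - 2) * Dv z $ i" for z i
    by (simp_all add: Fu_def Fv_def plap_flux_def)
  have Xsum: "X z = (\<Sum>i\<in>UNIV. F z $ i * H z $ i)" for z
    by (simp add: X_def inner_vec_def)
  have S: "open ?S" by (rule open_half_space)
  have Sl: "?S \<in> sets lebesgue" using S by auto
  let ?M = "lebesgue_on ?S"
  have um: "u \<in> borel_measurable ?M" "?v \<in> borel_measurable ?M" using u1(1) v1(1) by (auto dest: L_loc_measurable)
  have Dui: "\<And>i. L_loc 1 ?S (\<lambda>z. Du z $ i)" and Dvi: "\<And>i. L_loc 1 ?S (\<lambda>z. Dv z $ i)"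
    and uL: "L_loc 1 ?S u" and vL: "L_loc 1 ?S ?v" and utL: "L_loc 1 ?S ut" and vtL: "L_loc 1 ?S vt"
    using u1 v1 unfolding weak_gradient_x_def weak_derivative_on_def by blast+
  have Dum: "Du \<in> borel_measurable ?M" and Dvm: "Dv \<in> borel_measurable ?M"
    using Dui Dvi by (auto intro!: borel_measurable_vec_components dest: L_loc_measurable)
  have Fum: "(\<lambda>z. Fu z $ i) \<in> borel_measurable ?M" and Fvm: "(\<lambda>z. Fv z $ i) \<in> borel_measurable ?M" for i
    unfolding Fu_i Fv_i using Dum Dvm L_loc_measurable[OF Dui[of i]] L_loc_measurable[OF Dvi[of i]] by measurable
  have gm: "gu \<in> borel_measurable ?M" "gv \<in> borel_measurable ?M"
    unfolding gu_def gv_def using um by measurable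
  have nF: "norm (Fu z) = norm (Du z) powr (p - 1)" "norm (Fv z) = norm (Dv z) powr (p - 1)" for z
    unfolding Fu_def Fv_def by (rule norm_plap_flux[OF p(1)])+
  have p': "0 < p / (p - 1)" using p by simp
  have loc: "integrable lebesgue (\<lambda>z. indicator K z * gu z)" "integrable lebesgue (\<lambda>z. indicator K z * gv z)"
      "\<And>i. integrable lebesgue (\<lambda>z. indicator K z * Fu z $ i)" "\<And>i. integrable lebesgue (\<lambda>z. indicator K z * Fv z $ i)"
      "\<And>i. integrable lebesgue (\<lambda>z. indicator K z * \<bar>F z $ i\<bar> powr (p / (p - 1)))"
      "\<And>i. integrable lebesgue (\<lambda>z. indicator K z * \<bar>H z $ i\<bar> powr p)"
      "integrable lebesgue (\<lambda>z. indicator K z * \<bar>w z\<bar> powr q)"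
    if K: "compact K" "K \<subseteq> ?S" for K
  proof -
    note lb = integrable_localized_bound[OF S K]
    have P: "integrable lebesgue (\<lambda>z. indicator K z * norm (Du z) powr p)"
        "integrable lebesgue (\<lambda>z. indicator K z * norm (Dv z) powr p)"
      using L_loc_1_integrable[OF u1(4) S K] L_loc_1_integrable[OF v1(4) S K] by auto
    have Q: "integrable lebesgue (\<lambda>z. indicator K z * \<bar>u z\<bar> powr q)"
        "integrable lebesgue (\<lambda>z. indicator K z * \<bar>v z\<bar> powr q)"
      using L_loc_powr_integrable[OF u1(1) K] L_loc_powr_integrable[OF v1(1) K] by auto
    have one: "integrable lebesgue (indicator K :: _ \<Rightarrow> real)"
      using emeasure_compact_finite[OF K(1)] K(1)
      by (intro integrable_real_indicator) (auto simp: compact_imp_closed less_top[symmetric])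
    have P1: "integrable lebesgue (\<lambda>z. indicator K z * (1 + norm (Du z) powr p))"
        "integrable lebesgue (\<lambda>z. indicator K z * (1 + norm (Dv z) powr p))"
      using Bochner_Integration.integrable_add[OF one P(1)] Bochner_Integration.integrable_add[OF one P(2)]
      by (simp_all add: algebra_simps)
    have sumint: "integrable lebesgue (\<lambda>z. indicator K z * (c * (f z + g z)))"
      if "integrable lebesgue (\<lambda>z. indicator K z * f z)" "integrable lebesgue (\<lambda>z. indicator K z * g z)"
      for c :: real and f g :: "real \<times> (real ^ 'n) \<Rightarrow> real"
    proof -
      have "integrable lebesgue (\<lambda>z. c * (indicator K z * f z + indicator K z * g z))"
        by (intro integrable_mult_right Bochner_Integration.integrable_add that)
      then show ?thesis by (simp add: algebra_simps)
    qed
    show "integrable lebesgue (\<lambda>z. indicator K z * gu z)"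
    proof (rule lb[OF gm(1) Q(1)])
      show "\<bar>gu z\<bar> \<le> \<bar>u z\<bar> powr q" for z
        by (cases "u z = 0") (auto simp: gu_def abs_mult powr_diff)
    qed
    show "integrable lebesgue (\<lambda>z. indicator K z * gv z)"
    proof (rule lb[OF gm(2) Q(2)])
      show "\<bar>gv z\<bar> \<le> \<bar>v z\<bar> powr q" for z
        by (cases "v z = 0") (auto simp: gv_def abs_mult powr_diff)
    qed
    have Fle: "\<bar>Fu z $ i\<bar> \<le> 1 + norm (Du z) powr p" "\<bar>Fv z $ i\<bar> \<le> 1 + norm (Dv z) powr p" for z i
      using component_le_norm_cart[of "Fu z" i] component_le_norm_cart[of "Fv z" i] p
        powr_le_1_plus_powr[of "norm (Du z)" "p - 1" p] powr_le_1_plus_powr[of "norm (Dv z)" "p - 1" p]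
      by (auto simp: nF)
    show "integrable lebesgue (\<lambda>z. indicator K z * Fu z $ i)" for i
      by (rule lb[OF Fum P1(1) Fle(1)])
    show "integrable lebesgue (\<lambda>z. indicator K z * Fv z $ i)" for i
      by (rule lb[OF Fvm P1(2) Fle(2)])
    show "integrable lebesgue (\<lambda>z. indicator K z * \<bar>F z $ i\<bar> powr (p / (p - 1)))" for i
    proof (rule lb[OF _ sumint[OF P, of "2 powr (p / (p - 1))"]])
      show "(\<lambda>z. \<bar>F z $ i\<bar> powr (p / (p - 1))) \<in> borel_measurable ?M"
        unfolding F_def vector_add_component using Fum[of i] Fvm[of i] by measurable
      fix z
      have "\<bar>F z $ i\<bar> \<le> norm (Du z) powr (p - 1) + norm (Dv z) powr (p - 1)"
        using component_le_norm_cart[of "Fu z" i] component_le_norm_cart[of "Fv z" i]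
        by (simp add: F_def nF)
      then have "\<bar>F z $ i\<bar> powr (p / (p - 1)) \<le> (norm (Du z) powr (p - 1) + norm (Dv z) powr (p - 1)) powr (p / (p - 1))"
        using p' by (intro powr_mono2) auto
      also have "\<dots> \<le> 2 powr (p / (p - 1)) * ((norm (Du z) powr (p - 1)) powr (p / (p - 1)) + (norm (Dv z) powr (p - 1)) powr (p / (p - 1)))"
        using p' by (intro powr_sum_le) auto
      also have "\<dots> = 2 powr (p / (p - 1)) * (norm (Du z) powr p + norm (Dv z) powr p)"
        using p by (simp add: powr_powr)
      finally show "\<bar>\<bar>F z $ i\<bar> powr (p / (p - 1))\<bar> \<le> 2 powr (p / (p - 1)) * (norm (Du z) powr p + norm (Dv z) powr p)"
        by simp
    qed
    show "integrable lebesgue (\<lambda>z. indicator K z * \<bar>H z $ i\<bar> powr p)" for i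
    proof (rule lb[OF _ sumint[OF P, of "2 powr p"]])
      show "(\<lambda>z. \<bar>H z $ i\<bar> powr p) \<in> borel_measurable ?M"
        unfolding H_def vector_add_component
        using L_loc_measurable[OF Dui[of i]] L_loc_measurable[OF Dvi[of i]] by measurable
      fix z
      have "\<bar>H z $ i\<bar> \<le> norm (Du z) + norm (Dv z)"
        using component_le_norm_cart[of "Du z" i] component_le_norm_cart[of "Dv z" i] by (simp add: H_def)
      then have "\<bar>H z $ i\<bar> powr p \<le> (norm (Du z) + norm (Dv z)) powr p"
        using p by (intro powr_mono2) auto
      also have "\<dots> \<le> 2 powr p * (norm (Du z) powr p + norm (Dv z) powr p)"
        using p by (intro powr_sum_le) auto
      finally show "\<bar>\<bar>H z $ i\<bar> powr p\<bar> \<le> 2 powr p * (norm (Du z) powr p + norm (Dv z) powr p)" by simp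
    qed
    show "integrable lebesgue (\<lambda>z. indicator K z * \<bar>w z\<bar> powr q)"
    proof (rule lb[OF _ sumint[OF Q, of "2 powr q"]])
      show "(\<lambda>z. \<bar>w z\<bar> powr q) \<in> borel_measurable ?M"
        unfolding w_def diff_conv_add_uminus using um by measurable
      fix z
      have "\<bar>w z\<bar> powr q \<le> (\<bar>u z\<bar> + \<bar>v z\<bar>) powr q" using q by (intro powr_mono2) (auto simp: w_def)
      also have "\<dots> \<le> 2 powr q * (\<bar>u z\<bar> powr q + \<bar>v z\<bar> powr q)" using q by (intro powr_sum_le) auto
      finally show "\<bar>\<bar>w z\<bar> powr q\<bar> \<le> 2 powr q * (\<bar>u z\<bar> powr q + \<bar>v z\<bar> powr q)" by simp
    qed
  qed
  have AEw: "AE z in lebesgue. z \<in> ?S \<longrightarrow> v z \<le> u z"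
    using uv Sl by (simp add: AE_restrict_space_iff)
  show thesis
  proof (rule that[of G F X])
    show "AE z in lebesgue. z \<in> ?S \<longrightarrow> 0 \<le> u z - v z \<and> 2 powr (- q) * (u z - v z) powr q \<le> G z
      \<and> 2 powr (1 - p / (p - 1)) * norm (F z) powr (p / (p - 1)) \<le> X z"
      using AEw
    proof eventually_elim
      case (elim z)
      have "plap_flux p (Du z) - plap_flux p (- Dv z) = F z"
        by (simp add: F_def Fu_def Fv_def plap_flux_def)
      then have "2 powr (1 - p / (p - 1)) * norm (F z) powr (p / (p - 1)) \<le> X z"
        using plap_flux_monotone[OF p, of "Du z" "- Dv z"] by (simp add: X_def H_def)
      then show ?case
        using elim reaction_lower_bound[OF q, of "v z" "u z"] by (auto simp: G_def gu_def gv_def)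
    qed
    show "integrable lebesgue (\<lambda>z. indicator K z * \<bar>u z - v z\<bar> powr q)" if "compact K" "K \<subseteq> ?S" for K
      using loc(7)[OF that] by (simp add: w_def)
    have "energy_estimate w G X F"
    proof (unfold energy_estimate_def, intro allI impI, goal_cases)
      case (1 K \<phi> \<phi>' d e)
      then have KS: "K \<subseteq> ?S" and \<phi>: "C1_cutoff K \<phi> \<phi>'" and d: "0 < d" and e: "0 \<le> e" "e < 1" by auto
    have K: "compact K" and \<phi>0: "\<And>z. z \<notin> K \<Longrightarrow> \<phi> z = 0" "\<And>z b. z \<notin> K \<Longrightarrow> \<phi>' b z = 0"
      using \<phi> by (auto simp: C1_cutoff_def)
    \<comment> \<open>All functions are cut off to a compact neighbourhood \<open>L\<close> of \<open>K\<close>, which contains the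
      supports of all mollifiers centred in \<open>K\<close>.\<close>
    obtain \<rho> L where L: "0 < \<rho>" "compact L" "L \<subseteq> ?S" "K \<subseteq> L" "\<And>z r. z \<in> K \<Longrightarrow> r \<le> \<rho> \<Longrightarrow> cball z r \<subseteq> L"
      using compact_thickening[OF K KS S] by metis
    define r where "r = (\<lambda>j::nat. \<rho> / real (Suc j))"
    have r: "0 < r j" "r j \<le> \<rho>" for j
      using L(1) by (auto simp: r_def field_simps)
    have r0: "r \<longlonglongrightarrow> 0"
      unfolding r_def using LIMSEQ_Suc[OF lim_const_over_n[of \<rho>]] by simp
    have ball: "cball z (r j) \<subseteq> L" if "z \<in> K" for z j using L(5)[OF that r(2)] .
    let ?I = "indicator L :: _ \<Rightarrow> real"
    note lL = loc[OF L(2,3)]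
    have l1: "integrable lebesgue (\<lambda>z. ?I z * u z)" "integrable lebesgue (\<lambda>z. ?I z * - v z)"
      "integrable lebesgue (\<lambda>z. ?I z * ut z)" "integrable lebesgue (\<lambda>z. ?I z * vt z)"
      "\<And>i. integrable lebesgue (\<lambda>z. ?I z * Du z $ i)" "\<And>i. integrable lebesgue (\<lambda>z. ?I z * Dv z $ i)"
      by (rule L_loc_1_integrable[OF _ S L(2,3)], fact)+
    have spl: "(\<lambda>z. ?I z * w z) = (\<lambda>z. ?I z * u z + ?I z * - v z)"
      "(\<lambda>z. ?I z * G z) = (\<lambda>z. ?I z * gu z + ?I z * gv z)"
      "\<And>i. (\<lambda>z. ?I z * F z $ i) = (\<lambda>z. ?I z * Fu z $ i + ?I z * Fv z $ i)"
      "\<And>i. (\<lambda>z. ?I z * H z $ i) = (\<lambda>z. ?I z * Du z $ i + ?I z * Dv z $ i)"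
      by (simp_all add: w_def G_def F_def H_def algebra_simps fun_eq_iff)
    have wi: "integrable lebesgue (\<lambda>z. ?I z * w z)" unfolding spl by (intro Bochner_Integration.integrable_add l1)
    have Gi: "integrable lebesgue (\<lambda>z. ?I z * G z)" unfolding spl by (intro Bochner_Integration.integrable_add lL)
    have Fi: "integrable lebesgue (\<lambda>z. ?I z * F z $ i)" for i unfolding spl by (intro Bochner_Integration.integrable_add lL)
    have Hi: "integrable lebesgue (\<lambda>z. ?I z * H z $ i)" for i unfolding spl by (intro Bochner_Integration.integrable_add l1)
    have w0: "AE z in lebesgue. 0 \<le> ?I z * w z"
      using AEw by eventually_elim (use L(3) in \<open>auto simp: w_def indicator_def\<close>)
    have ip: "\<bar>?I z * x\<bar> powr a = ?I z * \<bar>x\<bar> powr a" for z x a by (auto simp: indicator_def)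
    have Fp: "integrable lebesgue (\<lambda>z. \<bar>?I z * F z $ i\<bar> powr (p / (p - 1)))" for i unfolding ip by (rule lL)
    have Hp: "integrable lebesgue (\<lambda>z. \<bar>?I z * H z $ i\<bar> powr p)" for i unfolding ip by (rule lL)
    have grad: "mol_deriv (r j) (space_dir i) (\<lambda>z. ?I z * w z) z = mol (r j) (\<lambda>z. ?I z * H z $ i) z" if z: "z \<in> K" for i j z
    proof -
      have "mol_deriv (r j) (space_dir i) (\<lambda>y. ?I y * u y) z = mol (r j) (\<lambda>y. ?I y * Du y $ i) z"
        "mol_deriv (r j) (space_dir i) (\<lambda>y. ?I y * - v y) z = mol (r j) (\<lambda>y. ?I y * Dv y $ i) z"
        using u1(3) v1(3) unfolding weak_gradient_x_def
        by (intro weak_derivative_mol[OF _ r(1) ball[OF z] L(3)]; blast)+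
      then show ?thesis unfolding spl by (simp only: mol_add mol_deriv_add r l1)
    qed
    have ineq: "0 \<le> mol_deriv (r j) time_dir (\<lambda>z. ?I z * w z) z
        - (\<Sum>i\<in>UNIV. mol_deriv (r j) (space_dir i) (\<lambda>z. ?I z * F z $ i) z) - mol (r j) (\<lambda>z. ?I z * G z) z"
      if z: "z \<in> K" for j z
    proof -
      have "mol_deriv (r j) time_dir (\<lambda>y. ?I y * u y) z = mol (r j) (\<lambda>y. ?I y * ut y) z"
        "mol_deriv (r j) time_dir (\<lambda>y. ?I y * - v y) z = mol (r j) (\<lambda>y. ?I y * vt y) z"
        by (intro weak_derivative_mol[OF _ r(1) ball[OF z] L(3)] u1 v1)+
      moreover have "0 \<le> mol (r j) (\<lambda>y. ?I y * ut y) z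
        - (\<Sum>i\<in>UNIV. mol_deriv (r j) (space_dir i) (\<lambda>y. ?I y * Fu y $ i) z) - mol (r j) (\<lambda>y. ?I y * gu y) z"
        by (rule weak_inequality_mol[OF _ r(1) ball[OF z] L(3) l1(3) lL(3) lL(1)])
           (unfold gu_def Fu_i, rule u2)
      moreover have "0 \<le> mol (r j) (\<lambda>y. ?I y * vt y) z
        - (\<Sum>i\<in>UNIV. mol_deriv (r j) (space_dir i) (\<lambda>y. ?I y * Fv y $ i) z) - mol (r j) (\<lambda>y. ?I y * gv y) z"
        by (rule weak_inequality_mol[OF _ r(1) ball[OF z] L(3) l1(4) lL(4) lL(2)])
           (unfold gv_def Fv_i, rule v2)
      ultimately show ?thesis
        unfolding spl by (simp only: mol_add mol_deriv_add r l1 lL sum.distrib)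
    qed
    note E = energy_inequality[where h = r and F = "\<lambda>i z. ?I z * F z $ i" and H = "\<lambda>i z. ?I z * H z $ i"
        and G = "\<lambda>z. ?I z * G z" and w = "\<lambda>z. ?I z * w z" and dir = space_dir and \<tau> = time_dir,
        OF r(1) r0 p(1) wi w0 Gi Fi Hi Fp Hp \<phi> d e grad ineq]
    have off: "?I z = 1 \<or> \<phi> z = 0 \<and> \<phi>' b z = 0" for z b
      using L(4) \<phi>0 by (cases "z \<in> K") (auto simp: indicator_def)
    have c1: "(?I z * G z) * ((?I z * w z + d) powr a * \<phi> z) = G z * ((w z + d) powr a * \<phi> z)"
      "(?I z * F z $ i) * (?I z * H z $ i) * ((?I z * w z + d) powr a * \<phi> z) = F z $ i * H z $ i * ((w z + d) powr a * \<phi> z)"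
      "(?I z * F z $ i) * ((?I z * w z + d) powr a * \<phi>' b z) = F z $ i * ((w z + d) powr a * \<phi>' b z)"
      "(?I z * w z + d) powr a * \<phi>' b z = (w z + d) powr a * \<phi>' b z" for z i b a
      using off[of z b] by auto
    note E' = E[unfolded c1(1-3), unfolded c1(4)]
    have X1: "X z * ((w z + d) powr (- e - 1) * \<phi> z) = (\<Sum>i\<in>UNIV. F z $ i * H z $ i * ((w z + d) powr (- e - 1) * \<phi> z))" for z
      by (simp add: Xsum sum_distrib_right)
    have X2: "(\<Sum>i\<in>UNIV. F z $ i * \<phi>' (space_dir i) z) * (w z + d) powr (- e)
        = (\<Sum>i\<in>UNIV. F z $ i * ((w z + d) powr (- e) * \<phi>' (space_dir i) z))" for z
      unfolding sum_distrib_right by (rule sum.cong) (simp_all add: mult_ac)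
    show ?case
      unfolding X1 X2
      using E' by (simp add: Bochner_Integration.integral_sum Bochner_Integration.integrable_sum)
    qed
    then show "energy_estimate (\<lambda>z. u z - v z) G X F" by (simp only: w_def)
  qed
qed

section \<open>Cutoff functions\<close>

lemma positive_part_square_derivative:
  "((\<lambda>x::real. (max 0 x)\<^sup>2) has_real_derivative 2 * max 0 x) (at x)"
proof -
  consider "0 < x" | "x < 0" | "x = 0" by linarith
  then show ?thesis
  proof cases
    case 1
    have "((\<lambda>x::real. x\<^sup>2) has_real_derivative 2 * max 0 x) (at x)"
      using 1 by (auto intro!: derivative_eq_intros)
    then show ?thesis
      by (rule has_field_derivative_transform_within_open[where S = "{0<..}"]) (use 1 in auto)
  next
    case 2
    have "((\<lambda>x::real. 0) has_real_derivative 2 * max 0 x) (at x)" using 2 by simp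
    then show ?thesis
      by (rule has_field_derivative_transform_within_open[where S = "{..<0}"]) (use 2 in auto)
  next
    case 3
    have "((\<lambda>y::real. ((max 0 y)\<^sup>2 - (max 0 0)\<^sup>2) / (y - 0)) \<longlongrightarrow> 0) (at 0)"
    proof (rule Lim_null_comparison)
      show "\<forall>\<^sub>F y in at (0::real). norm (((max 0 y)\<^sup>2 - (max 0 0)\<^sup>2) / (y - 0)) \<le> \<bar>y\<bar>"
        by (intro always_eventually allI) (auto simp: max_def power2_eq_square)
      show "((\<lambda>y::real. \<bar>y\<bar>) \<longlongrightarrow> 0) (at 0)"
        using tendsto_rabs[OF tendsto_ident_at[of "0::real" UNIV]] by simp
    qed
    then show ?thesis using 3 by (simp add: has_field_derivative_iff)
  qed
qed

text \<open>
  A nonincreasing \<open>C\<^sup>1\<close> profile with values in \<open>[0, 1]\<close>, equal to 1 on \<open>s \<le> 1\<close> and to 0 on \<open>s \<ge> 2\<close>;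
  \<open>plateau'\<close> is its derivative.
\<close>

definition plateau :: "real \<Rightarrow> real" where
  "plateau s = (max 0 (1 - (max 0 (s - 1))\<^sup>2))\<^sup>2"

definition plateau' :: "real \<Rightarrow> real" where
  "plateau' s = 2 * max 0 (1 - (max 0 (s - 1))\<^sup>2) * (- (2 * max 0 (s - 1)))"

lemma plateau_derivative: "(plateau has_real_derivative plateau' s) (at s)"
proof -
  have "((\<lambda>s. 1 - (max 0 (s - 1))\<^sup>2) has_real_derivative - (2 * max 0 (s - 1))) (at s)"
    by (rule derivative_eq_intros DERIV_chain2[OF positive_part_square_derivative] refl)+ simp
  from DERIV_chain2[OF positive_part_square_derivative this]
  show ?thesis by (simp only: plateau_def[abs_def] plateau'_def)
qed

lemma continuous_plateau: "continuous_on A plateau" "continuous_on A plateau'"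
  unfolding plateau_def plateau'_def by (intro continuous_intros)+

lemma plateau_range: "0 \<le> plateau s" "plateau s \<le> 1"
proof -
  show "0 \<le> plateau s" by (simp add: plateau_def)
  have "(max 0 (1 - (max 0 (s - 1))\<^sup>2))\<^sup>2 \<le> 1\<^sup>2" by (intro power_mono) auto
  then show "plateau s \<le> 1" by (simp add: plateau_def)
qed

lemma plateau_eq: "s \<le> 1 \<Longrightarrow> plateau s = 1" "s \<le> 1 \<Longrightarrow> plateau' s = 0"
  by (simp_all add: plateau_def plateau'_def)

lemma plateau_eq_0:
  assumes "2 \<le> s" shows "plateau s = 0" "plateau' s = 0"
proof -
  have "1\<^sup>2 \<le> (max 0 (s - 1))\<^sup>2" using assms by (intro power_mono) auto
  then show "plateau s = 0" "plateau' s = 0" by (simp_all add: plateau_def plateau'_def)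
qed

lemma plateau'_range: "plateau' s \<le> 0" "\<bar>plateau' s\<bar> \<le> 4"
proof -
  show "plateau' s \<le> 0" unfolding plateau'_def by (intro mult_nonneg_nonpos) auto
  show "\<bar>plateau' s\<bar> \<le> 4"
  proof (cases "s \<le> 2")
    case True
    have "\<bar>plateau' s\<bar> = 2 * max 0 (1 - (max 0 (s - 1))\<^sup>2) * (2 * max 0 (s - 1))"
      by (simp add: plateau'_def abs_mult)
    also have "\<dots> \<le> 2 * 1 * (2 * 1)" using True by (intro mult_mono) auto
    finally show ?thesis by simp
  qed (simp add: plateau_eq_0)
qed

text \<open>
  The cutoff on the half-space: it vanishes for \<open>t \<le> 1/R\<close>, for \<open>t \<ge> 2T\<close> and for \<open>\<bar>x\<bar>\<^sup>2 \<ge> 2R\<^sup>2\<close>, and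
  equals 1 for \<open>2/R \<le> t \<le> T\<close>, \<open>\<bar>x\<bar> \<le> R\<close>. Its derivative in the direction \<open>b\<close> is \<open>cutoff_deriv R T b\<close>.
\<close>

definition cutoff :: "real \<Rightarrow> real \<Rightarrow> real \<times> (real ^ 'n) \<Rightarrow> real" where
  "cutoff R T z = (1 - plateau (R * fst z)) * plateau (fst z / T) * plateau ((norm (snd z))\<^sup>2 / R\<^sup>2)"

definition cutoff_deriv :: "real \<Rightarrow> real \<Rightarrow> real \<times> (real ^ 'n) \<Rightarrow> real \<times> (real ^ 'n) \<Rightarrow> real" where
  "cutoff_deriv R T b z =
     (- (plateau' (R * fst z) * (R * fst b))) * plateau (fst z / T) * plateau ((norm (snd z))\<^sup>2 / R\<^sup>2)
     + (1 - plateau (R * fst z)) * (plateau' (fst z / T) * (fst b / T)) * plateau ((norm (snd z))\<^sup>2 / R\<^sup>2)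
     + (1 - plateau (R * fst z)) * plateau (fst z / T) * (plateau' ((norm (snd z))\<^sup>2 / R\<^sup>2) * (2 * (snd z \<bullet> snd b) / R\<^sup>2))"

text \<open>
  A box in the open half-space outside of which the cutoff vanishes.
\<close>

definition cutoff_support :: "real \<Rightarrow> real \<Rightarrow> (real \<times> (real ^ 'n)) set" where
  "cutoff_support R T = cbox (1 / R, \<chi> i. - (2 * R)) (2 * T, \<chi> i. 2 * R)"

text \<open>
  The region that contains all points at which the cutoff decreases in time or varies in space. The
  layer near \<open>t = 0\<close> is left out on purpose: the cutoff increases in time there.
\<close>

definition far_region :: "real \<Rightarrow> real \<Rightarrow> (real \<times> (real ^ 'n)) set" where
  "far_region R T = {z. T < fst z \<or> R < norm (snd z)}"

lemma cutoff_range: "0 \<le> cutoff R T z" "cutoff R T z \<le> 1"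
proof -
  show "0 \<le> cutoff R T z" unfolding cutoff_def using plateau_range by (intro mult_nonneg_nonneg) auto
  have "cutoff R T z \<le> 1 * 1 * 1" unfolding cutoff_def using plateau_range
    by (intro mult_mono) (auto intro!: mult_nonneg_nonneg)
  then show "cutoff R T z \<le> 1" by simp
qed

lemma cutoff_line_derivative:
  "((\<lambda>s. cutoff R T (z + s *\<^sub>R b)) has_real_derivative cutoff_deriv R T b (z + s *\<^sub>R b)) (at s)"
proof -
  have 1: "((\<lambda>s. R * fst (z + s *\<^sub>R b)) has_real_derivative R * fst b) (at s)"
    by (auto intro!: derivative_eq_intros)
  have 2: "((\<lambda>s. fst (z + s *\<^sub>R b) / T) has_real_derivative fst b / T) (at s)"
    unfolding divide_inverse by (auto intro!: derivative_eq_intros)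
  have eq: "(norm (snd (z + s *\<^sub>R b)))\<^sup>2 / R\<^sup>2
      = (snd z \<bullet> snd z + 2 * s * (snd z \<bullet> snd b) + s\<^sup>2 * (snd b \<bullet> snd b)) * inverse (R\<^sup>2)" for s
    unfolding power2_norm_eq_inner divide_inverse
    by (simp add: inner_add_left inner_add_right inner_commute power2_eq_square algebra_simps)
  have 3: "((\<lambda>s. (norm (snd (z + s *\<^sub>R b)))\<^sup>2 / R\<^sup>2) has_real_derivative 2 * (snd (z + s *\<^sub>R b) \<bullet> snd b) / R\<^sup>2) (at s)"
    unfolding eq
    by (auto intro!: derivative_eq_intros simp: inner_add_left divide_inverse algebra_simps)
  note ds = DERIV_chain2[OF plateau_derivative 1] DERIV_chain2[OF plateau_derivative 2] DERIV_chain2[OF plateau_derivative 3]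
  show ?thesis
    unfolding cutoff_def cutoff_deriv_def
    by (rule derivative_eq_intros ds refl)+ (simp add: algebra_simps)
qed

lemma continuous_on_plateau_compose [continuous_intros]:
  assumes "continuous_on A f"
  shows "continuous_on A (\<lambda>z. plateau (f z))" "continuous_on A (\<lambda>z. plateau' (f z))"
  by (rule continuous_on_compose2[OF continuous_plateau(1)[of UNIV] assms subset_UNIV],
      rule continuous_on_compose2[OF continuous_plateau(2)[of UNIV] assms subset_UNIV])

lemma continuous_cutoff:
  fixes b :: "real \<times> (real ^ 'n)"
  shows "continuous_on UNIV (cutoff R T :: real \<times> (real ^ 'n) \<Rightarrow> real)" "continuous_on UNIV (cutoff_deriv R T b)"
proof -
  have "continuous_on UNIV (\<lambda>z::real \<times> (real ^ 'n). (1 - plateau (R * fst z)) * plateau (fst z * a) * plateau ((norm (snd z))\<^sup>2 * c))" for a c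
    by (intro continuous_intros)
  then show "continuous_on UNIV (cutoff R T :: real \<times> (real ^ 'n) \<Rightarrow> real)"
    unfolding cutoff_def divide_inverse .
  have "continuous_on UNIV (\<lambda>z::real \<times> (real ^ 'n).
     (- (plateau' (R * fst z) * (R * fst b))) * plateau (fst z * a) * plateau ((norm (snd z))\<^sup>2 * c)
     + (1 - plateau (R * fst z)) * (plateau' (fst z * a) * (fst b * a)) * plateau ((norm (snd z))\<^sup>2 * c)
     + (1 - plateau (R * fst z)) * plateau (fst z * a) * (plateau' ((norm (snd z))\<^sup>2 * c) * (2 * (snd z \<bullet> snd b) * c)))" for a c
    by (intro continuous_intros)
  then show "continuous_on UNIV (cutoff_deriv R T b)"
    unfolding cutoff_deriv_def divide_inverse .
qed

lemma cutoff_outside: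
  assumes R: "0 < R" and T: "0 < T" and z: "z \<notin> cutoff_support R T"
  shows "cutoff R T z = 0"
proof (rule ccontr)
  assume nz: "cutoff R T z \<noteq> 0"
  have a: "1 < R * fst z" using nz plateau_eq(1)[of "R * fst z"] by (cases "R * fst z \<le> 1") (auto simp: cutoff_def)
  have b: "fst z / T < 2" using nz plateau_eq_0(1)[of "fst z / T"] by (cases "2 \<le> fst z / T") (auto simp: cutoff_def)
  have c: "(norm (snd z))\<^sup>2 / R\<^sup>2 < 2"
    using nz plateau_eq_0(1)[of "(norm (snd z))\<^sup>2 / R\<^sup>2"]
    by (cases "2 \<le> (norm (snd z))\<^sup>2 / R\<^sup>2") (auto simp: cutoff_def)
  have "(norm (snd z))\<^sup>2 < 2 * R\<^sup>2" using c R by (simp add: divide_simps)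
  also have "\<dots> \<le> (2 * R)\<^sup>2" by (simp add: power2_eq_square)
  finally have "(norm (snd z))\<^sup>2 < (2 * R)\<^sup>2" .
  then have n: "norm (snd z) < 2 * R" by (rule power2_less_imp_less) (use R in simp)
  have "- (2 * R) \<le> snd z $ i \<and> snd z $ i \<le> 2 * R" for i using component_le_norm_cart[of "snd z" i] n by linarith
  then have "snd z \<in> cbox (\<chi> i. - (2 * R)) (\<chi> i. 2 * R)"
    by (simp add: mem_box_cart)
  moreover have "fst z \<in> cbox (1 / R) (2 * T)" using a b R T by (auto simp: field_simps)
  ultimately have "(fst z, snd z) \<in> cutoff_support R T"
    unfolding cutoff_support_def cbox_Pair_eq by blast
  then show False using z by simp
qed

lemma cutoff_support_subset: "0 < R \<Longrightarrow> cutoff_support R T \<subseteq> half_space"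
  unfolding cutoff_support_def half_space_def cbox_Pair_eq
  by (auto intro: less_le_trans[of 0 "1 / R"])

lemma cutoff_C1:
  assumes R: "0 < R" and T: "0 < T" and k: "2 \<le> k"
  shows "C1_cutoff (cutoff_support R T) (\<lambda>z. cutoff R T z ^ k)
           (\<lambda>b z. real k * cutoff R T z ^ (k - 1) * cutoff_deriv R T b z)"
  unfolding C1_cutoff_def
proof (intro conjI allI impI)
  show "compact (cutoff_support R T)" by (simp add: cutoff_support_def compact_cbox)
  show "continuous_on UNIV (\<lambda>z. cutoff R T z ^ k)" by (intro continuous_intros continuous_cutoff)
  show "continuous_on UNIV (\<lambda>z. real k * cutoff R T z ^ (k - 1) * cutoff_deriv R T b z)" for b
    by (intro continuous_intros continuous_cutoff)
  show "((\<lambda>s. cutoff R T (z + s *\<^sub>R b) ^ k) has_real_derivative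
      real k * cutoff R T (z + s *\<^sub>R b) ^ (k - 1) * cutoff_deriv R T b (z + s *\<^sub>R b)) (at s)" for b z s
    by (rule derivative_eq_intros cutoff_line_derivative refl)+ simp
  show "0 \<le> cutoff R T z ^ k" for z :: "real \<times> (real ^ 'n)" by (intro zero_le_power cutoff_range)
qed (use k cutoff_outside[OF R T] in auto)

text \<open>
  Only an upper bound for the negative of the time derivative: the contribution of the layer near
  \<open>t = 0\<close> to it is nonpositive, whatever its size.
\<close>

lemma cutoff_time_derivative:
  assumes R: "0 < R" and T: "0 < T"
  shows "- (real k * cutoff R T z ^ (k - 1) * cutoff_deriv R T time_dir z)
    \<le> 4 * real k / T * cutoff R T z ^ (k - 1) * indicator (far_region R T) z"
proof -
  have 1: "- cutoff_deriv R T time_dir z \<le> 4 / T * indicator (far_region R T) z"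
  proof -
    have "plateau' (R * fst z) * R \<le> 0"
      using plateau'_range(1) R by (intro mult_nonpos_nonneg) auto
    then have "0 \<le> (- (plateau' (R * fst z) * R)) * plateau (fst z / T) * plateau ((norm (snd z))\<^sup>2 / R\<^sup>2)"
      by (intro mult_nonneg_nonneg plateau_range) simp
    moreover have "- ((1 - plateau (R * fst z)) * (plateau' (fst z / T) * (1 / T)) * plateau ((norm (snd z))\<^sup>2 / R\<^sup>2))
        \<le> 4 / T * indicator (far_region R T) z"
    proof (cases "fst z \<le> T")
      case True
      then have "plateau' (fst z / T) = 0" using T by (simp add: plateau_eq)
      then show ?thesis using T by simp
    next
      case False
      have "(1 - plateau (R * fst z)) * ((- plateau' (fst z / T)) * (1 / T)) * plateau ((norm (snd z))\<^sup>2 / R\<^sup>2) \<le> 1 * (4 * (1 / T)) * 1"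
        using plateau_range plateau'_range[of "fst z / T"] T by (intro mult_mono) (auto simp: divide_nonpos_pos)
      then show ?thesis using False by (simp add: far_region_def)
    qed
    ultimately show ?thesis by (simp add: cutoff_deriv_def)
  qed
  have "(real k * cutoff R T z ^ (k - 1)) * (- cutoff_deriv R T time_dir z)
      \<le> (real k * cutoff R T z ^ (k - 1)) * (4 / T * indicator (far_region R T) z)"
    by (intro mult_left_mono 1 mult_nonneg_nonneg zero_le_power cutoff_range) auto
  then show ?thesis by (simp add: mult_ac)
qed

lemma cutoff_space_derivative:
  fixes F :: "real ^ 'n"
  assumes R: "0 < R" and T: "0 < T"
  shows "(\<Sum>i\<in>UNIV. F $ i * (real k * cutoff R T z ^ (k - 1) * cutoff_deriv R T (space_dir i) z))
    \<le> 16 * real k / R * cutoff R T z ^ (k - 1) * norm F * indicator (far_region R T) z"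
proof -
  define c where "c = (1 - plateau (R * fst z)) * plateau (fst z / T)"
  define P where "P = plateau' ((norm (snd z))\<^sup>2 / R\<^sup>2)"
  have c: "0 \<le> c" "c \<le> 1"
    unfolding c_def using plateau_range mult_mono[of "1 - plateau (R * fst z)" 1 "plateau (fst z / T)" 1] by auto
  have "cutoff_deriv R T (space_dir i) z = c * P * 2 / R\<^sup>2 * snd z $ i" for i
    by (simp add: cutoff_deriv_def inner_axis c_def P_def)
  then have "(\<Sum>i\<in>UNIV. F $ i * cutoff_deriv R T (space_dir i) z) = c * P * 2 / R\<^sup>2 * (F \<bullet> snd z)"
    by (simp add: inner_vec_def sum_distrib_left sum_divide_distrib mult_ac)
  also have "\<dots> \<le> 16 / R * norm F * indicator (far_region R T) z"
  proof (cases "P = 0")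
    case False
    then have "1 < (norm (snd z))\<^sup>2 / R\<^sup>2" "(norm (snd z))\<^sup>2 / R\<^sup>2 < 2"
      using plateau_eq(2)[of "(norm (snd z))\<^sup>2 / R\<^sup>2"] plateau_eq_0(2)[of "(norm (snd z))\<^sup>2 / R\<^sup>2"] by (auto simp: P_def not_le[symmetric])
    then have n: "R\<^sup>2 < (norm (snd z))\<^sup>2" "(norm (snd z))\<^sup>2 \<le> (2 * R)\<^sup>2"
      using R by (auto simp: divide_simps)
    have far: "z \<in> far_region R T"
      using power2_less_imp_less[OF n(1)] by (simp add: far_region_def)
    have n2: "norm (snd z) \<le> 2 * R" using power2_le_imp_le[OF n(2)] R by simp
    have "\<bar>c * P * 2 / R\<^sup>2 * (F \<bullet> snd z)\<bar> = (c * \<bar>P\<bar>) * (2 / R\<^sup>2) * \<bar>F \<bullet> snd z\<bar>"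
      using c by (simp add: abs_mult)
    also have "\<dots> \<le> (1 * 4) * (2 / R\<^sup>2) * (norm F * (2 * R))"
    proof (intro mult_mono)
      show "\<bar>F \<bullet> snd z\<bar> \<le> norm F * (2 * R)"
        using Cauchy_Schwarz_ineq2[of F "snd z"] mult_left_mono[OF n2, of "norm F"] by simp
      show "\<bar>P\<bar> \<le> 4" unfolding P_def by (rule plateau'_range)
    qed (use c R in auto)
    also have "\<dots> = 16 / R * norm F" using R by (simp add: power2_eq_square field_simps)
    finally have "c * P * 2 / R\<^sup>2 * (F \<bullet> snd z) \<le> 16 / R * norm F"
      using order_trans[OF abs_ge_self] by blast
    then show ?thesis using far by simp
  qed (use R in simp)
  finally have 1: "(\<Sum>i\<in>UNIV. F $ i * cutoff_deriv R T (space_dir i) z) \<le> 16 / R * norm F * indicator (far_region R T) z" .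
  have "(\<Sum>i\<in>UNIV. F $ i * (real k * cutoff R T z ^ (k - 1) * cutoff_deriv R T (space_dir i) z))
      = (real k * cutoff R T z ^ (k - 1)) * (\<Sum>i\<in>UNIV. F $ i * cutoff_deriv R T (space_dir i) z)"
    by (simp add: sum_distrib_left mult_ac)
  also have "\<dots> \<le> (real k * cutoff R T z ^ (k - 1)) * (16 / R * norm F * indicator (far_region R T) z)"
    by (intro mult_left_mono 1 mult_nonneg_nonneg zero_le_power cutoff_range) auto
  finally show ?thesis by (simp add: mult_ac)
qed

lemma measure_cutoff_support:
  assumes R: "1 \<le> R" and T: "1 \<le> T"
  shows "measure lebesgue (cutoff_support R T :: (real \<times> (real ^ 'n)) set) \<le> 2 * T * (4 * R) ^ CARD('n)"
proof -
  have "1 / R \<le> 1" using R by simp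
  then have t: "measure lborel (cbox (1 / R) (2 * T)) \<le> 2 * T" using R T by simp
  have ne: "cbox (\<chi> i. - (2 * R)) (\<chi> i. 2 * R) \<noteq> ({} :: (real ^ 'n) set)"
    using R by (simp add: interval_ne_empty_cart)
  have x: "measure lborel (cbox (\<chi> i. - (2 * R)) (\<chi> i. 2 * R) :: (real ^ 'n) set) = (4 * R) ^ CARD('n)"
    by (subst content_cbox_cart[OF ne]) simp
  have "measure lebesgue (cutoff_support R T :: (real \<times> (real ^ 'n)) set)
      = measure lborel (cbox (1 / R) (2 * T)) * measure lborel (cbox (\<chi> i. - (2 * R)) (\<chi> i. 2 * R) :: (real ^ 'n) set)"
    by (simp add: cutoff_support_def content_Pair)
  also have "\<dots> \<le> 2 * T * (4 * R) ^ CARD('n)" unfolding x using t R by (intro mult_right_mono) auto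
  finally show ?thesis .
qed

section \<open>Absorption by Young inequalities\<close>

lemma unit_young_one:
  fixes \<alpha> \<beta> \<kappa> :: real
  assumes a: "0 \<le> \<alpha>" "0 < \<beta>" "\<alpha> + \<beta> < 1" and \<kappa>: "0 < \<kappa>"
  shows "\<exists>D. (\<forall>\<mu>>0. \<forall>M>0. 0 \<le> D \<mu> M \<and> (\<forall>X\<ge>0. \<forall>Y\<ge>0. \<kappa> * (X powr \<alpha> * Y powr \<beta>) \<le> \<mu> * X + M * Y + D \<mu> M))
      \<and> (\<forall>\<mu>>0. ((D \<mu>) \<longlongrightarrow> (0::real)) at_top)"
proof -
  define D where "D = (\<lambda>\<mu> M. \<kappa> * (((\<mu> / \<kappa>) powr (- \<alpha>) * (M / \<kappa>) powr (- \<beta>)) powr (1 / (1 - \<alpha> - \<beta>))))"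
  have ineq: "\<kappa> * (X powr \<alpha> * Y powr \<beta>) \<le> \<mu> * X + M * Y + D \<mu> M"
    if "0 < \<mu>" "0 < M" "0 \<le> X" "0 \<le> Y" for \<mu> M X Y
  proof -
    have "\<kappa> * (X powr \<alpha> * Y powr \<beta>) \<le> \<kappa> * (\<mu> / \<kappa> * X + M / \<kappa> * Y + ((\<mu> / \<kappa>) powr (- \<alpha>) * (M / \<kappa>) powr (- \<beta>)) powr (1 / (1 - \<alpha> - \<beta>)))"
      using that a \<kappa> by (intro mult_left_mono young_three) auto
    also have "\<dots> = \<mu> * X + M * Y + D \<mu> M" using \<kappa> by (simp add: D_def algebra_simps)
    finally show ?thesis .
  qed
  have lim: "((D \<mu>) \<longlongrightarrow> 0) at_top" for \<mu>
  proof -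
    have "((\<lambda>M. (M / \<kappa>) powr (- \<beta>)) \<longlongrightarrow> 0) at_top"
      by (rule tendsto_neg_powr) (use a \<kappa> in \<open>auto intro!: filterlim_at_top_mult_tendsto_pos filterlim_ident simp: divide_inverse\<close>)
    then have "((\<lambda>M. (\<mu> / \<kappa>) powr (- \<alpha>) * (M / \<kappa>) powr (- \<beta>)) \<longlongrightarrow> 0) at_top"
      by (rule tendsto_mult_right_zero)
    then have "((\<lambda>M. ((\<mu> / \<kappa>) powr (- \<alpha>) * (M / \<kappa>) powr (- \<beta>)) powr (1 / (1 - \<alpha> - \<beta>))) \<longlongrightarrow> 0 powr (1 / (1 - \<alpha> - \<beta>))) at_top"
      by (rule tendsto_powr2[OF _ tendsto_const]) (use a in auto)
    then have "((\<lambda>M. ((\<mu> / \<kappa>) powr (- \<alpha>) * (M / \<kappa>) powr (- \<beta>)) powr (1 / (1 - \<alpha> - \<beta>))) \<longlongrightarrow> 0) at_top" by simp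
    then show ?thesis unfolding D_def by (rule tendsto_mult_right_zero)
  qed
  show ?thesis using ineq lim \<kappa> by (intro exI[of _ D]) (auto simp: D_def)
qed

lemma unit_young_absorb:
  fixes \<gamma> \<kappa> :: real
  assumes \<gamma>: "0 < \<gamma>" "\<gamma> < 1" and \<kappa>: "0 < \<kappa>"
  shows "\<exists>D. (\<forall>M>0. 0 \<le> D M \<and> (\<forall>Y\<ge>0. \<kappa> * Y powr \<gamma> \<le> M * Y + D M)) \<and> (D \<longlongrightarrow> (0::real)) at_top"
proof -
  define D where "D = (\<lambda>M. \<kappa> * (M / \<kappa>) powr (- (\<gamma> / (1 - \<gamma>))))"
  have "\<kappa> * Y powr \<gamma> \<le> M * Y + D M" if M: "0 < M" and Y: "0 \<le> Y" for M Y
  proof (cases "\<kappa> * Y powr \<gamma> \<le> M * Y")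
    case True
    then show ?thesis using \<kappa> by (simp add: D_def add_increasing2)
  next
    case False
    then have Y0: "0 < Y" using Y by (cases "Y = 0") auto
    have "M / \<kappa> < Y powr (\<gamma> - 1)"
      using False Y0 \<kappa> by (simp add: powr_diff field_simps)
    then have "(Y powr (\<gamma> - 1)) powr (- (\<gamma> / (1 - \<gamma>))) \<le> (M / \<kappa>) powr (- (\<gamma> / (1 - \<gamma>)))"
      using M \<kappa> \<gamma> by (intro powr_mono2') auto
    moreover have "(\<gamma> - 1) * (- (\<gamma> / (1 - \<gamma>))) = \<gamma>" using \<gamma> by (simp add: field_simps)
    ultimately have "Y powr \<gamma> \<le> (M / \<kappa>) powr (- (\<gamma> / (1 - \<gamma>)))" by (simp only: powr_powr)
    then have "\<kappa> * Y powr \<gamma> \<le> D M" unfolding D_def using \<kappa> by (intro mult_left_mono) auto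
    then show ?thesis using M Y by (simp add: add_increasing)
  qed
  moreover have "(D \<longlongrightarrow> 0) at_top"
  proof -
    have "((\<lambda>M. (M / \<kappa>) powr (- (\<gamma> / (1 - \<gamma>)))) \<longlongrightarrow> 0) at_top"
      by (rule tendsto_neg_powr) (use \<gamma> \<kappa> in \<open>auto intro!: filterlim_at_top_mult_tendsto_pos filterlim_ident simp: divide_inverse\<close>)
    then show ?thesis unfolding D_def by (rule tendsto_mult_right_zero)
  qed
  ultimately show ?thesis using \<kappa> by (intro exI[of _ D]) (auto simp: D_def)
qed

text \<open>
  \<open>D \<mu> M\<close> is the price for absorbing the two terms on the right-hand side of the energy inequality
  (with exponent \<open>s\<close>) into \<open>\<mu>\<close> times the dissipation (with exponent \<open>e\<close>) plus \<open>M\<close> times the reaction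
  term, at unit scale: \<open>f\<close>, \<open>a\<close> and \<open>\<theta>\<close> stand for \<open>\<bar>F\<bar>\<close>, \<open>w + d\<close> and the cutoff, and the test function is
  \<open>\<theta>\<^sup>k\<close>. The price tends to 0 as \<open>M\<close> grows. The argument uses \<open>s = e\<close> and \<open>s = 0\<close>.
\<close>

definition absorbing :: "real \<Rightarrow> real \<Rightarrow> real \<Rightarrow> real \<Rightarrow> real \<Rightarrow> nat \<Rightarrow> (real \<Rightarrow> real \<Rightarrow> real) \<Rightarrow> bool" where
  "absorbing p q e s \<kappa> k D \<longleftrightarrow> (\<forall>\<mu>>0. \<forall>M>0. 0 \<le> D \<mu> M \<and>
        (\<forall>f\<ge>0. \<forall>a>0. \<forall>\<theta>>0. \<theta> \<le> 1 \<longrightarrow>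
          \<kappa> * f * \<theta> ^ (k - 1) * a powr (- s) + \<kappa> * a powr (1 - s) * \<theta> ^ (k - 1)
          \<le> \<mu> * (f powr (p / (p - 1)) * a powr (- 1 - e) * \<theta> ^ k) + M * (a powr (q - s) * \<theta> ^ k) + D \<mu> M))
      \<and> (\<forall>\<mu>>0. ((D \<mu>) \<longlongrightarrow> (0::real)) at_top)"

lemma absorbingD:
  assumes "absorbing p q e s \<kappa> k D" "0 < \<mu>"
  shows "0 < M \<Longrightarrow> 0 \<le> D \<mu> M"
    and "0 < M \<Longrightarrow> 0 \<le> f \<Longrightarrow> 0 < a \<Longrightarrow> 0 < \<theta> \<Longrightarrow> \<theta> \<le> 1 \<Longrightarrow>
          \<kappa> * f * \<theta> ^ (k - 1) * a powr (- s) + \<kappa> * a powr (1 - s) * \<theta> ^ (k - 1)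
          \<le> \<mu> * (f powr (p / (p - 1)) * a powr (- 1 - e) * \<theta> ^ k) + M * (a powr (q - s) * \<theta> ^ k) + D \<mu> M"
    and "(D \<mu> \<longlongrightarrow> 0) at_top"
  using assms unfolding absorbing_def by blast+

text \<open>
  The flux term is \<open>X\<^sup>\<alpha> Y\<^sup>\<beta>\<close> and the time term \<open>Y\<^sup>\<gamma>\<close>, up to powers of the cutoff, where \<open>X\<close> is the
  dissipation and \<open>Y\<close> the reaction term. The exponents satisfy \<open>\<alpha> + \<beta> < 1\<close> and \<open>\<gamma> < 1\<close>; this leaves
  room for the power of the cutoff that a differentiation costs, provided \<open>k\<close> is large.
\<close>

lemma unit_young:
  fixes p q e s :: real
  assumes p: "1 < p" "p \<le> 2" and q: "1 < q" and e: "0 < e" "e < p - 1" "1 + e < q" and s: "0 \<le> s" "s \<le> e"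
  shows "\<exists>k0. \<forall>\<kappa>>0. \<forall>k\<ge>k0. \<exists>D. absorbing p q e s \<kappa> k D"
proof -
  define \<alpha> where "\<alpha> = (p - 1) / p"
  define \<beta> where "\<beta> = ((1 + e) * \<alpha> - s) / (q - s)"
  define \<gamma> where "\<gamma> = (1 - s) / (q - s)"
  have qs: "0 < q - s" using s e by linarith
  have \<alpha>: "0 < \<alpha>" "\<alpha> < 1" using p by (auto simp: \<alpha>_def)
  have "s * p \<le> e * p" using s p by (intro mult_right_mono) auto
  moreover have "(1 + e) * (p - 1) = e * p + (p - 1 - e)" by (simp add: algebra_simps)
  ultimately have "s * p < (1 + e) * (p - 1)" using e by linarith
  then have \<beta>0: "0 < (1 + e) * \<alpha> - s" using p by (simp add: \<alpha>_def field_simps)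
  then have \<beta>: "0 < \<beta>" using qs by (simp add: \<beta>_def)
  have ab: "\<alpha> + \<beta> < 1"
  proof -
    have "(1 + e) * (p - 1) \<le> (1 + e) * 1" using p e by (intro mult_left_mono) auto
    also have "\<dots> < q" using e by simp
    finally have "(1 + e) * (p - 1) < q" .
    moreover have "0 \<le> (p - 1) * s" using p s by simp
    moreover have "(p - 1) * s = s * p - s" by (simp add: algebra_simps)
    ultimately have "(1 + e) * (p - 1) - s * p < q - s" by linarith
    then have "((1 + e) * (p - 1) - s * p) / p < (q - s) / p" using p by (intro divide_strict_right_mono) auto
    moreover have "((1 + e) * (p - 1) - s * p) / p = (1 + e) * \<alpha> - s"
      unfolding \<alpha>_def using p by (simp add: diff_divide_distrib[of _ "s * p"] del: times_divide_eq_right add: times_divide_eq_right[symmetric])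
    ultimately have "((1 + e) * \<alpha> - s) < (q - s) / p" by simp
    then have "\<beta> < 1 / p" using qs p by (simp add: \<beta>_def field_simps)
    moreover have "\<alpha> = 1 - 1 / p" using p by (simp add: \<alpha>_def field_simps)
    ultimately show ?thesis by simp
  qed
  have \<gamma>: "0 < \<gamma>" "0 + \<gamma> < 1" using s e p q qs by (auto simp: \<gamma>_def)
  obtain k0 :: nat where k0: "1 / (1 - \<alpha> - \<beta>) + 1 / (1 - \<gamma>) + 1 < real k0"
    using reals_Archimedean2 by blast
  show ?thesis
  proof (rule exI[of _ k0], intro allI impI)
    fix \<kappa> :: real and k assume \<kappa>: "0 < \<kappa>" and k: "k0 \<le> k"
    obtain D1 where D1: "\<And>\<mu> M. 0 < \<mu> \<Longrightarrow> 0 < M \<Longrightarrow> 0 \<le> D1 \<mu> M"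
        "\<And>\<mu> M X Y. 0 < \<mu> \<Longrightarrow> 0 < M \<Longrightarrow> 0 \<le> X \<Longrightarrow> 0 \<le> Y \<Longrightarrow> \<kappa> * (X powr \<alpha> * Y powr \<beta>) \<le> \<mu> * X + M * Y + D1 \<mu> M"
        "\<And>\<mu>. 0 < \<mu> \<Longrightarrow> ((D1 \<mu>) \<longlongrightarrow> 0) at_top"
      using unit_young_one[of \<alpha> \<beta> \<kappa>] \<alpha> \<beta> ab \<kappa> by (metis less_imp_le)
    obtain D2 where D2: "\<And>M. 0 < M \<Longrightarrow> 0 \<le> D2 M"
        "\<And>M Y. 0 < M \<Longrightarrow> 0 \<le> Y \<Longrightarrow> \<kappa> * Y powr \<gamma> \<le> M * Y + D2 M" "(D2 \<longlongrightarrow> 0) at_top"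
      using unit_young_absorb[of \<gamma> \<kappa>] \<gamma> \<kappa> by auto
    have pos: "0 < 1 / (1 - \<alpha> - \<beta>)" "0 < 1 / (1 - \<gamma>)" using ab \<gamma> by auto
    have kk: "1 / (1 - \<alpha> - \<beta>) < real k" "1 / (1 - \<gamma>) < real k" "1 < real k" using k k0 pos by linarith+
    have k1: "real k * \<alpha> + real k * \<beta> \<le> real k - 1" "real k * \<gamma> \<le> real k - 1"
      using kk ab \<gamma> by (auto simp: field_simps)
    have km: "real (k - 1) = real k - 1" using kk by (simp add: of_nat_diff)
    have \<theta>p: "\<theta> ^ m = \<theta> powr real m" if "0 < \<theta>" for \<theta> :: real and m using that by (simp add: powr_realpow)
    define D where "D = (\<lambda>\<mu> M. D1 \<mu> (M / 2) + D2 (M / 2))"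
    have main: "\<kappa> * f * \<theta> ^ (k - 1) * a powr (- s) + \<kappa> * a powr (1 - s) * \<theta> ^ (k - 1)
          \<le> \<mu> * (f powr (p / (p - 1)) * a powr (- 1 - e) * \<theta> ^ k) + M * (a powr (q - s) * \<theta> ^ k) + D \<mu> M"
      if \<mu>: "0 < \<mu>" and M: "0 < M" and f: "0 \<le> f" and a: "0 < a" and \<theta>: "0 < \<theta>" "\<theta> \<le> 1" for \<mu> M f a \<theta>
    proof -
      define X where "X = f powr (p / (p - 1)) * a powr (- 1 - e) * \<theta> ^ k"
      define Y where "Y = a powr (q - s) * \<theta> ^ k"
      have XY: "0 \<le> X" "0 \<le> Y" using \<theta> by (auto simp: X_def Y_def)
      have pa: "p / (p - 1) * \<alpha> = 1" using p by (simp add: \<alpha>_def)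
      have "X powr \<alpha> = (f powr (p / (p - 1))) powr \<alpha> * (a powr (- 1 - e)) powr \<alpha> * (\<theta> powr real k) powr \<alpha>"
        unfolding X_def \<theta>p[OF \<theta>(1)] by (simp add: powr_mult)
      also have "\<dots> = f * a powr ((- 1 - e) * \<alpha>) * \<theta> powr (real k * \<alpha>)"
        unfolding powr_powr pa using f by simp
      finally have Xa: "X powr \<alpha> = f * a powr ((- 1 - e) * \<alpha>) * \<theta> powr (real k * \<alpha>)" .
      have Yb: "Y powr b = a powr ((q - s) * b) * \<theta> powr (real k * b)" for b
        unfolding Y_def \<theta>p[OF \<theta>(1)] by (simp add: powr_mult powr_powr)
      have "(q - s) * \<beta> = (1 + e) * \<alpha> - s" using qs by (simp add: \<beta>_def)
      then have ex: "(- 1 - e) * \<alpha> + (q - s) * \<beta> = - s" by (simp only:) (simp add: algebra_simps)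
      have "X powr \<alpha> * Y powr \<beta> = f * (a powr ((- 1 - e) * \<alpha>) * a powr ((q - s) * \<beta>)) * (\<theta> powr (real k * \<alpha>) * \<theta> powr (real k * \<beta>))"
        unfolding Xa Yb by (simp add: mult_ac)
      also have "\<dots> = f * a powr (- s) * \<theta> powr (real k * \<alpha> + real k * \<beta>)"
        unfolding powr_add[symmetric] ex ..
      finally have XaYb: "X powr \<alpha> * Y powr \<beta> = f * a powr (- s) * \<theta> powr (real k * \<alpha> + real k * \<beta>)" .
      have t1: "\<theta> ^ (k - 1) \<le> \<theta> powr (real k * \<alpha> + real k * \<beta>)" and t2: "\<theta> ^ (k - 1) \<le> \<theta> powr (real k * \<gamma>)"
        unfolding \<theta>p[OF \<theta>(1)] km using powr_mono'[OF k1(1)] powr_mono'[OF k1(2)] \<theta> by simp_all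
      have "\<kappa> * f * \<theta> ^ (k - 1) * a powr (- s) \<le> \<kappa> * (X powr \<alpha> * Y powr \<beta>)"
      proof -
        have "(\<kappa> * f * a powr (- s)) * \<theta> ^ (k - 1) \<le> (\<kappa> * f * a powr (- s)) * \<theta> powr (real k * \<alpha> + real k * \<beta>)"
          using \<kappa> f by (intro mult_left_mono t1) auto
        then show ?thesis by (simp add: XaYb mult_ac)
      qed
      also have "\<dots> \<le> \<mu> * X + M / 2 * Y + D1 \<mu> (M / 2)"
        by (rule D1(2)) (use \<mu> M XY in auto)
      finally have 1: "\<kappa> * f * \<theta> ^ (k - 1) * a powr (- s) \<le> \<mu> * X + M / 2 * Y + D1 \<mu> (M / 2)" .
      have exg: "(q - s) * \<gamma> = 1 - s" using qs by (simp add: \<gamma>_def)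
      have "\<kappa> * a powr (1 - s) * \<theta> ^ (k - 1) \<le> \<kappa> * Y powr \<gamma>"
        unfolding Yb exg using \<kappa> mult_left_mono[OF t2, of "\<kappa> * a powr (1 - s)"] by (simp add: mult.assoc)
      also have "\<dots> \<le> M / 2 * Y + D2 (M / 2)"
        by (rule D2(2)) (use M XY in auto)
      finally have 2: "\<kappa> * a powr (1 - s) * \<theta> ^ (k - 1) \<le> M / 2 * Y + D2 (M / 2)" .
      have "M / 2 * Y + M / 2 * Y = M * Y" by (simp add: field_simps)
      then show ?thesis unfolding X_def[symmetric] Y_def[symmetric] D_def using 1 2 by linarith
    qed
    have nonneg: "0 \<le> D \<mu> M" if "0 < \<mu>" "0 < M" for \<mu> M
      using D1(1)[of \<mu> "M / 2"] D2(1)[of "M / 2"] that by (simp add: D_def)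
    have lim: "((D \<mu>) \<longlongrightarrow> 0) at_top" if "0 < \<mu>" for \<mu>
    proof -
      have h: "filterlim (\<lambda>M::real. M / 2) at_top at_top" by real_asymp
      have "((\<lambda>M. D1 \<mu> (M / 2) + D2 (M / 2)) \<longlongrightarrow> 0 + 0) at_top"
        by (rule tendsto_add[OF filterlim_compose[OF D1(3)[OF that] h] filterlim_compose[OF D2(3) h]])
      then show ?thesis by (simp add: D_def)
    qed
    show "\<exists>D. absorbing p q e s \<kappa> k D"
      unfolding absorbing_def
      by (intro exI[of _ D] conjI allI impI main nonneg lim)
  qed
qed

section \<open>The test function argument\<close>

text \<open>
  The unit-scale inequality for \<open>\<bar>F\<bar> (R/W)\<^sup>p\<^sup>-\<^sup>1\<close> and \<open>(w + d)/W\<close>, multiplied by \<open>W\<^sup>q\<^sup>-\<^sup>s\<close>. The relations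
  between \<open>R\<close>, \<open>T\<close> and \<open>W\<close> are those under which all terms of the equation scale alike.
\<close>

lemma young_unscaled:
  fixes p q e s \<kappa> R T W :: real
  assumes p: "1 < p" and k: "2 \<le> k"
    and Y: "\<And>f a \<theta>. 0 \<le> f \<Longrightarrow> 0 < a \<Longrightarrow> 0 < \<theta> \<Longrightarrow> \<theta> \<le> 1 \<Longrightarrow>
          \<kappa> * f * \<theta> ^ (k - 1) * a powr (- s) + \<kappa> * a powr (1 - s) * \<theta> ^ (k - 1)
          \<le> \<mu> * (f powr (p / (p - 1)) * a powr (- 1 - e) * \<theta> ^ k) + M * (a powr (q - s) * \<theta> ^ k) + D"
    and R: "0 < R" and W: "0 < W" and RW: "R powr p * W powr (q - p + 1) = 1" and T: "T = W powr (1 - q)"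
    and D: "0 \<le> D" and f: "0 \<le> f" and a: "0 < a" and \<theta>: "0 \<le> \<theta>" "\<theta> \<le> 1"
  shows "\<kappa> / R * \<theta> ^ (k - 1) * f * a powr (- s) + \<kappa> / T * \<theta> ^ (k - 1) * a powr (1 - s)
    \<le> \<mu> * W powr (e - s) * (f powr (p / (p - 1)) * a powr (- 1 - e) * \<theta> ^ k) + M * (a powr (q - s) * \<theta> ^ k) + D * W powr (q - s)"
proof (cases "\<theta> = 0")
  case True
  then have z0: "\<theta> ^ (k - 1) = 0" "\<theta> ^ k = 0" using k by auto
  show ?thesis unfolding z0 using D by simp
next
  case False
  then have \<theta>0: "0 < \<theta>" using \<theta> by simp
  define c where "c = W powr (q - s)"
  have c0: "0 < c" using W by (simp add: c_def)
  have dv: "(x / W) powr b = x powr b * W powr (- b)" if "0 \<le> x" for x b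
    using powr_divide[of x W b] powr_minus_divide[of W b] that W by simp
  have Rp: "R powr (p - 1) = R powr p / R"
    using R powr_diff[of R p 1] by simp
  have i1: "c * ((R / W) powr (p - 1) * (a / W) powr (- s)) = a powr (- s) / R"
  proof -
    have "c * ((R / W) powr (p - 1) * (a / W) powr (- s))
        = R powr p * (W powr (q - s) * W powr (- (p - 1)) * W powr s) * a powr (- s) / R"
      using R a by (simp add: dv Rp c_def)
    also have "W powr (q - s) * W powr (- (p - 1)) * W powr s = W powr (q - p + 1)"
      unfolding powr_add[symmetric] by (rule arg_cong[where f = "\<lambda>x. W powr x"]) simp
    finally show ?thesis by (simp add: RW)
  qed
  have i2: "c * (a / W) powr (1 - s) = a powr (1 - s) / T"
  proof -
    have "c * (a / W) powr (1 - s) = (W powr (q - s) * W powr (- (1 - s))) * a powr (1 - s)"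
      using a by (simp add: dv c_def)
    also have "W powr (q - s) * W powr (- (1 - s)) = W powr (- (1 - q))" by (simp add: powr_add[symmetric])
    also have "\<dots> = 1 / T" unfolding T using powr_minus_divide[of W "1 - q"] by simp
    finally show ?thesis by simp
  qed
  have i3: "c * ((f * (R / W) powr (p - 1)) powr (p / (p - 1)) * (a / W) powr (- 1 - e))
      = W powr (e - s) * (f powr (p / (p - 1)) * a powr (- 1 - e))"
  proof -
    have "(f * (R / W) powr (p - 1)) powr (p / (p - 1)) = f powr (p / (p - 1)) * (R / W) powr p"
      using f p by (simp add: powr_mult powr_powr)
    then have "c * ((f * (R / W) powr (p - 1)) powr (p / (p - 1)) * (a / W) powr (- 1 - e))
        = (R powr p * (W powr (q - s) * W powr (- p) * W powr (- (- 1 - e)))) * (f powr (p / (p - 1)) * a powr (- 1 - e))"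
      by (simp only: dv[OF less_imp_le[OF a]] dv[OF less_imp_le[OF R]] c_def mult_ac)
    also have "W powr (q - s) * W powr (- p) * W powr (- (- 1 - e)) = W powr (q - p + 1) * W powr (e - s)"
      unfolding powr_add[symmetric] by (rule arg_cong[where f = "\<lambda>x. W powr x"]) simp
    also have "R powr p * (W powr (q - p + 1) * W powr (e - s)) = W powr (e - s)"
      using RW by (simp add: mult.assoc[symmetric])
    finally show ?thesis .
  qed
  have i4: "c * (a / W) powr (q - s) = a powr (q - s)"
  proof -
    have "c * (a / W) powr (q - s) = (W powr (q - s) * W powr (- (q - s))) * a powr (q - s)"
      by (simp only: dv[OF less_imp_le[OF a]] c_def mult_ac)
    also have "W powr (q - s) * W powr (- (q - s)) = 1" using W by (simp only: powr_add[symmetric]) simp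
    finally show ?thesis by simp
  qed
  have "c * (\<kappa> * (f * (R / W) powr (p - 1)) * \<theta> ^ (k - 1) * (a / W) powr (- s) + \<kappa> * (a / W) powr (1 - s) * \<theta> ^ (k - 1))
      \<le> c * (\<mu> * ((f * (R / W) powr (p - 1)) powr (p / (p - 1)) * (a / W) powr (- 1 - e) * \<theta> ^ k)
        + M * ((a / W) powr (q - s) * \<theta> ^ k) + D)"
    using c0 f a W R \<theta>0 \<theta> by (intro mult_left_mono Y) auto
  also have "\<dots> = \<mu> * (c * ((f * (R / W) powr (p - 1)) powr (p / (p - 1)) * (a / W) powr (- 1 - e))) * \<theta> ^ k
      + M * ((c * (a / W) powr (q - s)) * \<theta> ^ k) + D * c" by (simp add: algebra_simps)
  also have "\<dots> = \<mu> * W powr (e - s) * (f powr (p / (p - 1)) * a powr (- 1 - e) * \<theta> ^ k) + M * (a powr (q - s) * \<theta> ^ k) + D * W powr (q - s)"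
    unfolding i3 i4 by (simp add: c_def mult_ac)
  also have "c * (\<kappa> * (f * (R / W) powr (p - 1)) * \<theta> ^ (k - 1) * (a / W) powr (- s) + \<kappa> * (a / W) powr (1 - s) * \<theta> ^ (k - 1))
      = \<kappa> * f * \<theta> ^ (k - 1) * (c * ((R / W) powr (p - 1) * (a / W) powr (- s))) + \<kappa> * \<theta> ^ (k - 1) * (c * (a / W) powr (1 - s))"
    by (simp add: algebra_simps)
  also have "\<dots> = \<kappa> / R * \<theta> ^ (k - 1) * f * a powr (- s) + \<kappa> / T * \<theta> ^ (k - 1) * a powr (1 - s)"
    unfolding i1 i2 by (simp add: mult_ac)
  finally show ?thesis .
qed

text \<open>
  The Fujita-type argument. Besides the energy estimate, only the two pointwise lower bounds and local
  integrability of \<open>w\<^sup>q\<close> enter. The critical exponent appears solely in the bound \<open>W\<^sup>q m \<le> C\<close> for the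
  measure \<open>m\<close> of the support of the cutoff.
\<close>

lemma energy_estimate_imp_zero:
  fixes w G X :: "real \<times> (real ^ 'n) \<Rightarrow> real" and F :: "real \<times> (real ^ 'n) \<Rightarrow> real ^ 'n" and p q c0 cF :: real
  assumes p: "1 < p" "p \<le> 2" and q: "1 < q" "q \<le> p - 1 + p / real CARD('n)"
    and c0: "0 < c0" and cF: "0 < cF"
    and AE0: "AE z in lebesgue. z \<in> half_space \<longrightarrow> 0 \<le> w z \<and> c0 * w z powr q \<le> G z
        \<and> cF * norm (F z) powr (p / (p - 1)) \<le> X z"
    and loc: "\<And>K. compact K \<Longrightarrow> K \<subseteq> half_space \<Longrightarrow> integrable lebesgue (\<lambda>z. indicator K z * \<bar>w z\<bar> powr q)"
    and en0: "energy_estimate w G X F"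
  shows "AE z in lebesgue. z \<in> half_space \<longrightarrow> w z = 0"
proof -
  let ?S = "half_space :: (real \<times> (real ^ 'n)) set"
  note en = en0[unfolded energy_estimate_def, rule_format]
  \<comment> \<open>The conditions on \<open>e\<close> make the Young exponents admissible.\<close>
  define e where "e = min (p - 1) (q - 1) / 2"
  have e: "0 < e" "e < p - 1" "1 + e < q" "e < 1" 
  proof -
    have le: "e \<le> (p - 1) / 2" "e \<le> (q - 1) / 2" by (auto simp: e_def)
    show "0 < e" using p q by (simp add: e_def)
    have "(p - 1) / 2 < p - 1" "(q - 1) / 2 < q - 1" "(p - 1) / 2 < 1" using p q(1) by auto
    then show "e < p - 1" "1 + e < q" "e < 1" using le by auto
  qed
  define \<sigma> where "\<sigma> = q - p + 1"
  have \<sigma>: "0 < \<sigma>" using p q by (simp add: \<sigma>_def)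
  obtain ka where ka: "\<And>\<kappa> k. 0 < \<kappa> \<Longrightarrow> ka \<le> k \<Longrightarrow> \<exists>D. absorbing p q e e \<kappa> k D"
    using unit_young[OF p q(1) e(1-3), of e] e(1) by auto
  obtain kb where kb: "\<And>\<kappa> k. 0 < \<kappa> \<Longrightarrow> kb \<le> k \<Longrightarrow> \<exists>D. absorbing p q e 0 \<kappa> k D"
    using unit_young[OF p q(1) e(1-3), of 0] e(1) by auto
  define k where "k = max 2 (max ka kb)"
  have k: "2 \<le> k" "ka \<le> k" "kb \<le> k" by (auto simp: k_def)
  define \<kappa> where "\<kappa> = 16 * real k / (1 - e)"
  have \<kappa>: "0 < \<kappa>" using k e by (simp add: \<kappa>_def)
  have "16 * real k * (1 - e) \<le> 16 * real k * 1" using e by (intro mult_left_mono) auto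
  then have \<kappa>1: "16 * real k \<le> \<kappa>" using e by (simp add: \<kappa>_def le_divide_eq)
  have \<kappa>2: "1 / (1 - e) * (4 * real k) \<le> \<kappa>" "4 * real k \<le> \<kappa>" using e \<kappa>1 by (auto simp: \<kappa>_def divide_right_mono)
  obtain De where "absorbing p q e e \<kappa> k De" using ka[OF \<kappa> k(2)] by blast
  note De = absorbingD[OF this]
  obtain D where "absorbing p q e 0 \<kappa> k D" using kb[OF \<kappa> k(3)] by blast
  note D = absorbingD[OF this]
  define W where "W = (\<lambda>R::real. R powr (- (p / \<sigma>)))"
  define T where "T = (\<lambda>R::real. W R powr (1 - q))"
  have W0: "0 < W R" if "1 \<le> R" for R using that by (simp add: W_def)
  have RW: "R powr p * W R powr (q - p + 1) = 1" if "1 \<le> R" for R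
    using that \<sigma> unfolding \<sigma>_def[symmetric] by (simp add: W_def powr_powr powr_add[symmetric])
  have T_eq: "T R = R powr (p / \<sigma> * (q - 1))" if "1 \<le> R" for R
  proof -
    have "- a * (1 - q) = a * (q - 1)" for a :: real by (simp add: algebra_simps)
    then show ?thesis by (simp only: T_def W_def powr_powr)
  qed
  have T1: "1 \<le> T R" if "1 \<le> R" for R
    unfolding T_eq[OF that] using that p q \<sigma> by (intro ge_one_powr_ge_zero) auto
  define K where "K = (\<lambda>R. cutoff_support R (T R) :: (real \<times> (real ^ 'n)) set)"
  define \<theta> where "\<theta> = (\<lambda>R. cutoff R (T R) :: real \<times> (real ^ 'n) \<Rightarrow> real)"
  define A where "A = (\<lambda>R. far_region R (T R) :: (real \<times> (real ^ 'n)) set)"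
  define \<phi> where "\<phi> = (\<lambda>R z. \<theta> R z ^ k)"
  define \<phi>' where "\<phi>' = (\<lambda>R b z. real k * \<theta> R z ^ (k - 1) * cutoff_deriv R (T R) b z)"
  define m where "m = (\<lambda>R. measure lebesgue (K R))"
  have m0: "0 \<le> m R" for R by (simp add: m_def)
  have C1: "C1_cutoff (K R) (\<phi> R) (\<phi>' R)" if "1 \<le> R" for R
    unfolding K_def \<phi>_def \<phi>'_def \<theta>_def using that T1[OF that] by (intro cutoff_C1 k) auto
  have KS: "K R \<subseteq> ?S" if "1 \<le> R" for R unfolding K_def using that by (intro cutoff_support_subset) auto
  have Kc: "compact (K R)" for R by (simp add: K_def cutoff_support_def compact_cbox)
  have Ki: "integrable lebesgue (indicator (K R) :: _ \<Rightarrow> real)" for R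
    using emeasure_compact_finite[OF Kc[of R]] Kc[of R]
    by (intro integrable_real_indicator) (auto simp: compact_imp_closed less_top[symmetric])
  have \<phi>0: "\<phi> R z = 0" "\<phi>' R b z = 0" if "1 \<le> R" "z \<notin> K R" for R b z
    using C1[OF that(1)] that(2) unfolding C1_cutoff_def by blast+
  have \<theta>01: "0 \<le> \<theta> R z" "\<theta> R z \<le> 1" for R z by (simp_all add: \<theta>_def cutoff_range)
  have \<phi>01: "0 \<le> \<phi> R z" "\<phi> R z \<le> 1" for R z using \<theta>01[of R z] by (auto simp: \<phi>_def power_le_one)
  have flux: "(\<Sum>i\<in>UNIV. F z $ i * \<phi>' R (space_dir i) z) \<le> \<kappa> / R * \<theta> R z ^ (k - 1) * norm (F z) * indicator (A R) z"
    if R: "1 \<le> R" for R z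
  proof -
    have "(\<Sum>i\<in>UNIV. F z $ i * \<phi>' R (space_dir i) z)
        \<le> 16 * real k / R * \<theta> R z ^ (k - 1) * norm (F z) * indicator (A R) z"
      unfolding \<phi>'_def \<theta>_def A_def using R T1[OF R] by (intro cutoff_space_derivative) auto
    also have "\<dots> \<le> \<kappa> / R * \<theta> R z ^ (k - 1) * norm (F z) * indicator (A R) z"
      using R \<kappa>1 \<theta>01 by (intro mult_right_mono divide_right_mono) auto
    finally show ?thesis .
  qed
  have time: "- (c * \<phi>' R time_dir z) \<le> \<kappa> / T R * \<theta> R z ^ (k - 1) * indicator (A R) z"
    if R: "1 \<le> R" and c: "0 \<le> c" "c * (4 * real k) \<le> \<kappa>" for R z c
  proof -
    have "c * (- \<phi>' R time_dir z) \<le> c * (4 * real k / T R * \<theta> R z ^ (k - 1) * indicator (A R) z)"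
      unfolding \<phi>'_def \<theta>_def A_def using R T1[OF R] c by (intro mult_left_mono cutoff_time_derivative) auto
    also have "\<dots> = c * (4 * real k) / T R * \<theta> R z ^ (k - 1) * indicator (A R) z" by simp
    also have "\<dots> \<le> \<kappa> / T R * \<theta> R z ^ (k - 1) * indicator (A R) z"
      using T1[OF R] c \<theta>01 by (intro mult_right_mono divide_right_mono) auto
    finally show ?thesis by simp
  qed
  define Cn where "Cn = (2 * 4 ^ CARD('n) :: real)"
  have vol: "W R powr q * m R \<le> Cn" if R: "1 \<le> R" for R
  proof -
    have n: "real CARD('n) \<le> p / \<sigma>"
    proof -
      have "\<sigma> \<le> p / real CARD('n)" using q by (simp add: \<sigma>_def)
      then have "real CARD('n) * \<sigma> \<le> p" by (simp add: field_simps)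
      then show ?thesis using \<sigma> by (simp add: field_simps)
    qed
    have "W R powr q * m R \<le> W R powr q * (2 * T R * (4 * R) ^ CARD('n))"
      unfolding m_def K_def using R T1[OF R] by (intro mult_left_mono measure_cutoff_support) auto
    also have "\<dots> = Cn * (W R powr q * T R) * R ^ CARD('n)"
      by (simp add: Cn_def power_mult_distrib)
    also have "W R powr q * T R = W R" using W0[OF R] by (simp add: T_def powr_add[symmetric])
    also have "Cn * W R * R ^ CARD('n) = Cn * R powr (real CARD('n) - p / \<sigma>)"
      using R by (simp add: W_def powr_realpow[symmetric] powr_diff powr_minus divide_inverse)
    also have "\<dots> \<le> Cn * R powr 0" using R n by (intro mult_left_mono powr_mono) (auto simp: Cn_def)
    also have "\<dots> = Cn" using R by simp
    finally show ?thesis .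
  qed
  have Cn0: "0 < Cn" by (simp add: Cn_def)

  \<comment> \<open>First step, with exponent \<open>e > 0\<close>: the dissipation \<open>I R d\<close> is bounded uniformly after
    scaling. The part of the reaction term used for absorption is compared with \<open>G\<close> at the cost
    of powers of \<open>d\<close>, which \<open>d \<le> W R\<close> keeps at the natural scale.\<close>
  define I where "I = (\<lambda>R d. LINT z|lebesgue. X z * ((w z + d) powr (- e - 1) * \<phi> R z))"
  define E where "E = c0 + De (e / 2 * cF) (c0 / 2 powr q)"
  have E0: "0 < E" using De(1)[of "e / 2 * cF" "c0 / 2 powr q"] e c0 cF by (simp add: E_def)
  have step1: "e / 2 * I R d \<le> E * W R powr (q - e) * m R" if R: "1 \<le> R" and d: "0 < d" "d \<le> W R" for R d
  proof -
    have \<mu>e: "0 < e / 2 * cF" and Me: "0 < c0 / 2 powr q" using e c0 cF by auto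
    have R0: "0 < R" using R by simp
    have T_W: "T R = W R powr (1 - q)" by (simp add: T_def)
    note en' = en[OF KS[OF R] C1[OF R] d(1) less_imp_le[OF e(1)] e(4)]
    let ?L = "\<lambda>z. (\<Sum>i\<in>UNIV. F z $ i * \<phi>' R (space_dir i) z) * (w z + d) powr (- e)
        - 1 / (1 - e) * ((w z + d) powr (1 - e) * \<phi>' R time_dir z)"
    let ?U = "\<lambda>z. e / 2 * (X z * ((w z + d) powr (- e - 1) * \<phi> R z)) + G z * ((w z + d) powr (- e) * \<phi> R z)
        + E * W R powr (q - e) * indicator (K R) z"
    have "integral\<^sup>L lebesgue ?L \<le> integral\<^sup>L lebesgue ?U"
    proof (rule integral_mono_AE)
      show "integrable lebesgue ?L" "integrable lebesgue ?U" using en' Ki by auto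
      show "AE z in lebesgue. ?L z \<le> ?U z"
        using AE0
      proof eventually_elim
        case (elim z)
        show ?case
        proof (cases "z \<in> K R")
          case False
          then show ?thesis using \<phi>0[OF R] by simp
        next
          case True
          then have z: "0 \<le> w z" "c0 * w z powr q \<le> G z" "cF * norm (F z) powr (p / (p - 1)) \<le> X z"
            using elim KS[OF R] by auto
          define a where "a = w z + d"
          have a: "d \<le> a" "0 < a" using z d by (auto simp: a_def)
          have "?L z \<le> \<kappa> / R * \<theta> R z ^ (k - 1) * norm (F z) * a powr (- e) + \<kappa> / T R * \<theta> R z ^ (k - 1) * a powr (1 - e)"
          proof -
            have "(\<Sum>i\<in>UNIV. F z $ i * \<phi>' R (space_dir i) z) \<le> \<kappa> / R * \<theta> R z ^ (k - 1) * norm (F z)"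
            proof (cases "z \<in> A R")
              case False
              have "0 \<le> \<kappa> / R * \<theta> R z ^ (k - 1) * norm (F z)" using R \<kappa> \<theta>01(1)[of R z] by simp
              then show ?thesis using flux[OF R, of z] False by simp
            qed (use flux[OF R, of z] in simp)
            moreover have "- (1 / (1 - e) * \<phi>' R time_dir z) \<le> \<kappa> / T R * \<theta> R z ^ (k - 1)"
            proof (cases "z \<in> A R")
              case False
              have "0 \<le> \<kappa> / T R * \<theta> R z ^ (k - 1)" using T1[OF R] \<kappa> \<theta>01(1)[of R z] by simp
              then show ?thesis using time[OF R _ \<kappa>2(1), of z] e False by simp
            qed (use time[OF R _ \<kappa>2(1), of z] e in simp)
            ultimately have "(\<Sum>i\<in>UNIV. F z $ i * \<phi>' R (space_dir i) z) * a powr (- e) + (- (1 / (1 - e) * \<phi>' R time_dir z)) * a powr (1 - e)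
              \<le> (\<kappa> / R * \<theta> R z ^ (k - 1) * norm (F z)) * a powr (- e) + (\<kappa> / T R * \<theta> R z ^ (k - 1)) * a powr (1 - e)"
              by (intro add_mono mult_right_mono powr_ge_zero)
            moreover have "x * P + (- (c * t)) * Q = x * P - c * (Q * t)" for x P c t Q :: real
              by simp
            ultimately show ?thesis unfolding a_def[symmetric] by (simp add: mult.commute[of "a powr (1 - e)"])
          qed
          also have "\<dots> \<le> e / 2 * cF * W R powr (e - e) * (norm (F z) powr (p / (p - 1)) * a powr (- 1 - e) * \<theta> R z ^ k)
              + c0 / 2 powr q * (a powr (q - e) * \<theta> R z ^ k) + De (e / 2 * cF) (c0 / 2 powr q) * W R powr (q - e)"
            by (rule young_unscaled[OF p(1) k(1) De(2)[OF \<mu>e Me] R0 W0[OF R] RW[OF R] T_W De(1)[OF \<mu>e Me]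
                  norm_ge_zero a(2) \<theta>01])
          also have "\<dots> \<le> e / 2 * (X z * (a powr (- e - 1) * \<phi> R z)) + (G z * (a powr (- e) * \<phi> R z) + c0 * W R powr (q - e))
              + De (e / 2 * cF) (c0 / 2 powr q) * W R powr (q - e)"
          proof (intro add_mono order_refl)
            have "e / 2 * (cF * norm (F z) powr (p / (p - 1)) * (a powr (- e - 1) * \<phi> R z)) \<le> e / 2 * (X z * (a powr (- e - 1) * \<phi> R z))"
              using z e \<phi>01 by (intro mult_left_mono mult_right_mono) auto
            moreover have ex: "- 1 - e = - e - 1" by simp
            ultimately show "e / 2 * cF * W R powr (e - e) * (norm (F z) powr (p / (p - 1)) * a powr (- 1 - e) * \<theta> R z ^ k)
              \<le> e / 2 * (X z * (a powr (- e - 1) * \<phi> R z))"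
              unfolding ex using W0[OF R] by (simp add: \<phi>_def mult_ac)
            have "a powr (q - e) = a powr q * a powr (- e)" by (simp add: powr_add[symmetric])
            also have "\<dots> \<le> 2 powr q * (w z powr q + d powr q) * a powr (- e)"
              unfolding a_def using z d q by (intro mult_right_mono powr_sum_le) auto
            finally have "c0 / 2 powr q * a powr (q - e) \<le> c0 / 2 powr q * (2 powr q * (w z powr q + d powr q) * a powr (- e))"
              using c0 by (intro mult_left_mono) auto
            also have "\<dots> = c0 * w z powr q * a powr (- e) + c0 * (d powr q * a powr (- e))" by (simp add: algebra_simps)
            also have "\<dots> \<le> G z * a powr (- e) + c0 * W R powr (q - e)"
            proof (intro add_mono mult_right_mono mult_left_mono)
              have "d powr q * a powr (- e) \<le> d powr q * d powr (- e)"
                using a d e by (intro mult_left_mono powr_mono2') auto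
              also have "\<dots> = d powr (q - e)" by (simp add: powr_add[symmetric])
              also have "\<dots> \<le> W R powr (q - e)" using d e by (intro powr_mono2) auto
              finally show "d powr q * a powr (- e) \<le> W R powr (q - e)" .
            qed (use z c0 in auto)
            finally have "(c0 / 2 powr q * a powr (q - e)) * \<phi> R z \<le> (G z * a powr (- e) + c0 * W R powr (q - e)) * \<phi> R z"
              using \<phi>01 by (intro mult_right_mono) auto
            also have "\<dots> \<le> G z * a powr (- e) * \<phi> R z + c0 * W R powr (q - e) * 1"
              unfolding distrib_right using c0 \<phi>01 by (intro add_left_mono mult_left_mono) auto
            finally show "c0 / 2 powr q * (a powr (q - e) * \<theta> R z ^ k) \<le> G z * (a powr (- e) * \<phi> R z) + c0 * W R powr (q - e)"
              by (simp add: \<phi>_def mult_ac)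
          qed
          also have "\<dots> = ?U z" using True by (simp add: a_def E_def algebra_simps)
          finally show ?thesis .
        qed
      qed
    qed
    moreover have "integral\<^sup>L lebesgue ?U = e / 2 * I R d + (LINT z|lebesgue. G z * ((w z + d) powr (- e) * \<phi> R z)) + E * W R powr (q - e) * m R"
      using en' Ki[of R] by (simp add: I_def m_def Bochner_Integration.integral_add)
    moreover have "integral\<^sup>L lebesgue ?L = (LINT z|lebesgue. (\<Sum>i\<in>UNIV. F z $ i * \<phi>' R (space_dir i) z) * (w z + d) powr (- e))
        - 1 / (1 - e) * (LINT z|lebesgue. (w z + d) powr (1 - e) * \<phi>' R time_dir z)"
      using en' by (simp add: Bochner_Integration.integral_diff)
    ultimately show ?thesis using en' unfolding I_def by linarith
  qed
  define C where "C = 2 * E / e * Cn"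
  have C0: "0 < C" using E0 e Cn0 by (simp add: C_def)
  have dissipation: "W R powr e * I R d \<le> C" if R: "1 \<le> R" and d: "0 < d" "d \<le> W R" for R d
  proof -
    have "I R d \<le> 2 * E / e * (W R powr (q - e) * m R)"
      using step1[OF R d] e by (simp add: field_simps)
    then have "W R powr e * I R d \<le> W R powr e * (2 * E / e * (W R powr (q - e) * m R))"
      by (intro mult_left_mono) auto
    also have "\<dots> = 2 * E / e * ((W R powr e * W R powr (q - e)) * m R)" by simp
    also have "W R powr e * W R powr (q - e) = W R powr q" by (simp add: powr_add[symmetric])
    also have "2 * E / e * (W R powr q * m R) \<le> C"
      unfolding C_def using E0 e vol[OF R] by (intro mult_left_mono) auto
    finally show ?thesis .
  qed

  define N where "N = (\<lambda>R. LINT z|lebesgue. \<bar>w z\<bar> powr q * \<phi> R z)"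
  define NA where "NA = (\<lambda>R. LINT z|lebesgue. \<bar>w z\<bar> powr q * \<phi> R z * indicator (A R) z)"
  have Ab: "A R \<in> sets lebesgue" for R
  proof -
    have "open (A R)"
      unfolding A_def far_region_def by (intro open_Collect_disj open_Collect_less continuous_intros)
    then show ?thesis by auto
  qed
  have \<phi>c: "continuous_on UNIV (\<phi> R)" for R
    unfolding \<phi>_def \<theta>_def by (intro continuous_intros continuous_cutoff)
  have Ni: "integrable lebesgue (\<lambda>z. \<bar>w z\<bar> powr q * \<phi> R z)" if R: "1 \<le> R" for R
  proof -
    have "integrable lebesgue (\<lambda>z. indicator (K R) z * \<bar>w z\<bar> powr q * \<phi> R z)"
      by (rule integrable_mult_bounded[OF loc[OF Kc KS[OF R]] continuous_lebesgue_measurable[OF \<phi>c], of _ 1])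
         (use \<phi>01 in auto)
    also have "(\<lambda>z. indicator (K R) z * \<bar>w z\<bar> powr q * \<phi> R z) = (\<lambda>z. \<bar>w z\<bar> powr q * \<phi> R z)"
      using \<phi>0(1)[OF R] by (auto simp: indicator_def fun_eq_iff)
    finally show ?thesis .
  qed
  have NAi: "integrable lebesgue (\<lambda>z. \<bar>w z\<bar> powr q * \<phi> R z * indicator (A R) z)" if R: "1 \<le> R" for R
    by (rule integrable_mult_bounded[OF Ni[OF R], of _ 1]) (use Ab in auto)

  \<comment> \<open>Second step, with exponent 0: the bound does not depend on \<open>d\<close> any more, since \<open>d\<close> may be
    taken arbitrarily small for each fixed \<open>R\<close>.\<close>
  have step2: "c0 * N R \<le> \<mu> * C + M * 2 powr q * NA R + D (\<mu> * cF) M * Cn"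
    if R: "1 \<le> R" and \<mu>: "0 < \<mu>" and M: "0 < M" for R \<mu> M
  proof (rule field_le_epsilon)
    fix \<eta> :: real assume \<eta>: "0 < \<eta>"
    define Q where "Q = M * 2 powr q"
    have Q0: "0 < Q" using M by (simp add: Q_def)
    \<comment> \<open>Chosen so that \<open>Q d\<^sup>q m \<le> \<eta>\<close>, where \<open>m\<close> is the measure of the support.\<close>
    define d where "d = min (W R) ((\<eta> / (Q * (m R + 1))) powr (1 / q))"
    have pos: "0 < \<eta> / (Q * (m R + 1))" using \<eta> Q0 m0[of R] by (intro divide_pos_pos mult_pos_pos) auto
    have d: "0 < d" "d \<le> W R" using W0[OF R] pos by (auto simp: d_def)
    have root: "(x powr (1 / q)) powr q = x" if "0 < x" for x
      using that q(1) by (simp add: powr_powr)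
    have "d powr q \<le> ((\<eta> / (Q * (m R + 1))) powr (1 / q)) powr q"
      using d q by (intro powr_mono2) (auto simp: d_def)
    also have "\<dots> = \<eta> / (Q * (m R + 1))" by (rule root[OF pos])
    finally have "Q * d powr q * m R \<le> Q * (\<eta> / (Q * (m R + 1))) * m R"
      using Q0 m0[of R] by (intro mult_right_mono mult_left_mono) auto
    also have "\<dots> = \<eta> * (m R / (m R + 1))" using Q0 by simp
    also have "\<dots> \<le> \<eta> * 1" using \<eta> m0[of R] by (intro mult_left_mono) auto
    finally have dq: "Q * d powr q * m R \<le> \<eta>" by simp
    have \<mu>c: "0 < \<mu> * cF" using \<mu> cF by simp
    have R0: "0 < R" using R by simp
    have T_W: "T R = W R powr (1 - q)" by (simp add: T_def)
    note en0 = en[OF KS[OF R] C1[OF R] d(1) order_refl zero_less_one]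
    note en01 = en0[THEN conjunct1] and en03 = en0[THEN conjunct2, THEN conjunct2, THEN conjunct1]
      and en04 = en0[THEN conjunct2, THEN conjunct2, THEN conjunct2, THEN conjunct1]
      and en05 = en0[THEN conjunct2, THEN conjunct2, THEN conjunct2, THEN conjunct2]
    note ene = en[OF KS[OF R] C1[OF R] d(1) less_imp_le[OF e(1)] e(4)]
    let ?L = "\<lambda>z. (\<Sum>i\<in>UNIV. F z $ i * \<phi>' R (space_dir i) z) * (w z + d) powr (- 0)
        - 1 / (1 - 0) * ((w z + d) powr (1 - 0) * \<phi>' R time_dir z)"
    let ?U = "\<lambda>z. \<mu> * W R powr e * (X z * ((w z + d) powr (- e - 1) * \<phi> R z)) + Q * (\<bar>w z\<bar> powr q * \<phi> R z * indicator (A R) z)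
        + (Q * d powr q + D (\<mu> * cF) M * W R powr q) * indicator (K R) z"
    have "integral\<^sup>L lebesgue ?L \<le> integral\<^sup>L lebesgue ?U"
    proof (rule integral_mono_AE)
      show "integrable lebesgue ?L"
        by (intro Bochner_Integration.integrable_diff integrable_mult_right en03 en04)
      show "integrable lebesgue ?U" using ene Ki NAi[OF R] by auto
      show "AE z in lebesgue. ?L z \<le> ?U z"
        using AE0
      proof eventually_elim
        case (elim z)
        show ?case
        proof (cases "z \<in> K R")
          case False
          then show ?thesis using \<phi>0[OF R] by simp
        next
          case True
          then have z: "0 \<le> w z" "c0 * w z powr q \<le> G z" "cF * norm (F z) powr (p / (p - 1)) \<le> X z"
            using elim KS[OF R] by auto
          have X0: "0 \<le> X z" using z(3) cF by (meson mult_nonneg_nonneg less_imp_le order_trans powr_ge_zero)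
          define a where "a = w z + d"
          have a: "d \<le> a" "0 < a" using z d by (auto simp: a_def)
          have Dn: "0 \<le> D (\<mu> * cF) M" using D(1) \<mu> cF M by simp
          have "?L z \<le> (\<kappa> / R * \<theta> R z ^ (k - 1) * norm (F z) * a powr (- 0) + \<kappa> / T R * \<theta> R z ^ (k - 1) * a powr (1 - 0)) * indicator (A R) z"
          proof -
            have ineq: "(\<Sum>i\<in>UNIV. F z $ i * \<phi>' R (space_dir i) z) * a powr (- 0) + (- (1 * \<phi>' R time_dir z)) * a powr (1 - 0)
              \<le> (\<kappa> / R * \<theta> R z ^ (k - 1) * norm (F z) * indicator (A R) z) * a powr (- 0) + (\<kappa> / T R * \<theta> R z ^ (k - 1) * indicator (A R) z) * a powr (1 - 0)"
              using \<kappa>2(2) by (intro add_mono mult_right_mono flux time R powr_ge_zero) simp_all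
            have e1: "(x * i) * P + (t * i) * Q = (x * P + t * Q) * i" for x i P t Q :: real
              by (simp add: algebra_simps)
            have e2: "x * P + (- (1 * t)) * Q = x * P - 1 / (1 - 0) * (Q * t)" for x P t Q :: real
              by simp
            show ?thesis unfolding a_def[symmetric] using ineq unfolding e1 e2 .
          qed
          also have "\<dots> \<le> (\<mu> * cF * W R powr (e - 0) * (norm (F z) powr (p / (p - 1)) * a powr (- 1 - e) * \<theta> R z ^ k)
              + M * (a powr (q - 0) * \<theta> R z ^ k) + D (\<mu> * cF) M * W R powr (q - 0)) * indicator (A R) z"
          proof (rule mult_right_mono)
            show "\<kappa> / R * \<theta> R z ^ (k - 1) * norm (F z) * a powr (- 0) + \<kappa> / T R * \<theta> R z ^ (k - 1) * a powr (1 - 0)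
              \<le> \<mu> * cF * W R powr (e - 0) * (norm (F z) powr (p / (p - 1)) * a powr (- 1 - e) * \<theta> R z ^ k)
              + M * (a powr (q - 0) * \<theta> R z ^ k) + D (\<mu> * cF) M * W R powr (q - 0)"
              by (rule young_unscaled[OF p(1) k(1) D(2)[OF \<mu>c M] R0 W0[OF R] RW[OF R] T_W Dn norm_ge_zero a(2) \<theta>01])
          qed simp
          also have "\<dots> \<le> ?U z"
          proof -
            have 1: "\<mu> * cF * W R powr (e - 0) * (norm (F z) powr (p / (p - 1)) * a powr (- 1 - e) * \<theta> R z ^ k)
              \<le> \<mu> * W R powr e * (X z * (a powr (- e - 1) * \<phi> R z))"
            proof -
              have "\<mu> * W R powr e * (cF * norm (F z) powr (p / (p - 1)) * (a powr (- e - 1) * \<phi> R z)) \<le> \<mu> * W R powr e * (X z * (a powr (- e - 1) * \<phi> R z))"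
                using z \<mu> \<phi>01 by (intro mult_left_mono mult_right_mono) auto
              moreover have ex: "- 1 - e = - e - 1" by simp
              ultimately show ?thesis unfolding ex by (simp add: \<phi>_def mult_ac)
            qed
            have "a powr q \<le> 2 powr q * (w z powr q + d powr q)"
              unfolding a_def using z d q by (intro powr_sum_le) auto
            then have "M * (a powr q * \<phi> R z) \<le> M * (2 powr q * (w z powr q + d powr q) * \<phi> R z)"
              using M \<phi>01 by (intro mult_left_mono mult_right_mono) auto
            also have "\<dots> = Q * (\<bar>w z\<bar> powr q * \<phi> R z) + Q * d powr q * \<phi> R z"
              using z by (simp add: Q_def algebra_simps)
            also have "\<dots> \<le> Q * (\<bar>w z\<bar> powr q * \<phi> R z) + Q * d powr q * 1"
              using Q0 \<phi>01 by (intro add_left_mono mult_left_mono) auto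
            finally have 2: "M * (a powr (q - 0) * \<theta> R z ^ k) \<le> Q * (\<bar>w z\<bar> powr q * \<phi> R z) + Q * d powr q"
              by (simp add: \<phi>_def)
            have 3: "0 \<le> \<mu> * W R powr e * (X z * (a powr (- e - 1) * \<phi> R z))"
              using \<mu> X0 \<phi>01 by (intro mult_nonneg_nonneg) auto
            have 4: "0 \<le> Q * d powr q" "0 \<le> D (\<mu> * cF) M * W R powr q" using Q0 Dn by auto
            show ?thesis
            proof (cases "z \<in> A R")
              case True
              then show ?thesis using 1 2 \<open>z \<in> K R\<close> by (simp add: a_def)
            next
              case False
              then show ?thesis using 3 4 \<open>z \<in> K R\<close> by (simp add: a_def)
            qed
          qed
          finally show ?thesis .
        qed
      qed
    qed
    moreover have "integral\<^sup>L lebesgue ?U = \<mu> * W R powr e * I R d + Q * NA R + (Q * d powr q + D (\<mu> * cF) M * W R powr q) * m R"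
      using ene Ki[of R] NAi[OF R] by (simp add: I_def NA_def m_def Bochner_Integration.integral_add)
    moreover have "integral\<^sup>L lebesgue ?L = (LINT z|lebesgue. (\<Sum>i\<in>UNIV. F z $ i * \<phi>' R (space_dir i) z) * (w z + d) powr (- 0))
        - 1 / (1 - 0) * (LINT z|lebesgue. (w z + d) powr (1 - 0) * \<phi>' R time_dir z)"
    proof -
      have "integrable lebesgue (\<lambda>z. (\<Sum>i\<in>UNIV. F z $ i * \<phi>' R (space_dir i) z) * (w z + d) powr (- 0))"
        "integrable lebesgue (\<lambda>z. 1 / (1 - 0) * ((w z + d) powr (1 - 0) * \<phi>' R time_dir z))"
        by (intro integrable_mult_right en03 en04)+
      from Bochner_Integration.integral_diff[OF this] show ?thesis by simp
    qed
    moreover have "c0 * N R \<le> (LINT z|lebesgue. G z * ((w z + d) powr (- 0) * \<phi> R z))"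
    proof -
      have "c0 * N R = (LINT z|lebesgue. c0 * (\<bar>w z\<bar> powr q * \<phi> R z))" by (simp add: N_def)
      also have "\<dots> \<le> (LINT z|lebesgue. G z * ((w z + d) powr (- 0) * \<phi> R z))"
      proof (rule integral_mono_AE)
        show "integrable lebesgue (\<lambda>z. c0 * (\<bar>w z\<bar> powr q * \<phi> R z))" by (intro integrable_mult_right Ni R)
        show "integrable lebesgue (\<lambda>z. G z * ((w z + d) powr (- 0) * \<phi> R z))" by (rule en01)
        show "AE z in lebesgue. c0 * (\<bar>w z\<bar> powr q * \<phi> R z) \<le> G z * ((w z + d) powr (- 0) * \<phi> R z)"
          using AE0
        proof eventually_elim
          case (elim z)
          show ?case
          proof (cases "z \<in> K R")
            case False
            then show ?thesis using \<phi>0[OF R] by simp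
          next
            case True
            then have z: "0 \<le> w z" "c0 * w z powr q \<le> G z" using elim KS[OF R] by auto
            then have "c0 * w z powr q * \<phi> R z \<le> G z * \<phi> R z" using \<phi>01 by (intro mult_right_mono) auto
            then show ?thesis using z d by (simp add: mult.assoc)
          qed
        qed
      qed
      finally show ?thesis .
    qed
    ultimately have "c0 * N R \<le> \<mu> * W R powr e * I R d + Q * NA R + (Q * d powr q + D (\<mu> * cF) M * W R powr q) * m R"
      using en05 by linarith
    also have "\<dots> = \<mu> * (W R powr e * I R d) + Q * NA R + D (\<mu> * cF) M * (W R powr q * m R) + Q * d powr q * m R"
      by (simp add: algebra_simps)
    also have "\<dots> \<le> \<mu> * C + Q * NA R + D (\<mu> * cF) M * Cn + \<eta>"
      using Q0 \<mu> M cF D(1) dissipation[OF R d] vol[OF R] dq by (intro add_mono mult_left_mono) auto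
    finally show "c0 * N R \<le> \<mu> * C + M * 2 powr q * NA R + D (\<mu> * cF) M * Cn + \<eta>" by (simp add: Q_def)
  qed

  \<comment> \<open>The radii run through the positive integers; every point of the half-space eventually lies
    where the cutoff is 1.\<close>
  define r where "r = (\<lambda>i::nat. real (Suc i))"
  have r1: "1 \<le> r i" for i by (simp add: r_def)
  have ev: "\<forall>\<^sub>F i in sequentially. c \<le> r i" for c
  proof -
    obtain n :: nat where "c \<le> real n" using real_arch_simple by blast
    then show ?thesis unfolding eventually_sequentially r_def by (intro exI[of _ n]) auto
  qed
  have evz: "\<forall>\<^sub>F i in sequentially. \<phi> (r i) z = 1 \<and> z \<notin> A (r i)" if z: "z \<in> ?S" for z
  proof -
    have t: "0 < fst z" using z by (auto simp: half_space_def)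
    define b where "b = p / \<sigma> * (q - 1)"
    have b: "0 < b" using p q \<sigma> by (simp add: b_def)
    show ?thesis
      using ev[of "2 / fst z"] ev[of "fst z powr (1 / b)"] ev[of "norm (snd z)"]
    proof eventually_elim
      case (elim i)
      have "(fst z powr (1 / b)) powr b \<le> r i powr b" using elim(2) b by (intro powr_mono2) auto
      moreover have "(fst z powr (1 / b)) powr b = fst z" using t b by (simp add: powr_powr)
      moreover have "T (r i) = r i powr b" unfolding b_def by (rule T_eq[OF r1])
      ultimately have tT: "fst z \<le> T (r i)" by simp
      have T0: "0 < T (r i)" using T1[OF r1[of i]] by linarith
      have r0: "0 < r i" using r1[of i] by linarith
      have 1: "plateau (r i * fst z) = 0" using elim(1) t by (intro plateau_eq_0) (simp add: field_simps)
      have 2: "plateau (fst z / T (r i)) = 1" using tT T0 by (intro plateau_eq) (simp add: field_simps)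
      have "(norm (snd z))\<^sup>2 \<le> (r i)\<^sup>2" using elim(3) by (intro power_mono) auto
      then have 3: "plateau ((norm (snd z))\<^sup>2 / (r i)\<^sup>2) = 1" using r0 by (intro plateau_eq) (simp add: field_simps)
      show ?case using 1 2 3 tT elim(3) by (simp add: \<phi>_def \<theta>_def cutoff_def A_def far_region_def)
    qed
  qed
  define J where "J = (\<lambda>z. indicator ?S z * \<bar>w z\<bar> powr q)"
  define h where "h = (\<lambda>i z. \<bar>w z\<bar> powr q * \<phi> (r i) z)"
  have off: "\<phi> (r i) z = 0" if "z \<notin> ?S" for i z
    using \<phi>0(1)[OF r1] KS[OF r1] that by blast
  have J0: "0 \<le> J z" for z by (simp add: J_def)
  have hJ: "0 \<le> h i z" "h i z \<le> J z" for i z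
  proof -
    show "0 \<le> h i z" using \<phi>01 by (simp add: h_def)
    show "h i z \<le> J z"
      using off[of z i] mult_left_mono[OF \<phi>01(2)[of "r i" z], of "\<bar>w z\<bar> powr q"] by (cases "z \<in> ?S") (auto simp: h_def J_def)
  qed
  have hlim: "(\<lambda>i. h i z) \<longlonglongrightarrow> J z" for z
  proof (cases "z \<in> ?S")
    case True
    have "\<forall>\<^sub>F i in sequentially. h i z = J z"
      using evz[OF True] by eventually_elim (use True in \<open>simp add: h_def J_def\<close>)
    then show ?thesis by (rule tendsto_eventually)
  qed (simp add: h_def J_def off)
  have Nh: "N (r i) = integral\<^sup>L lebesgue (h i)" for i by (simp add: N_def h_def)
  have hi: "integrable lebesgue (h i)" for i unfolding h_def by (rule Ni[OF r1])
  have Jm: "J \<in> borel_measurable lebesgue"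
    by (rule borel_measurable_LIMSEQ_real[OF hlim]) (use hi in auto)
  have NA0: "0 \<le> NA R" for R unfolding NA_def using \<phi>01 by (intro Bochner_Integration.integral_nonneg) auto
  have NAN: "NA R \<le> N R" if "1 \<le> R" for R
    unfolding NA_def N_def
  proof (rule Bochner_Integration.integral_mono[OF NAi[OF that] Ni[OF that]])
    show "\<bar>w z\<bar> powr q * \<phi> R z * indicator (A R) z \<le> \<bar>w z\<bar> powr q * \<phi> R z" for z
      using \<phi>01 by (auto simp: indicator_def)
  qed
  \<comment> \<open>With this \<open>M\<close> half of the left-hand side absorbs the far integral.\<close>
  define M1 where "M1 = c0 / (2 * 2 powr q)"
  define C3 where "C3 = 2 / c0 * (C + D cF M1 * Cn)"
  have bound: "N R \<le> C3" if R: "1 \<le> R" for R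
  proof -
    have M1: "0 < M1" "M1 * 2 powr q = c0 / 2" using c0 by (simp_all add: M1_def)
    have "c0 * N R \<le> 1 * C + M1 * 2 powr q * NA R + D (1 * cF) M1 * Cn"
      by (rule step2[OF R zero_less_one M1(1)])
    moreover have "c0 / 2 * NA R \<le> c0 / 2 * N R" using NAN[OF R] c0 by (intro mult_left_mono) auto
    ultimately have "c0 * N R \<le> C + c0 / 2 * N R + D cF M1 * Cn" unfolding M1(2) mult_1 by linarith
    then show ?thesis using c0 by (simp add: C3_def field_simps)
  qed
  have Ji: "integrable lebesgue J"
  proof (rule integrableI_nonneg[OF Jm])
    show "AE z in lebesgue. 0 \<le> J z" using J0 by simp
    have "(\<integral>\<^sup>+z. ennreal (J z) \<partial>lebesgue) = (\<integral>\<^sup>+z. liminf (\<lambda>i. ennreal (h i z)) \<partial>lebesgue)"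
      using lim_imp_Liminf[OF _ tendsto_ennrealI[OF hlim]] by simp
    also have "\<dots> \<le> liminf (\<lambda>i. \<integral>\<^sup>+z. ennreal (h i z) \<partial>lebesgue)"
      by (rule nn_integral_liminf) (use hi in auto)
    also have "\<dots> \<le> liminf (\<lambda>i::nat. ennreal C3)"
    proof (rule Liminf_mono, intro always_eventually allI)
      fix i
      have "(\<integral>\<^sup>+z. ennreal (h i z) \<partial>lebesgue) = ennreal (N (r i))"
        unfolding Nh by (rule nn_integral_eq_integral[OF hi]) (use hJ in auto)
      then show "(\<integral>\<^sup>+z. ennreal (h i z) \<partial>lebesgue) \<le> ennreal C3" using bound[OF r1] by (simp add: ennreal_leI)
    qed
    also have "\<dots> = ennreal C3" by (simp add: Liminf_const)
    finally show "(\<integral>\<^sup>+z. ennreal (J z) \<partial>lebesgue) < \<infinity>" using le_less_trans ennreal_less_top by (metis infinity_ennreal_def)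
  qed
  have Nlim: "(\<lambda>i. N (r i)) \<longlonglongrightarrow> integral\<^sup>L lebesgue J"
    unfolding Nh
    by (rule integral_dominated_convergence[where w = J]) (use Jm Ji hi hJ hlim in auto)
  have NAlim: "(\<lambda>i. NA (r i)) \<longlonglongrightarrow> 0"
  proof -
    have "(\<lambda>i. NA (r i)) \<longlonglongrightarrow> (LINT z|(lebesgue :: (real \<times> (real ^ 'n)) measure). (0::real))"
      unfolding NA_def
    proof (rule integral_dominated_convergence[where w = J])
      show "AE z in lebesgue. (\<lambda>i. \<bar>w z\<bar> powr q * \<phi> (r i) z * indicator (A (r i)) z) \<longlonglongrightarrow> 0"
      proof (rule AE_I2)
        fix z
        show "(\<lambda>i. \<bar>w z\<bar> powr q * \<phi> (r i) z * indicator (A (r i)) z) \<longlonglongrightarrow> 0"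
        proof (cases "z \<in> ?S")
          case True
          have "\<forall>\<^sub>F i in sequentially. \<bar>w z\<bar> powr q * \<phi> (r i) z * indicator (A (r i)) z = 0"
            using evz[OF True] by eventually_elim simp
          then show ?thesis by (rule tendsto_eventually)
        qed (simp add: off)
      qed
      show "AE z in lebesgue. norm (\<bar>w z\<bar> powr q * \<phi> (r i) z * indicator (A (r i)) z) \<le> J z" for i
        using hJ[of i] J0 unfolding h_def by (intro AE_I2) (auto simp: indicator_def)
      show "(\<lambda>z. \<bar>w z\<bar> powr q * \<phi> (r i) z * indicator (A (r i)) z) \<in> borel_measurable lebesgue" for i
        by (rule borel_measurable_integrable[OF NAi[OF r1]])
    qed (use Ji in auto)
    then show ?thesis by simp
  qed
  have lim1: "c0 * integral\<^sup>L lebesgue J \<le> \<mu> * C + D (\<mu> * cF) M * Cn" if \<mu>: "0 < \<mu>" and M: "0 < M" for \<mu> M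
  proof -
    have "(\<lambda>i. \<mu> * C + M * 2 powr q * NA (r i) + D (\<mu> * cF) M * Cn) \<longlonglongrightarrow> \<mu> * C + M * 2 powr q * 0 + D (\<mu> * cF) M * Cn"
      by (intro tendsto_intros NAlim)
    then have "c0 * integral\<^sup>L lebesgue J \<le> \<mu> * C + M * 2 powr q * 0 + D (\<mu> * cF) M * Cn"
      by (rule LIMSEQ_le[OF tendsto_mult_left[OF Nlim]]) (use step2[OF r1 \<mu> M] in blast)
    then show ?thesis by simp
  qed
  have lim2: "c0 * integral\<^sup>L lebesgue J \<le> \<mu> * C" if \<mu>: "0 < \<mu>" for \<mu>
  proof -
    have "((\<lambda>M. \<mu> * C + D (\<mu> * cF) M * Cn) \<longlongrightarrow> \<mu> * C + 0 * Cn) at_top"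
      using \<mu> cF by (intro tendsto_intros D(3)) auto
    moreover have "\<forall>\<^sub>F M in at_top. c0 * integral\<^sup>L lebesgue J \<le> \<mu> * C + D (\<mu> * cF) M * Cn"
      using eventually_gt_at_top[of "0::real"] by eventually_elim (rule lim1[OF \<mu>])
    ultimately have "c0 * integral\<^sup>L lebesgue J \<le> \<mu> * C + 0 * Cn"
      by (rule tendsto_lowerbound) simp
    then show ?thesis by simp
  qed
  have "integral\<^sup>L lebesgue J \<le> 0"
  proof (rule ccontr)
    assume "\<not> integral\<^sup>L lebesgue J \<le> 0"
    then have P: "0 < c0 * integral\<^sup>L lebesgue J" using c0 by simp
    have "c0 * integral\<^sup>L lebesgue J \<le> (c0 * integral\<^sup>L lebesgue J / (2 * C)) * C"
      using P C0 by (intro lim2) simp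
    then show False using P C0 by simp
  qed
  then have "integral\<^sup>L lebesgue J = 0"
    using Bochner_Integration.integral_nonneg[of lebesgue J] J0 by (simp add: order_antisym)
  then have "AE z in lebesgue. J z = 0"
    using integral_nonneg_eq_0_iff_AE[OF Ji] J0 by simp
  then show ?thesis
    by eventually_elim (auto simp: J_def)
qed

theorem theorem2:
  fixes p q :: real
    and u v :: "real \<times> (real ^ 'n) \<Rightarrow> real"
    and u0 v0 :: "real ^ 'n \<Rightarrow> real"
    and IC :: "(real \<times> (real ^ 'n) \<Rightarrow> real) \<Rightarrow> (real ^ 'n \<Rightarrow> real) \<Rightarrow> bool"
  assumes "1 < p" and "p \<le> 2"
    and "1 < q" and "q \<le> p - 1 + p / real CARD('n)"
    and "cauchy_supersolution IC p q u0 u"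
    and "cauchy_subsolution IC p q v0 v"
    and "AE z in lebesgue_on half_space. u z \<ge> v z"
  shows "AE z in lebesgue_on half_space. u z = v z"
proof -
  have "entire_weak_supersolution p q u" "entire_weak_subsolution p q v"
    using assms by (auto simp: cauchy_supersolution_def cauchy_subsolution_def)
  then have "AE z in lebesgue. z \<in> half_space \<longrightarrow> u z - v z = 0"
  proof (rule solution_pair_energy[OF assms(1-3) _ _ assms(7)], goal_cases)
    case (1 G X F)
    show ?case
      by (rule energy_estimate_imp_zero[where w = "\<lambda>z. u z - v z", OF assms(1-4) _ _ 1]) auto
  qed
  then have "AE z in lebesgue. z \<in> half_space \<longrightarrow> u z = v z" by eventually_elim auto
  moreover have "open (half_space :: (real \<times> (real ^ 'n)) set)" by (rule open_half_space)
  then have "(half_space :: (real \<times> (real ^ 'n)) set) \<in> sets lebesgue" by auto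
  ultimately show ?thesis by (simp add: AE_restrict_space_iff)
qed

end
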